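(* (1) The map $\phi$ induces a one-one correspondence $H\mapsto\phi(H)$ between the finite index subgroups of $F$ and the finite index subgroups of $\mathbb{Z}^2$. (2) Suppose $H$ is a finite index subgroup of $F$, with image $\tilde H=\phi(H)\le\mathbb{Z}^2$, and let $a$ and $b$ be positive integers such that $\operatorname{Inner}(H)=K_{(a,b)}\le H$. Let $Q=\tilde H/\tilde K_{(a,b)}$. Then $Q$ is finite cyclic, $K_{(a,b)}\cong F$, and there are homomorphisms $\iota:K_{(a,b)}\to H$, $\rho:H\to Q$, $\tilde\iota:\tilde K_{(a,b)}\to\tilde H$ and $\tilde\rho:\tilde H\to Q$ such that the rows $$1\to K_{(a,b)}\xrightarrow{\ \iota\ }H\xrightarrow{\ \rho\ }Q\to 1,\qquad 1\to\tilde K_{(a,b)}\xrightarrow{\ \tilde\iota\ }\tilde H\xrightarrow{\ \tilde\rho\ }Q\to 1$$ are exact and the diagram formed by these two rows and the vertical maps $\phi|_{K_{(a,b)}}:K_{(a,b)}\to\tilde K_{(a,b)}$, $\phi|_H:H\to\tilde H$ and $\mathrm{id}_Q:Q\to Q$ commutes, i.e. $\phi|_H\circ\iota=\tilde\iota\circ\phi|_{K_{(a,b)}}$ and $\rho=\tilde\rho\circ\phi|_H$.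
   Context: $F$ (R. Thompson's group $F$) is the group, under composition, of all piecewise-linear, orientation-preserving homeomorphisms of $[0,1]$ which admit finitely many breaks in slope, all breaks occurring over dyadic rationals (elements of $\mathbb{Z}[1/2]$), and all of whose affine pieces have slopes that are integral powers of $2$. For $f\in F$, $f'(0)$ denotes the right derivative at $0$ and $f'(1)$ the left derivative at $1$. The homomorphism $\phi:F\to\mathbb{Z}^2$ is defined by $\phi(f)=(\log_2 f'(0),\log_2 f'(1))$. For positive integers $a,b$, $\tilde K_{(a,b)}=\langle (a,0),(0,b)\rangle\le\mathbb{Z}^2$ and $K_{(a,b)}=\phi^{-1}(\tilde K_{(a,b)})\le F$; the groups $K_{(a,b)}$ are called rectangular subgroups of $F$. For a finite index subgroup $H$ of $F$, $\operatorname{Inner}(H)$ denotes the unique maximal (with respect to inclusion) rectangular subgroup contained in $H$ (it exists for every finite index $H$). *)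

theory Defs
  imports "HOL-Analysis.Analysis" "HOL-Algebra.Bij" "HOL-Algebra.Elementary_Groups"
begin

definition dyadic :: "real set" where
  "dyadic = {of_int m / 2 ^ n | (m::int) (n::nat). True}"

text \<open>The set \<open>B\<close> contains all breaks of \<open>f\<close>: on every closed interval with no point of \<open>B\<close> in its
  interior, \<open>f\<close> is affine, with slope an integral power of 2.\<close>

definition PL2_breaks_in :: "real set \<Rightarrow> (real \<Rightarrow> real) \<Rightarrow> bool" where
  "PL2_breaks_in B f \<longleftrightarrow>
     (\<forall>x y. 0 \<le> x \<longrightarrow> x < y \<longrightarrow> y \<le> 1 \<longrightarrow> {x<..<y} \<inter> B = {} \<longrightarrow>
        (\<exists>(k::int) c. \<forall>t\<in>{x..y}. f t = 2 powi k * t + c))"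

text \<open>As in \<^const>\<open>BijGroup\<close>, self-maps of \<open>[0,1]\<close> are represented by functions that take the
  value \<^term>\<open>undefined\<close> outside \<open>[0,1]\<close>.\<close>

definition thompson_carrier :: "(real \<Rightarrow> real) set" where
  "thompson_carrier =
     {f \<in> extensional {0..1}.
        (\<exists>g. homeomorphism {0..1} {0..1} f g) \<and> strict_mono_on {0..1} f \<and>
        (\<exists>B. finite B \<and> B \<subseteq> dyadic \<and> PL2_breaks_in B f)}"

definition thompson_F :: "(real \<Rightarrow> real) monoid" where
  "thompson_F = (BijGroup {0..1})\<lparr>carrier := thompson_carrier\<rparr>"

definition Z2 :: "(int \<times> int) monoid" where
  "Z2 = integer_group \<times>\<times> integer_group"

text \<open>The floor only converts to \<^typ>\<open>int\<close>: on \<open>F\<close> both logarithms are integers, see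
  \<open>phi_eq_log\<close> below.\<close>

definition phi :: "(real \<Rightarrow> real) \<Rightarrow> int \<times> int" where
  "phi f = (\<lfloor>log 2 (vector_derivative f (at_right 0))\<rfloor>, \<lfloor>log 2 (vector_derivative f (at_left 1))\<rfloor>)"

definition Ktilde :: "int \<Rightarrow> int \<Rightarrow> (int \<times> int) set" where
  "Ktilde a b = generate Z2 {(a, 0), (0, b)}"

definition K :: "int \<Rightarrow> int \<Rightarrow> (real \<Rightarrow> real) set" where
  "K a b = {f \<in> carrier thompson_F. phi f \<in> Ktilde a b}"

definition rectangular :: "(real \<Rightarrow> real) set \<Rightarrow> bool" where
  "rectangular R \<longleftrightarrow> (\<exists>a b. a > 0 \<and> b > 0 \<and> R = K a b)"

definition finite_index_subgroup :: "'a set \<Rightarrow> ('a, 'm) monoid_scheme \<Rightarrow> bool" where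
  "finite_index_subgroup H G \<longleftrightarrow> subgroup H G \<and> finite (rcosets\<^bsub>G\<^esub> H)"

definition Inner :: "(real \<Rightarrow> real) set \<Rightarrow> (real \<Rightarrow> real) set" where
  "Inner H = (THE R. rectangular R \<and> R \<subseteq> H \<and> (\<forall>R'. rectangular R' \<longrightarrow> R' \<subseteq> H \<longrightarrow> \<not> R \<subset> R'))"

text \<open>Exactness of \<open>1 \<rightarrow> A \<rightarrow> B \<rightarrow> C \<rightarrow> 1\<close>. The inductive predicate in \<open>HOL-Algebra.Exact_Sequence\<close> requires all groups
  to have the same element type.\<close>

definition short_exact ::
  "('a, 'm) monoid_scheme \<Rightarrow> ('a \<Rightarrow> 'b) \<Rightarrow> ('b, 'n) monoid_scheme \<Rightarrow> ('b \<Rightarrow> 'c) \<Rightarrow> ('c, 'k) monoid_scheme \<Rightarrow> bool"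
  where
  "short_exact A f B g C \<longleftrightarrow>
     group_hom A B f \<and> group_hom B C g \<and>
     kernel A B f = {\<one>\<^bsub>A\<^esub>} \<and> f ` carrier A = kernel B C g \<and> g ` carrier B = carrier C"

lemma finite_gap_right:
  fixes B :: "real set"
  assumes "finite B"
  shows "\<exists>y. 0 < y \<and> y \<le> 1 \<and> {0<..<y} \<inter> B = {}"
proof -
  let ?S = "insert 1 (B \<inter> {0<..})"
  have fin: "finite ?S" using assms by simp
  have "0 < Min ?S" using fin by (subst Min_gr_iff) auto
  moreover have "Min ?S \<le> 1" using fin by (simp add: Min_le)
  moreover have "{0<..<Min ?S} \<inter> B = {}"
  proof (rule ccontr)
    assume "{0<..<Min ?S} \<inter> B \<noteq> {}"
    then obtain z where z: "0 < z" "z < Min ?S" "z \<in> B" by auto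
    with fin have "Min ?S \<le> z" by (intro Min_le) auto
    with z show False by linarith
  qed
  ultimately show ?thesis by blast
qed

lemma finite_gap_left:
  fixes B :: "real set"
  assumes "finite B"
  shows "\<exists>x. 0 \<le> x \<and> x < 1 \<and> {x<..<1} \<inter> B = {}"
proof -
  obtain y where y: "0 < y" "y \<le> 1" "{0<..<y} \<inter> ((\<lambda>t. 1 - t) ` B) = {}"
    using finite_gap_right[of "(\<lambda>t. 1 - t) ` B"] assms by auto
  have "{1 - y<..<1} \<inter> B = {}"
  proof (rule ccontr)
    assume "{1 - y<..<1} \<inter> B \<noteq> {}"
    then obtain z where z: "1 - y < z" "z < 1" "z \<in> B" by auto
    then have "1 - z \<in> {0<..<y} \<inter> ((\<lambda>t. 1 - t) ` B)" by auto
    with y show False by blast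
  qed
  with y show ?thesis by (intro exI[of _ "1 - y"]) auto
qed

lemma vector_derivative_affine:
  fixes f :: "real \<Rightarrow> real"
  assumes f: "\<forall>t\<in>{x..y}. f t = m * t + c" and "x < y" "z \<in> {x..y}"
  shows "vector_derivative f (at z within {x..y}) = m"
proof -
  have "((\<lambda>t. m * t + c) has_vector_derivative m) (at z within {x..y})"
    by (auto intro!: derivative_eq_intros simp: has_real_derivative_iff_has_vector_derivative[symmetric])
  then have "(f has_vector_derivative m) (at z within {x..y})"
    by (rule has_vector_derivative_transform[rotated 2]) (use assms in auto)
  then show ?thesis
    using assms by (intro vector_derivative_within_cbox[of x y, unfolded cbox_interval])
qed

lemma phi_eq_log:
  assumes "f \<in> carrier thompson_F"
  shows "real_of_int (fst (phi f)) = log 2 (vector_derivative f (at_right 0))"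
    and "real_of_int (snd (phi f)) = log 2 (vector_derivative f (at_left 1))"
proof -
  from assms obtain B where B: "finite B" "PL2_breaks_in B f"
    by (auto simp: thompson_F_def thompson_carrier_def)
  obtain y where y: "0 < y" "y \<le> 1" "{0<..<y} \<inter> B = {}"
    using finite_gap_right[OF B(1)] by blast
  obtain x where x: "0 \<le> x" "x < 1" "{x<..<1} \<inter> B = {}"
    using finite_gap_left[OF B(1)] by blast
  obtain k :: int and c where k: "\<forall>t\<in>{0..y}. f t = 2 powi k * t + c"
    using B(2) y unfolding PL2_breaks_in_def by (metis order_refl)
  obtain l :: int and d where l: "\<forall>t\<in>{x..1}. f t = 2 powi l * t + d"
    using B(2) x unfolding PL2_breaks_in_def by (metis order_refl)
  have "vector_derivative f (at_right 0) = 2 powi k"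
    using vector_derivative_affine[OF k, of 0] at_within_Icc_at_right[of 0 y] y by simp
  then show "real_of_int (fst (phi f)) = log 2 (vector_derivative f (at_right 0))"
    by (simp add: phi_def powr_real_of_int'[symmetric])
  have "vector_derivative f (at_left 1) = 2 powi l"
    using vector_derivative_affine[OF l, of 1] at_within_Icc_at_left[of x 1] x by simp
  then show "real_of_int (snd (phi f)) = log 2 (vector_derivative f (at_left 1))"
    by (simp add: phi_def powr_real_of_int'[symmetric])
qed

end

theory Submission
  imports Defs "HOL-Algebra.Multiplicative_Group"
begin

text \<open>
  Two facts about \<open>F\<close> carry the theorem; what remains is elementary algebra in \<open>\<int>\<^sup>2\<close>.

  First, every homomorphism \<open>\<psi>\<close> from \<open>F\<close> to a finite group kills the kernel of \<open>\<phi>\<close>, which consists of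
  the elements that are the identity near \<open>0\<close> and near \<open>1\<close> (\<open>ker_phi_trivial\<close>). Applied to the action
  of \<open>F\<close> on the cosets of \<open>H\<close>, this says that a subgroup \<open>H\<close> of finite index contains \<open>ker \<phi>\<close>. As
  \<open>\<phi>\<close> is onto \<open>\<int>\<^sup>2\<close>, part (1) follows, and \<open>H\<close> is the preimage of \<open>\<phi>(H)\<close>. The proof has three steps.

  \<^item> The image \<open>\<psi>(ker \<phi>)\<close> is abelian. If \<open>m\<close> is the order of the target, then \<open>\<psi>(f\<^sup>m) = 1\<close> for every
    \<open>f\<close>, and \<open>f\<close> may be chosen so that \<open>f\<^sup>m\<close> pushes the support of one given element of \<open>ker \<phi>\<close> off the
    support of another; the conjugate commutes with the other element and has the same image.
  \<^item> Implant \<open>f \<in> F\<close> into a dyadic interval inside \<open>(0,1)\<close>. By the first step \<open>\<psi>\<close> of the implanted copy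
    does not depend on the interval, which gives a homomorphism \<open>\<mu>\<close> on all of \<open>F\<close> with
    \<open>\<mu>(f \<oplus> 1) = \<mu>(1 \<oplus> f) = \<mu>(f)\<close>, where \<open>f \<oplus> g\<close> acts by \<open>f\<close> on the left half of \<open>[0,1]\<close> and by \<open>g\<close>
    on the right half. Let \<open>x\<close> rebracket \<open>(AB)C\<close> to \<open>A(BC)\<close>. The pentagon identity
    \<open>x x = (1 \<oplus> x) x (x \<oplus> 1)\<close> yields \<open>\<mu>(x)\<^sup>2 = \<mu>(x)\<^sup>3\<close>, so \<open>\<mu>(x) = 1\<close>.
  \<^item> An element of \<open>F\<close> carries the leaves of one binary tree affinely to those of another, and every tree
    can be rebracketed to a vine by copies of \<open>x\<close>. Hence \<open>\<mu> = 1\<close>, and every element of \<open>ker \<phi>\<close> is an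
    implanted copy.

  Second, \<open>K\<^bsub>(a,b)\<^esub>\<close> is isomorphic to \<open>F\<close> (\<open>K_iso\<close>). There is a homeomorphism \<open>\<theta>\<close> of \<open>[0,1]\<close> that is
  dyadically piecewise linear on compact parts of \<open>(0,1)\<close> and satisfies \<open>\<theta>(2\<^sup>-\<^sup>a t) = \<theta>(t)/2\<close> near \<open>0\<close>
  and the analogous equation with \<open>b\<close> near \<open>1\<close>. Conjugation by \<open>\<theta>\<close> turns germs of slope \<open>2\<^sup>a\<^sup>k\<close> at \<open>0\<close>
  into germs of slope \<open>2\<^sup>k\<close> and preserves piecewise linearity in between, so it maps \<open>K\<^bsub>(a,b)\<^esub>\<close> onto \<open>F\<close>.

  Finally, \<open>K\<^bsub>(p,q)\<^esub> \<le> H\<close> means that \<open>(p,0)\<close> and \<open>(0,q)\<close> lie in \<open>\<phi>(H)\<close>. So \<open>Inner(H) = K\<^bsub>(a,b)\<^esub>\<close>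
  identifies \<open>a\<close> and \<open>b\<close> as generators of the intersections of \<open>\<phi>(H)\<close> with the two axes. Modulo
  \<open>{0} \<times> b\<int>\<close>, the first projection embeds \<open>\<phi>(H)\<close> into \<open>\<int>\<close>, so \<open>Q\<close> is a quotient of a cyclic group.
  The rows are the inclusions and coset maps.
\<close>

section \<open>Dyadic numbers\<close>

lemma dyadic_of_int [simp]: "of_int m \<in> dyadic"
  unfolding dyadic_def by (intro CollectI exI[of _ m] exI[of _ "0::nat"]) simp

lemma dyadic_0 [simp]: "0 \<in> dyadic" and dyadic_1 [simp]: "1 \<in> dyadic"
  using dyadic_of_int[of 0] dyadic_of_int[of 1] by simp_all

lemma dyadic_add [intro]: "x \<in> dyadic \<Longrightarrow> y \<in> dyadic \<Longrightarrow> x + y \<in> dyadic"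
proof -
  assume "x \<in> dyadic" "y \<in> dyadic"
  then obtain m n p q where "x = of_int m / 2 ^ n" "y = of_int p / 2 ^ q"
    unfolding dyadic_def by blast
  then have "x + y = of_int (m * 2 ^ q + p * 2 ^ n) / 2 ^ (n + q)"
    by (simp add: add_frac_eq power_add)
  then show ?thesis unfolding dyadic_def by blast
qed

lemma dyadic_mult [intro]: "x \<in> dyadic \<Longrightarrow> y \<in> dyadic \<Longrightarrow> x * y \<in> dyadic"
proof -
  assume "x \<in> dyadic" "y \<in> dyadic"
  then obtain m n p q where "x = of_int m / 2 ^ n" "y = of_int p / 2 ^ q"
    unfolding dyadic_def by blast
  then have "x * y = of_int (m * p) / 2 ^ (n + q)"
    by (simp add: power_add)
  then show ?thesis unfolding dyadic_def by blast
qed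

lemma dyadic_uminus [intro]: "x \<in> dyadic \<Longrightarrow> - x \<in> dyadic"
  using dyadic_mult[of "of_int (-1)" x] dyadic_of_int[of "-1"] by simp

lemma dyadic_diff [intro]: "x \<in> dyadic \<Longrightarrow> y \<in> dyadic \<Longrightarrow> x - y \<in> dyadic"
  using dyadic_add[of x "- y"] by auto

lemma dyadic_powi [simp, intro]: "2 powi k \<in> dyadic"
proof (cases "k \<ge> 0")
  case True
  then have "(2::real) powi k = of_int (2 ^ nat k)" by (simp add: power_int_def)
  then show ?thesis using dyadic_of_int by metis
next
  case False
  then have "(2::real) powi k = of_int 1 / 2 ^ nat (- k)"
    by (simp add: power_int_def inverse_eq_divide power_divide)
  then show ?thesis unfolding dyadic_def by blast
qed

lemma dyadic_powi_mult [intro]: "x \<in> dyadic \<Longrightarrow> 2 powi k * x \<in> dyadic"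
  by auto

lemma dyadic_powi_mult_iff: "2 powi k * x + b \<in> dyadic \<longleftrightarrow> x \<in> dyadic" if "b \<in> dyadic"
proof
  assume "2 powi k * x + b \<in> dyadic"
  then have "2 powi (-k) * (2 powi k * x + b - b) \<in> dyadic"
    using that by (intro dyadic_powi_mult dyadic_diff)
  also have "2 powi (-k) * (2 powi k * x + b - b) = x"
    by (simp add: power_int_minus mult.assoc[symmetric])
  finally show "x \<in> dyadic" .
qed (use that in auto)

lemma dyadic_half [intro]: "x \<in> dyadic \<Longrightarrow> x / 2 \<in> dyadic"
  using dyadic_powi_mult[of x "-1"] by (simp add: power_int_minus field_simps)

lemma dyadic_quarter [intro]: "x \<in> dyadic \<Longrightarrow> x / 4 \<in> dyadic"
  using dyadic_half[OF dyadic_half, of x] by simp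

lemma dyadic_between:
  assumes "a < (b::real)" obtains x where "x \<in> dyadic" "a < x" "x < b"
proof -
  obtain n :: nat where n: "1 / (b - a) < 2 ^ n"
    using real_arch_pow[of 2 "1 / (b - a)"] by auto
  then have *: "1 < 2 ^ n * (b - a)" using assms by (simp add: field_simps)
  define m where "m = \<lfloor>2 ^ n * a\<rfloor> + 1"
  have "2 ^ n * a < of_int m" "of_int m \<le> 2 ^ n * a + 1" by (auto simp: m_def)
  with * have "a < of_int m / 2 ^ n" "of_int m / 2 ^ n < b" by (auto simp: field_simps)
  moreover have "of_int m / 2 ^ n \<in> dyadic" unfolding dyadic_def by blast
  ultimately show ?thesis using that by blast
qed

section \<open>Dyadic piecewise linear maps on an interval\<close>

text \<open>
  Building the pieces inductively makes composition, inversion and restriction immediate by rule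
  induction. Requiring a dyadic constant term in each piece ensures that breaks are mapped to dyadic
  points, so that breaks of composites and inverses are again dyadic.
\<close>
inductive PL :: "(real \<Rightarrow> real) \<Rightarrow> real \<Rightarrow> real \<Rightarrow> bool" for f where
  affine: "c \<le> d \<Longrightarrow> b \<in> dyadic \<Longrightarrow> (\<And>t. c \<le> t \<Longrightarrow> t \<le> d \<Longrightarrow> f t = 2 powi k * t + b) \<Longrightarrow> PL f c d"
| join: "PL f c m \<Longrightarrow> PL f m d \<Longrightarrow> m \<in> dyadic \<Longrightarrow> PL f c d"

lemma PL_le: "PL f c d \<Longrightarrow> c \<le> d"
  by (induction rule: PL.induct) auto

lemma PL_less: "PL f c d \<Longrightarrow> c \<le> s \<Longrightarrow> s < t \<Longrightarrow> t \<le> d \<Longrightarrow> f s < f t"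
proof (induction arbitrary: s t rule: PL.induct)
  case (affine c d b k)
  then have "f s = 2 powi k * s + b" "f t = 2 powi k * t + b" by auto
  then show ?case using affine.prems by simp
next
  case (join c m d)
  consider "t \<le> m" | "m \<le> s" | "s < m" "m < t" by linarith
  then show ?case
  proof cases
    case 3
    with join.prems show ?thesis using join.IH(1)[of s m] join.IH(2)[of m t] by auto
  qed (use join in auto)
qed

lemma PL_less_iff:
  assumes "PL f c d" "s \<in> {c..d}" "t \<in> {c..d}"
  shows "f s < f t \<longleftrightarrow> s < t"
  using PL_less[OF assms(1), of s t] PL_less[OF assms(1), of t s] assms(2,3)
  by (cases s t rule: linorder_cases) auto

lemma PL_le_iff:
  assumes "PL f c d" "s \<in> {c..d}" "t \<in> {c..d}"
  shows "f s \<le> f t \<longleftrightarrow> s \<le> t"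
  using PL_less_iff[OF assms(1,3,2)] by (simp add: not_less[symmetric])

lemma PL_eq_iff:
  assumes "PL f c d" "s \<in> {c..d}" "t \<in> {c..d}"
  shows "f s = f t \<longleftrightarrow> s = t"
  using PL_le_iff[OF assms(1,3,2)] PL_le_iff[OF assms] by (auto simp: order_eq_iff)

lemma PL_inj_on: "PL f c d \<Longrightarrow> inj_on f {c..d}"
  by (auto simp: inj_on_def PL_eq_iff)

lemma PL_continuous_on: "PL f c d \<Longrightarrow> continuous_on {c..d} f"
proof (induction rule: PL.induct)
  case (affine c d b k)
  have "continuous_on {c..d} (\<lambda>t. 2 powi k * t + b)" by (intro continuous_intros)
  then show ?case using affine by (subst continuous_on_cong[OF refl]) auto
next
  case (join c m d)
  have "{c..d} = {c..m} \<union> {m..d}" using PL_le[OF join(1)] PL_le[OF join(2)] by auto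
  then show ?case using join.IH by (metis closed_atLeastAtMost continuous_on_closed_Un)
qed

lemma PL_image: assumes "PL f c d" shows "f ` {c..d} = {f c..f d}"
proof
  show "f ` {c..d} \<subseteq> {f c..f d}"
    using PL_le_iff[OF assms] PL_le[OF assms] by auto
  show "{f c..f d} \<subseteq> f ` {c..d}"
  proof
    fix y assume "y \<in> {f c..f d}"
    then obtain x where "c \<le> x" "x \<le> d" "f x = y"
      using IVT'[of f c y d] PL_continuous_on[OF assms] PL_le[OF assms] by auto
    then show "y \<in> f ` {c..d}" by auto
  qed
qed

lemma PL_bij_betw: "PL f c d \<Longrightarrow> bij_betw f {c..d} {f c..f d}"
  by (simp add: bij_betw_def PL_inj_on PL_image)

lemma PL_dyadic_iff: "PL f c d \<Longrightarrow> c \<le> t \<Longrightarrow> t \<le> d \<Longrightarrow> f t \<in> dyadic \<longleftrightarrow> t \<in> dyadic"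
proof (induction rule: PL.induct)
  case (affine c d b k)
  then show ?case using dyadic_powi_mult_iff by auto
next
  case (join c m d)
  then show ?case by (cases "t \<le> m") auto
qed

lemma PL_cong: "PL f c d \<Longrightarrow> (\<And>t. c \<le> t \<Longrightarrow> t \<le> d \<Longrightarrow> g t = f t) \<Longrightarrow> PL g c d"
proof (induction rule: PL.induct)
  case (affine c d b k)
  then show ?case by (intro PL.affine) auto
next
  case (join c m d)
  then show ?case using PL_le[OF join(1)] PL_le[OF join(2)] by (intro PL.join[of g c m d]) auto
qed

lemma PL_subinterval: "PL f c d \<Longrightarrow> c \<le> c' \<Longrightarrow> c' \<le> d' \<Longrightarrow> d' \<le> d \<Longrightarrow> PL f c' d'"
proof (induction arbitrary: c' d' rule: PL.induct)
  case (affine c d b k)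
  then show ?case by (intro PL.affine[of c' d' b]) auto
next
  case (join c m d)
  consider "d' \<le> m" | "m \<le> c'" | "c' < m" "m < d'" by linarith
  then show ?case
  proof cases
    case 3
    then show ?thesis using join by (intro PL.join[of f c' m d']) auto
  qed (use join in auto)
qed

lemma PL_compose_affine:
  "PL g c d \<Longrightarrow> b \<in> dyadic \<Longrightarrow> (\<And>t. g c \<le> t \<Longrightarrow> t \<le> g d \<Longrightarrow> f t = 2 powi k * t + b)
    \<Longrightarrow> PL (\<lambda>t. f (g t)) c d"
proof (induction rule: PL.induct)
  case (affine c d b' k')
  have "f (g t) = 2 powi (k + k') * t + (2 powi k * b' + b)" if "c \<le> t" "t \<le> d" for t
  proof -
    have "g c \<le> g t" "g t \<le> g d" using affine.hyps that by auto
    then have "f (g t) = 2 powi k * g t + b" by (rule affine.prems(2))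
    then show ?thesis using affine.hyps(3)[OF that] by (simp add: algebra_simps power_int_add)
  qed
  then show ?case using affine.hyps(1,2) affine.prems(1)
    by (intro PL.affine[of c d "2 powi k * b' + b" _ "k + k'"] dyadic_add dyadic_powi_mult)
next
  case (join c m d)
  have "g c \<le> g m" "g m \<le> g d"
    using PL_le_iff[OF join.hyps(1)] PL_le_iff[OF join.hyps(2)]
      PL_le[OF join.hyps(1)] PL_le[OF join.hyps(2)] by auto
  then show ?case using join by (intro PL.join[of "\<lambda>t. f (g t)" c m d]) auto
qed

text \<open>
  The breaks of the outer map are pulled back along the inner one; as the inner map is a bijection
  that preserves and reflects dyadic points, the new breaks are dyadic.
\<close>
lemma PL_compose:
  assumes "PL f C D" "PL g c d" "g c = C" "g d = D"
  shows "PL (\<lambda>t. f (g t)) c d"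
  using assms
proof (induction arbitrary: c d rule: PL.induct)
  case (affine C D b k)
  show ?case
    using affine.hyps affine.prems by (intro PL_compose_affine[OF affine.prems(1) affine.hyps(2), of f k]) auto
next
  case (join C M D)
  have "M \<in> g ` {c..d}"
    unfolding PL_image[OF join.prems(1)] using join PL_le by auto
  then obtain m where m: "c \<le> m" "m \<le> d" "g m = M" by auto
  then have "m \<in> dyadic" using join PL_dyadic_iff by blast
  then show ?case
    using join m PL_subinterval[OF join.prems(1)] by (intro PL.join[of _ c m d]) auto
qed

lemma PL_inverse: "PL g c d \<Longrightarrow> (\<And>t. c \<le> t \<Longrightarrow> t \<le> d \<Longrightarrow> h (g t) = t) \<Longrightarrow> PL h (g c) (g d)"
proof (induction rule: PL.induct)
  case (affine c d b k)
  have eq: "h s = 2 powi (-k) * s + (- (2 powi (-k) * b))" if s: "g c \<le> s" "s \<le> g d" for s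
  proof -
    define t where "t = 2 powi (-k) * (s - b)"
    have st: "s = 2 powi k * t + b" by (simp add: t_def power_int_minus field_simps)
    have "2 powi k * c \<le> 2 powi k * t" "2 powi k * t \<le> 2 powi k * d"
      using s affine.hyps by (auto simp: st)
    then have t: "c \<le> t" "t \<le> d" by auto
    then have "h s = t" using affine.prems[OF t] affine.hyps(3)[OF t] st by simp
    then show ?thesis by (simp add: t_def algebra_simps)
  qed
  have "g c \<le> g d" using affine by auto
  then show ?case using eq affine.hyps(2)
    by (intro PL.affine[of _ _ "- (2 powi (-k) * b)" _ "-k"] dyadic_uminus dyadic_powi_mult)
next
  case (join c m d)
  have "g m \<in> dyadic" using PL_dyadic_iff[OF join.hyps(1), of m] PL_le[OF join.hyps(1)] join by auto
  then show ?case using join PL_le[OF join.hyps(1)] PL_le[OF join.hyps(2)]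
    by (intro PL.join[of h "g c" "g m" "g d"]) auto
qed

lemma PL_reflect: "PL f c d \<Longrightarrow> PL (\<lambda>t. 1 - f (1 - t)) (1 - d) (1 - c)"
proof (induction rule: PL.induct)
  case (affine c d b k)
  have "1 - b - 2 powi k \<in> dyadic"
    using affine.hyps(2) by (intro dyadic_diff dyadic_1 dyadic_powi)
  then show ?case using affine.hyps
    by (intro PL.affine[of _ _ "1 - b - 2 powi k" _ k]) (simp_all add: algebra_simps)
next
  case (join c m d)
  then show ?case by (intro PL.join[of _ "1 - d" "1 - m" "1 - c"]) auto
qed

lemma PL_glue:
  assumes "PL f c m" "PL g m d" "f m = g m" "m \<in> dyadic"
  shows "PL (\<lambda>t. if t \<le> m then f t else g t) c d"
proof (rule PL.join[OF _ _ assms(4)])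
  show "PL (\<lambda>t. if t \<le> m then f t else g t) c m" using assms(1) by (rule PL_cong) auto
  show "PL (\<lambda>t. if t \<le> m then f t else g t) m d" using assms(2) by (rule PL_cong) (use assms in auto)
qed

lemma PL_affine: "c \<le> d \<Longrightarrow> b \<in> dyadic \<Longrightarrow> PL (\<lambda>t. 2 powi k * t + b) c d"
  by (rule PL.affine) auto

lemma PL_translate: "c \<le> d \<Longrightarrow> b \<in> dyadic \<Longrightarrow> PL (\<lambda>t. t + b) c d"
  using PL_affine[of c d b 0] by simp

lemma PL_id: "c \<le> d \<Longrightarrow> PL (\<lambda>t. t) c d"
  using PL_translate[of c d 0] by simp

section \<open>Maps between arbitrary dyadic intervals\<close>

text \<open>
  An equivalence relation on lengths that is compatible with addition and with scaling by powers
  of 2. Since \<open>2 = 1 + 1\<close> is related to \<open>1\<close>, so are all positive integers, hence all positive dyadic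
  numbers: any two dyadic intervals are related by a piecewise linear map.
\<close>
definition PL_stretches :: "real \<Rightarrow> real \<Rightarrow> bool" where
  "PL_stretches L M \<longleftrightarrow> (\<exists>f. PL f 0 L \<and> f 0 = 0 \<and> f L = M)"

lemma PL_stretches_trans: "PL_stretches L M \<Longrightarrow> PL_stretches M N \<Longrightarrow> PL_stretches L N"
proof -
  assume "PL_stretches L M" "PL_stretches M N"
  then obtain f g where "PL f 0 L" "f 0 = 0" "f L = M" "PL g 0 M" "g 0 = 0" "g M = N"
    by (auto simp: PL_stretches_def)
  then show "PL_stretches L N" unfolding PL_stretches_def
    by (intro exI[of _ "\<lambda>t. g (f t)"]) (auto intro: PL_compose)
qed

lemma PL_has_inverse:
  assumes "PL f c d"
  obtains g where "PL g (f c) (f d)" "\<And>t. c \<le> t \<Longrightarrow> t \<le> d \<Longrightarrow> g (f t) = t"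
    "\<And>s. f c \<le> s \<Longrightarrow> s \<le> f d \<Longrightarrow> f (g s) = s"
proof
  let ?g = "inv_into {c..d} f"
  show inv: "?g (f t) = t" if "c \<le> t" "t \<le> d" for t
    using PL_inj_on[OF assms] that by (intro inv_into_f_f) auto
  show "PL ?g (f c) (f d)" using inv by (rule PL_inverse[OF assms])
  show "f (?g s) = s" if "f c \<le> s" "s \<le> f d" for s
    using that PL_image[OF assms] by (intro f_inv_into_f) auto
qed

lemma PL_stretches_sym: "PL_stretches L M \<Longrightarrow> PL_stretches M L"
proof -
  assume "PL_stretches L M"
  then obtain f where f: "PL f 0 L" "f 0 = 0" "f L = M" by (auto simp: PL_stretches_def)
  obtain g where "PL g (f 0) (f L)" "\<And>t. 0 \<le> t \<Longrightarrow> t \<le> L \<Longrightarrow> g (f t) = t"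
    using PL_has_inverse[OF f(1)] by metis
  then show "PL_stretches M L" unfolding PL_stretches_def using f PL_le[OF f(1)] by (metis order_refl)
qed

lemma PL_stretches_add:
  assumes "PL_stretches L M" "PL_stretches L' M'" "L \<in> dyadic"
  shows "PL_stretches (L + L') (M + M')"
proof -
  obtain f g where f: "PL f 0 L" "f 0 = 0" "f L = M" and g: "PL g 0 L'" "g 0 = 0" "g L' = M'"
    using assms by (auto simp: PL_stretches_def)
  have le: "0 \<le> L" "0 \<le> L'" using f g PL_le by auto
  have M: "M \<in> dyadic" using PL_dyadic_iff[OF f(1), of L] f assms le by auto
  have 1: "PL (\<lambda>t. g (t + - L)) L (L + L')"
    using g assms(3) le by (intro PL_compose[OF g(1) PL_translate]) auto
  have 2: "PL (\<lambda>t. (\<lambda>s. s + M) (g (t + - L))) L (L + L')"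
  proof (rule PL_compose[OF _ 1])
    show "PL (\<lambda>s. s + M) 0 M'" using M g PL_le_iff[OF g(1), of 0 L'] le by (intro PL_translate) auto
  qed (use g in auto)
  show ?thesis unfolding PL_stretches_def
    by (intro exI[of _ "\<lambda>t. if t \<le> L then f t else g (t + - L) + M"] conjI PL_glue f(1) assms(3) 2)
      (use f g le in auto)
qed

lemma PL_stretches_scale: "0 \<le> L \<Longrightarrow> PL_stretches L (2 powi k * L)"
  unfolding PL_stretches_def using PL_affine[of 0 L 0 k] by (intro exI[of _ "\<lambda>t. 2 powi k * t"]) auto

text \<open>
  Inductively \<open>n + 2 = n + 2 \<cdot> 1\<close> is related to \<open>n + 1\<close>, by doubling only the last unit.
\<close>
lemma PL_stretches_int: "PL_stretches 1 (real (Suc n))"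
proof (induction n)
  case 0
  then show ?case using PL_stretches_scale[of 1 0] by simp
next
  case (Suc n)
  have "PL_stretches (real n + 1) (real n + 2 powi 1 * 1)"
    by (intro PL_stretches_add PL_stretches_scale) (use PL_stretches_scale[of "real n" 0] dyadic_of_int[of "int n"] in auto)
  then show ?case using PL_stretches_trans[OF Suc.IH] by (simp add: add.commute)
qed

lemma PL_stretches_dyadic:
  assumes "x \<in> dyadic" "x > 0" shows "PL_stretches 1 x"
proof -
  from assms(1) obtain m :: int and n where mn: "x = of_int m / 2 ^ n" by (auto simp: dyadic_def)
  then have "m > 0" using assms(2) by (simp add: zero_less_divide_iff)
  then obtain q where q: "m = int (Suc q)" by (metis not0_implies_Suc of_nat_0 order_less_irrefl zero_less_imp_eq_int)
  have "PL_stretches (real (Suc q)) (2 powi (- int n) * real (Suc q))" by (rule PL_stretches_scale) simp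
  moreover have "2 powi (- int n) * real (Suc q) = x"
    by (simp add: mn q power_int_minus field_simps)
  ultimately show ?thesis using PL_stretches_trans[OF PL_stretches_int] by metis
qed

lemma PL_exists:
  assumes "c < d" "c' < d'" "c \<in> dyadic" "d \<in> dyadic" "c' \<in> dyadic" "d' \<in> dyadic"
  obtains f where "PL f c d" "f c = c'" "f d = d'"
proof -
  have "PL_stretches (d - c) (d' - c')"
    using PL_stretches_trans[OF PL_stretches_sym[OF PL_stretches_dyadic] PL_stretches_dyadic, of "d - c" "d' - c'"] assms by auto
  then obtain f where f: "PL f 0 (d - c)" "f 0 = 0" "f (d - c) = d' - c'"
    by (auto simp: PL_stretches_def)
  have 1: "PL (\<lambda>t. f (t + - c)) c d"
    using assms by (intro PL_compose[OF f(1) PL_translate]) auto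
  have "PL (\<lambda>t. (\<lambda>s. s + c') (f (t + - c))) c d"
    using assms f by (intro PL_compose[OF PL_translate 1, of 0 "d' - c'"]) auto
  then show ?thesis using f assms by (intro that[of "\<lambda>t. f (t + - c) + c'"]) auto
qed

section \<open>The elements of F\<close>

lemma PL_imp_breaks:
  "PL f c d \<Longrightarrow> \<exists>B. finite B \<and> B \<subseteq> dyadic \<and>
     (\<forall>x y. c \<le> x \<longrightarrow> x < y \<longrightarrow> y \<le> d \<longrightarrow> {x<..<y} \<inter> B = {} \<longrightarrow>
        (\<exists>(k::int) b. \<forall>t\<in>{x..y}. f t = 2 powi k * t + b))"
proof (induction rule: PL.induct)
  case (affine c d b k)
  then show ?case
    by (intro exI[of _ "{}"] conjI allI impI exI[of _ k] exI[of _ b]) auto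
next
  case (join c m d)
  then obtain B C where BC: "finite B" "B \<subseteq> dyadic" "finite C" "C \<subseteq> dyadic"
    "\<And>x y. c \<le> x \<Longrightarrow> x < y \<Longrightarrow> y \<le> m \<Longrightarrow> {x<..<y} \<inter> B = {} \<Longrightarrow>
        \<exists>(k::int) b. \<forall>t\<in>{x..y}. f t = 2 powi k * t + b"
    "\<And>x y. m \<le> x \<Longrightarrow> x < y \<Longrightarrow> y \<le> d \<Longrightarrow> {x<..<y} \<inter> C = {} \<Longrightarrow>
        \<exists>(k::int) b. \<forall>t\<in>{x..y}. f t = 2 powi k * t + b"
    by metis
  show ?case
  proof (intro exI[of _ "insert m (B \<union> C)"] conjI allI impI)
    fix x y assume *: "c \<le> x" "x < y" "y \<le> d" "{x<..<y} \<inter> insert m (B \<union> C) = {}"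
    then have "m \<notin> {x<..<y}" "{x<..<y} \<inter> B = {}" "{x<..<y} \<inter> C = {}" by blast+
    then consider "y \<le> m" "{x<..<y} \<inter> B = {}" | "m \<le> x" "{x<..<y} \<inter> C = {}" by force
    then show "\<exists>(k::int) b. \<forall>t\<in>{x..y}. f t = 2 powi k * t + b"
      using BC(5,6) * by cases auto
  qed (use BC join.hyps in auto)
qed

text \<open>
  Induction on the number of breaks in the open interval. The assumption that \<open>f c\<close> is dyadic is
  propagated from left to right and is what makes the constant terms dyadic.
\<close>
lemma breaks_imp_PL:
  assumes "finite B" "B \<subseteq> dyadic" "PL2_breaks_in B f"
    and "0 \<le> c" "c < d" "d \<le> 1" "c \<in> dyadic" "f c \<in> dyadic"
  shows "PL f c d"
  using assms(4-)
proof (induction "card (B \<inter> {c<..<d})" arbitrary: c d rule: less_induct)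
  case less
  show ?case
  proof (cases "B \<inter> {c<..<d} = {}")
    case True
    then obtain k :: int and b where kb: "\<forall>t\<in>{c..d}. f t = 2 powi k * t + b"
      using assms(3) less.prems unfolding PL2_breaks_in_def by (metis Int_commute)
    then have "b = f c - 2 powi k * c" using less.prems by simp
    then have "b \<in> dyadic" using less.prems by (simp add: dyadic_diff dyadic_mult)
    then show ?thesis using less.prems kb by (intro PL.affine[of c d b f k]) auto
  next
    case False
    then obtain m where m: "m \<in> B" "c < m" "m < d" by auto
    have fin: "finite (B \<inter> {c<..<d})" using assms(1) by simp
    have "B \<inter> {c<..<m} \<subset> B \<inter> {c<..<d}" "B \<inter> {m<..<d} \<subset> B \<inter> {c<..<d}"
      using m by auto
    then have cards: "card (B \<inter> {c<..<m}) < card (B \<inter> {c<..<d})"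
      "card (B \<inter> {m<..<d}) < card (B \<inter> {c<..<d})"
      using fin psubset_card_mono by blast+
    have md: "m \<in> dyadic" using m assms(2) by auto
    have 1: "PL f c m" using less m cards by (intro less.hyps) auto
    then have "f m \<in> dyadic" using PL_dyadic_iff[OF 1, of m] md m by simp
    then have "PL f m d" using less.prems m cards md by (intro less.hyps) auto
    with 1 md show ?thesis by (blast intro: PL.join)
  qed
qed

lemma thompson_carrier_iff:
  "f \<in> thompson_carrier \<longleftrightarrow> f \<in> extensional {0..1} \<and> PL f 0 1 \<and> f 0 = 0 \<and> f 1 = 1"
proof (intro iffI conjI)
  assume "f \<in> thompson_carrier"
  then obtain g B where f: "f \<in> extensional {0..1}" "homeomorphism {0..1} {0..1} f g"
    "strict_mono_on {0..1} f" "finite B" "B \<subseteq> dyadic" "PL2_breaks_in B f"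
    unfolding thompson_carrier_def by blast
  have im: "f ` {0..1} = {0..1}" using f(2) by (simp add: homeomorphism_def)
  have mono: "f x \<le> f y" if "0 \<le> x" "x \<le> y" "y \<le> 1" for x y
    using f(3) that by (cases "x = y") (auto simp: strict_mono_on_def less_imp_le)
  have "0 \<in> f ` {0..1}" "1 \<in> f ` {0..1}" unfolding im by auto
  then obtain a b where ab: "a \<in> {0..1}" "f a = 0" "b \<in> {0..1}" "f b = 1" by auto
  have "f 0 \<in> {0..1}" "f 1 \<in> {0..1}" using im by auto
  then show "f 0 = 0" "f 1 = 1" using mono[of 0 a] mono[of b 1] ab by auto
  then show "PL f 0 1" using breaks_imp_PL[OF f(4-6)] by simp
  show "f \<in> extensional {0..1}" by fact
next
  assume f: "f \<in> extensional {0..1} \<and> PL f 0 1 \<and> f 0 = 0 \<and> f 1 = 1"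
  then have "strict_mono_on {0..1} f" using PL_less by (auto simp: strict_mono_on_def)
  moreover have "\<exists>g. homeomorphism {0..1} {0..1} f g"
    using f PL_continuous_on[of f 0 1] PL_image[of f 0 1] PL_inj_on[of f 0 1]
    by (intro homeomorphism_compact) auto
  moreover have "\<exists>B. finite B \<and> B \<subseteq> dyadic \<and> PL2_breaks_in B f"
    using PL_imp_breaks[of f 0 1] f by (auto simp: PL2_breaks_in_def)
  ultimately show "f \<in> thompson_carrier" using f unfolding thompson_carrier_def by blast
qed

lemma carrier_F: "carrier thompson_F = thompson_carrier"
  by (simp add: thompson_F_def)

lemma F_iff: "f \<in> carrier thompson_F \<longleftrightarrow> f \<in> extensional {0..1} \<and> PL f 0 1 \<and> f 0 = 0 \<and> f 1 = 1"
  by (simp add: carrier_F thompson_carrier_iff)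

lemma F_D:
  assumes "f \<in> carrier thompson_F"
  shows "f \<in> extensional {0..1}" "PL f 0 1" "f 0 = 0" "f 1 = 1"
  using assms by (auto simp: F_iff)

lemma F_range: "f \<in> carrier thompson_F \<Longrightarrow> 0 \<le> t \<Longrightarrow> t \<le> 1 \<Longrightarrow> 0 \<le> f t \<and> f t \<le> 1"
  using PL_image[of f 0 1] by (auto simp: F_iff)

lemma F_eqI:
  assumes "f \<in> carrier thompson_F" "g \<in> carrier thompson_F" "\<And>t. 0 \<le> t \<Longrightarrow> t \<le> 1 \<Longrightarrow> f t = g t"
  shows "f = g"
  using assms by (intro extensionalityI[of f "{0..1}" g]) (auto simp: F_iff)

lemma restrict_in_F:
  "PL f 0 1 \<Longrightarrow> f 0 = 0 \<Longrightarrow> f 1 = 1 \<Longrightarrow> restrict f {0..1} \<in> carrier thompson_F"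
  by (auto simp: F_iff intro: PL_cong)

lemma F_subset_Bij: "carrier thompson_F \<subseteq> Bij {0..1}"
  using PL_bij_betw[of _ 0 1] by (fastforce simp: F_iff Bij_def)

lemma F_inv_into:
  assumes "f \<in> carrier thompson_F"
  shows "(\<lambda>t\<in>{0..1}. inv_into {0..1} f t) \<in> carrier thompson_F"
proof -
  have f: "PL f 0 1" "f 0 = 0" "f 1 = 1" using F_D[OF assms] by auto
  have inv: "inv_into {0..1} f (f t) = t" if "0 \<le> t" "t \<le> 1" for t
    using PL_inj_on[OF f(1)] that by (intro inv_into_f_f) auto
  have "PL (inv_into {0..1} f) (f 0) (f 1)" using inv by (rule PL_inverse[OF f(1)])
  then show ?thesis using inv[of 0] inv[of 1] f by (intro restrict_in_F) auto
qed

lemma subgroup_F: "subgroup (carrier thompson_F) (BijGroup {0..1})"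
proof (rule group.subgroupI[OF group_BijGroup])
  show "carrier thompson_F \<subseteq> carrier (BijGroup {0..1})"
    using F_subset_Bij by (simp add: BijGroup_def)
  have "(\<lambda>t\<in>{0..1}. t) \<in> carrier thompson_F" by (intro restrict_in_F PL_id) auto
  then show "carrier thompson_F \<noteq> {}" by auto
next
  fix f assume f: "f \<in> carrier thompson_F"
  then have "f \<in> Bij {0..1}" using F_subset_Bij by blast
  then show "inv\<^bsub>BijGroup {0..1}\<^esub> f \<in> carrier thompson_F"
    using F_inv_into[OF f] by (simp add: inv_BijGroup)
next
  fix f g assume fg: "f \<in> carrier thompson_F" "g \<in> carrier thompson_F"
  then have "f \<in> Bij {0..1}" "g \<in> Bij {0..1}" using F_subset_Bij by blast+
  then have "f \<otimes>\<^bsub>BijGroup {0..1}\<^esub> g = (\<lambda>t\<in>{0..1}. f (g t))"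
    by (simp add: BijGroup_def compose_def)
  moreover have "(\<lambda>t\<in>{0..1}. f (g t)) \<in> carrier thompson_F"
    using F_D[OF fg(1)] F_D[OF fg(2)]
    by (intro restrict_in_F PL_compose[OF F_D(2)[OF fg(1)] F_D(2)[OF fg(2)]]) auto
  ultimately show "f \<otimes>\<^bsub>BijGroup {0..1}\<^esub> g \<in> carrier thompson_F" by simp
qed

lemma group_F: "group thompson_F"
  using group.subgroup_imp_group[OF group_BijGroup subgroup_F] by (simp add: thompson_F_def)

interpretation F: group thompson_F by (rule group_F)

lemma F_mult:
  assumes "f \<in> carrier thompson_F" "g \<in> carrier thompson_F"
  shows "f \<otimes>\<^bsub>thompson_F\<^esub> g = (\<lambda>t\<in>{0..1}. f (g t))"
  using assms F_subset_Bij by (auto simp: thompson_F_def BijGroup_def compose_def subset_eq)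

lemma F_mult_apply:
  assumes "f \<in> carrier thompson_F" "g \<in> carrier thompson_F" "0 \<le> t" "t \<le> 1"
  shows "(f \<otimes>\<^bsub>thompson_F\<^esub> g) t = f (g t)"
  using assms by (simp add: F_mult)

lemma F_one: "\<one>\<^bsub>thompson_F\<^esub> = (\<lambda>t\<in>{0..1}. t)"
  by (simp add: thompson_F_def BijGroup_def)

lemma F_one_apply: "0 \<le> t \<Longrightarrow> t \<le> 1 \<Longrightarrow> \<one>\<^bsub>thompson_F\<^esub> t = t"
  by (simp add: F_one)

lemma F_inv_apply:
  assumes "f \<in> carrier thompson_F" "0 \<le> t" "t \<le> 1"
  shows "(inv\<^bsub>thompson_F\<^esub> f) (f t) = t" "f ((inv\<^bsub>thompson_F\<^esub> f) t) = t"
  using F_mult_apply[of "inv\<^bsub>thompson_F\<^esub> f" f t] F_mult_apply[of f "inv\<^bsub>thompson_F\<^esub> f" t] assms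
  by (auto simp: F_one_apply)

section \<open>The slopes at the ends\<close>

lemma PL_right_germ:
  "PL f c d \<Longrightarrow> c < d \<Longrightarrow> \<exists>e (k::int). c < e \<and> e \<le> d \<and> (\<forall>t\<in>{c..e}. f t = 2 powi k * (t - c) + f c)"
proof (induction rule: PL.induct)
  case (affine c d b k)
  then have "f t = 2 powi k * (t - c) + f c" if "t \<in> {c..d}" for t
    using that by (simp add: algebra_simps)
  then show ?case using affine by blast
next
  case (join c m d)
  show ?case
  proof (cases "c = m")
    case False
    then have "c < m" "m \<le> d" using PL_le[OF join.hyps(1)] PL_le[OF join.hyps(2)] by auto
    from join.IH(1)[OF this(1)] obtain e and k :: int
      where e: "c < e" "e \<le> m" "\<forall>t\<in>{c..e}. f t = 2 powi k * (t - c) + f c" by blast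
    have "e \<le> d" using e(2) \<open>m \<le> d\<close> by linarith
    with e show ?thesis by blast
  next
    case True
    then show ?thesis using join.IH(2) join.prems by blast
  qed
qed

lemma phi_eqI:
  assumes "0 < e" "\<And>t. 0 \<le> t \<Longrightarrow> t \<le> e \<Longrightarrow> f t = 2 powi k * t"
    "\<And>t. 0 \<le> t \<Longrightarrow> t \<le> e \<Longrightarrow> f (1 - t) = 1 - 2 powi l * t"
  shows "phi f = (k, l)"
proof -
  have "vector_derivative f (at_right 0) = 2 powi k"
    using vector_derivative_affine[of 0 e f "2 powi k" 0 0] at_within_Icc_at_right[of 0 e] assms by auto
  moreover have "f t = 2 powi l * t + (1 - 2 powi l)" if "t \<in> {1 - e..1}" for t
    using assms(3)[of "1 - t"] that by (simp add: algebra_simps)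
  then have "vector_derivative f (at_left 1) = 2 powi l"
    using vector_derivative_affine[of "1 - e" 1 f "2 powi l" "1 - 2 powi l" 1]
      at_within_Icc_at_left[of "1 - e" 1] assms(1) by auto
  ultimately show ?thesis by (simp add: phi_def powr_real_of_int'[symmetric])
qed

lemma F_germs:
  assumes "f \<in> carrier thompson_F"
  obtains e where "e > 0" "e \<le> 1"
    "\<And>t. 0 \<le> t \<Longrightarrow> t \<le> e \<Longrightarrow> f t = 2 powi (fst (phi f)) * t"
    "\<And>t. 0 \<le> t \<Longrightarrow> t \<le> e \<Longrightarrow> f (1 - t) = 1 - 2 powi (snd (phi f)) * t"
proof -
  note f = F_D[OF assms]
  have "\<exists>e1 (k::int). 0 < e1 \<and> e1 \<le> 1 \<and> (\<forall>t\<in>{0..e1}. f t = 2 powi k * t)"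
    using PL_right_germ[OF f(2)] f(3) by simp
  then obtain e1 and k :: int where 1: "0 < e1" "e1 \<le> 1" "\<And>t. 0 \<le> t \<Longrightarrow> t \<le> e1 \<Longrightarrow> f t = 2 powi k * t"
    by (metis atLeastAtMost_iff)
  have "PL (\<lambda>t. 1 - f (1 - t)) 0 1" using PL_reflect[OF f(2)] by simp
  then have "\<exists>e2 (l::int). 0 < e2 \<and> e2 \<le> 1 \<and> (\<forall>t\<in>{0..e2}. 1 - f (1 - t) = 2 powi l * t)"
    using PL_right_germ[of "\<lambda>t. 1 - f (1 - t)" 0 1] f(4) by simp
  then obtain e2 and l :: int
    where 2: "0 < e2" "e2 \<le> 1" "\<And>t. 0 \<le> t \<Longrightarrow> t \<le> e2 \<Longrightarrow> 1 - f (1 - t) = 2 powi l * t"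
    by (metis atLeastAtMost_iff)
  have 2: "f (1 - t) = 1 - 2 powi l * t" if "0 \<le> t" "t \<le> e2" for t using 2(3)[OF that] by simp
  have "phi f = (k, l)" using 1 2 \<open>0 < e2\<close> by (intro phi_eqI[of "min e1 e2"]) auto
  then show ?thesis using 1 2 \<open>0 < e2\<close> by (intro that[of "min e1 e2"]) auto
qed

lemma Z2_simps [simp]:
  "carrier Z2 = UNIV" "x \<otimes>\<^bsub>Z2\<^esub> y = (fst x + fst y, snd x + snd y)" "\<one>\<^bsub>Z2\<^esub> = (0, 0)"
  by (auto simp: Z2_def DirProd_def integer_group_def split: prod.splits)

lemma group_Z2: "comm_group Z2"
  by (rule comm_groupI) (auto intro: exI[of _ "- x" for x])

interpretation Z2: comm_group Z2 by (rule group_Z2)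

lemma phi_mult:
  assumes "f \<in> carrier thompson_F" "g \<in> carrier thompson_F"
  shows "phi (f \<otimes>\<^bsub>thompson_F\<^esub> g) = phi f \<otimes>\<^bsub>Z2\<^esub> phi g"
proof -
  obtain e where e: "e > 0" "e \<le> 1"
    "\<And>t. 0 \<le> t \<Longrightarrow> t \<le> e \<Longrightarrow> f t = 2 powi (fst (phi f)) * t"
    "\<And>t. 0 \<le> t \<Longrightarrow> t \<le> e \<Longrightarrow> f (1 - t) = 1 - 2 powi (snd (phi f)) * t"
    using F_germs[OF assms(1)] by blast
  obtain e' where e': "e' > 0" "e' \<le> 1"
    "\<And>t. 0 \<le> t \<Longrightarrow> t \<le> e' \<Longrightarrow> g t = 2 powi (fst (phi g)) * t"
    "\<And>t. 0 \<le> t \<Longrightarrow> t \<le> e' \<Longrightarrow> g (1 - t) = 1 - 2 powi (snd (phi g)) * t"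
    using F_germs[OF assms(2)] by blast
  define d where "d = Min {e', e / 2 powi (fst (phi g)), e / 2 powi (snd (phi g))}"
  have d: "0 < d" "d \<le> e'" "d \<le> e / 2 powi (fst (phi g))" "d \<le> e / 2 powi (snd (phi g))"
    using e(1) e'(1) by (auto simp: d_def)
  show ?thesis unfolding Z2_simps
  proof (rule phi_eqI[OF d(1)])
    fix t assume t: "0 \<le> t" "t \<le> d"
    have "t \<le> e / 2 powi (fst (phi g))" "t \<le> e / 2 powi (snd (phi g))" using t d by linarith+
    then have "2 powi (fst (phi g)) * t \<le> e" "2 powi (snd (phi g)) * t \<le> e"
      by (simp_all add: pos_le_divide_eq mult.commute)
    then show "(f \<otimes>\<^bsub>thompson_F\<^esub> g) t = 2 powi (fst (phi f) + fst (phi g)) * t"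
      "(f \<otimes>\<^bsub>thompson_F\<^esub> g) (1 - t) = 1 - 2 powi (snd (phi f) + snd (phi g)) * t"
      using t d e e' assms by (auto simp: F_mult_apply power_int_add)
  qed
qed

lemma phi_hom: "group_hom thompson_F Z2 phi"
  by (intro group_hom.intro group_hom_axioms.intro homI) (auto simp: group_F phi_mult simp del: Z2_simps(2))

interpretation phi: group_hom thompson_F Z2 phi by (rule phi_hom)

text \<open>
  Close enough to the ends the germs with the required slopes leave room, and the gap in the middle
  is filled by a map between two dyadic intervals.
\<close>
lemma phi_surj: "\<exists>f\<in>carrier thompson_F. phi f = (k, l)"
proof -
  define e :: real where "e = 2 powi (- (\<bar>k\<bar> + \<bar>l\<bar> + 2))"
  have e: "e > 0" "e < 1/2" "2 powi k * e < 1 / 2" "2 powi l * e < 1 / 2"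
  proof -
    have 1: "(2::real) powi j < 2 powi (-1)" if "j < - 1" for j
      using that by (intro power_int_strict_increasing) auto
    show "e > 0" by (simp add: e_def)
    show "e < 1/2" using 1[of "- (\<bar>k\<bar> + \<bar>l\<bar> + 2)"] by (simp add: e_def power_int_minus)
    have 2: "2 powi j * e < 1 / 2" if "j \<le> \<bar>k\<bar> + \<bar>l\<bar>" for j
    proof -
      have "2 powi j * e = 2 powi (j + (- (\<bar>k\<bar> + \<bar>l\<bar> + 2)))"
        unfolding e_def by (subst power_int_add) auto
      also have "\<dots> < 2 powi (-1)" using that by (intro 1) simp
      finally show ?thesis by (simp add: power_int_minus)
    qed
    show "2 powi k * e < 1 / 2" "2 powi l * e < 1 / 2" by (rule 2; simp)+
  qed
  have ed: "e \<in> dyadic" by (simp only: e_def dyadic_powi)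
  obtain h where h: "PL h e (1 - e)" "h e = 2 powi k * e" "h (1 - e) = 1 - 2 powi l * e"
  proof (rule PL_exists[of e "1 - e" "2 powi k * e" "1 - 2 powi l * e"])
    show "1 - e \<in> dyadic" "2 powi k * e \<in> dyadic" "1 - 2 powi l * e \<in> dyadic"
      using ed by (intro dyadic_diff dyadic_powi_mult dyadic_1; assumption)+
  qed (use e ed in auto)
  define f1 where "f1 = (\<lambda>t. if t \<le> e then 2 powi k * t + 0 else h t)"
  define f where "f = (\<lambda>t. if t \<le> 1 - e then f1 t else 2 powi l * t + (1 - 2 powi l))"
  have "PL f1 0 (1 - e)" unfolding f1_def
    using h e ed by (intro PL_glue PL_affine) auto
  then have "PL f 0 1" unfolding f_def
    using h e ed by (intro PL_glue PL_affine) (auto simp: f1_def algebra_simps)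
  then have "restrict f {0..1} \<in> carrier thompson_F"
    using e by (intro restrict_in_F) (auto simp: f_def f1_def)
  moreover have "phi (restrict f {0..1}) = (k, l)"
    using e h by (intro phi_eqI[OF e(1)]) (auto simp: f_def f1_def algebra_simps)
  ultimately show ?thesis by blast
qed

section \<open>Copies of elements supported on a subinterval\<close>

text \<open>
  Frames need not be affine: the support of an element may have any dyadic length, and an affine
  map from \<open>[0,1]\<close> whose slope is a power of 2 only reaches lengths \<open>2\<^sup>-\<^sup>n\<close>.
\<close>
definition frame :: "(real \<Rightarrow> real) \<Rightarrow> bool" where
  "frame r \<longleftrightarrow> PL r 0 1 \<and> r 0 \<in> dyadic \<and> 0 \<le> r 0 \<and> r 1 \<le> 1"

text \<open>
  Implants move all of \<open>F\<close> into \<open>(0,1)\<close>, where any two dyadic intervals are interchangeable.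
\<close>
definition implant :: "(real \<Rightarrow> real) \<Rightarrow> (real \<Rightarrow> real) \<Rightarrow> real \<Rightarrow> real" where
  "implant r f = (\<lambda>t\<in>{0..1}. if r 0 \<le> t \<and> t \<le> r 1 then r (f (inv_into {0..1} r t)) else t)"

lemma frame_less: "frame r \<Longrightarrow> r 0 < r 1"
  using PL_less[of r 0 1 0 1] by (simp add: frame_def)

lemma frame_range: "frame r \<Longrightarrow> 0 \<le> s \<Longrightarrow> s \<le> 1 \<Longrightarrow> r 0 \<le> r s \<and> r s \<le> r 1 \<and> 0 \<le> r s \<and> r s \<le> 1"
  using PL_le_iff[of r 0 1 0 s] PL_le_iff[of r 0 1 s 1] by (auto simp: frame_def)

lemma frame_dyadic: "frame r \<Longrightarrow> r 0 \<in> dyadic \<and> r 1 \<in> dyadic"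
  using PL_dyadic_iff[of r 0 1 1] by (auto simp: frame_def)

lemma implant_apply:
  assumes "frame r" "0 \<le> s" "s \<le> 1"
  shows "implant r f (r s) = r (f s)"
  using assms frame_range[OF assms] PL_inj_on[of r 0 1]
  by (simp add: implant_def frame_def inv_into_f_f)

lemma implant_outside:
  assumes "frame r" "f \<in> carrier thompson_F" "0 \<le> t" "t \<le> 1" "t \<le> r 0 \<or> r 1 \<le> t"
  shows "implant r f t = t"
proof -
  consider "t = r 0" | "t = r 1" | "t < r 0 \<or> r 1 < t" using assms(5) by linarith
  then show ?thesis
    using implant_apply[OF assms(1), of 0] implant_apply[OF assms(1), of 1] F_D[OF assms(2)] assms(3,4)
    by cases (auto simp: implant_def)
qed

lemma frame_cases:
  assumes "frame r" "0 \<le> t" "t \<le> 1"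
  obtains s where "0 \<le> s" "s \<le> 1" "t = r s" | "t < r 0 \<or> r 1 < t"
proof (cases "t < r 0 \<or> r 1 < t")
  case False
  then have "t \<in> r ` {0..1}" using PL_image[of r 0 1] assms by (auto simp: frame_def)
  then show ?thesis using that(1) by auto
qed (use that in auto)

lemma implant_in_F:
  assumes r: "frame r" and f: "f \<in> carrier thompson_F"
  shows "implant r f \<in> carrier thompson_F"
proof -
  note rd = r[unfolded frame_def] and fd = F_D[OF f] and out = implant_outside[OF r f]
  obtain q where q: "PL q (r 0) (r 1)" "\<And>s. 0 \<le> s \<Longrightarrow> s \<le> 1 \<Longrightarrow> q (r s) = s"
    using PL_has_inverse[of r 0 1] rd by metis
  have "PL (\<lambda>t. f (q t)) (r 0) (r 1)" using q(2)[of 0] q(2)[of 1]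
    by (intro PL_compose[OF fd(2) q(1)]) auto
  then have "PL (\<lambda>t. r (f (q t))) (r 0) (r 1)"
    using rd fd q(2)[of 0] q(2)[of 1] by (intro PL_compose[of r 0 1 "\<lambda>t. f (q t)"]) auto
  then have "PL (implant r f) (r 0) (r 1)"
  proof (rule PL_cong)
    fix t assume t: "r 0 \<le> t" "t \<le> r 1"
    then obtain s where "0 \<le> s" "s \<le> 1" "t = r s"
      using frame_cases[OF r, of t] rd by (metis not_le order_trans)
    then show "implant r f t = r (f (q t))" using implant_apply[OF r] q by simp
  qed
  moreover have "PL (implant r f) 0 (r 0)" "PL (implant r f) (r 1) 1"
    by (rule PL_cong[OF PL_id]; use out rd frame_less[OF r] in auto)+
  ultimately have "PL (implant r f) 0 1"
    using frame_dyadic[OF r] by (blast intro: PL.join)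
  then show ?thesis using out[of 0] out[of 1] rd by (simp add: F_iff implant_def)
qed

lemma implant_mult:
  assumes r: "frame r" and "f \<in> carrier thompson_F" "g \<in> carrier thompson_F"
  shows "implant r (f \<otimes>\<^bsub>thompson_F\<^esub> g) = implant r f \<otimes>\<^bsub>thompson_F\<^esub> implant r g"
proof (rule F_eqI)
  fix t :: real assume t: "0 \<le> t" "t \<le> 1"
  show "implant r (f \<otimes>\<^bsub>thompson_F\<^esub> g) t = (implant r f \<otimes>\<^bsub>thompson_F\<^esub> implant r g) t"
    using frame_cases[OF r t]
  proof cases
    case (1 s)
    then show ?thesis
      using assms t F_range[of g s] by (simp add: F_mult_apply implant_in_F implant_apply)
  next
    case 2
    then show ?thesis using assms t
      by (auto simp: F_mult_apply implant_in_F implant_outside)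
  qed
qed (use assms in \<open>auto intro: implant_in_F\<close>)

lemma implant_hom:
  assumes "frame r" shows "group_hom thompson_F thompson_F (implant r)"
  using assms by (intro group_hom.intro group_hom_axioms.intro homI)
    (auto simp: group_F implant_mult implant_in_F)

lemma frame_compose:
  assumes "frame r" "frame s" shows "frame (\<lambda>t. r (s t))"
proof -
  have s: "PL s 0 1" "0 \<le> s 0" "s 0 \<le> 1" "s 0 \<le> s 1" "0 \<le> s 1" "s 1 \<le> 1" "s 0 \<in> dyadic"
    using assms(2) frame_less[OF assms(2)] by (auto simp: frame_def)
  have "PL r (s 0) (s 1)" using assms(1) s PL_subinterval[of r 0 1] by (auto simp: frame_def)
  from PL_compose[OF this s(1)] have "PL (\<lambda>t. r (s t)) 0 1" by simp
  then show ?thesis using s frame_range[OF assms(1)] PL_dyadic_iff[of r 0 1 "s 0"] assms(1)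
    by (auto simp: frame_def)
qed

lemma frame_F_compose:
  assumes "f \<in> carrier thompson_F" "frame s" shows "frame (\<lambda>t. f (s t))"
  using assms(1) by (intro frame_compose[OF _ assms(2)]) (auto simp: frame_def F_iff)

lemma implant_implant:
  assumes r: "frame r" and s: "frame s" and f: "f \<in> carrier thompson_F"
  shows "implant r (implant s f) = implant (\<lambda>t. r (s t)) f"
proof (rule F_eqI)
  have rs: "frame (\<lambda>t. r (s t))" using frame_compose r s .
  show "implant r (implant s f) \<in> carrier thompson_F" "implant (\<lambda>t. r (s t)) f \<in> carrier thompson_F"
    using implant_in_F r s f rs by auto
  fix t :: real assume t: "0 \<le> t" "t \<le> 1"
  have sf: "implant s f \<in> carrier thompson_F" using s f by (rule implant_in_F)
  show "implant r (implant s f) t = implant (\<lambda>t. r (s t)) f t"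
    using frame_cases[OF r t]
  proof cases
    case (1 u)
    show ?thesis using frame_cases[OF s 1(1,2)]
    proof cases
      case (1 v)
      then show ?thesis
        using implant_apply[OF rs, of v f] implant_apply[OF s, of v f]
          implant_apply[OF r, of u "implant s f"] \<open>0 \<le> u\<close> \<open>u \<le> 1\<close> \<open>t = r u\<close> by simp
    next
      case 2
      then have "t < r (s 0) \<or> r (s 1) < t"
        using 1 r frame_range[OF s, of 0] frame_range[OF s, of 1]
          PL_less_iff[of r 0 1 u "s 0"] PL_less_iff[of r 0 1 "s 1" u] by (auto simp: frame_def)
      then show ?thesis using 1 2 t rs f s r implant_outside[OF rs f t] implant_outside[OF s f 1(1,2)]
        by (auto simp: implant_apply)
    qed
  next
    case 2
    then have "t < r (s 0) \<or> r (s 1) < t"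
      using frame_range[OF r, of "s 0"] frame_range[OF r, of "s 1"] frame_range[OF s, of 0] frame_range[OF s, of 1]
      by auto
    then show ?thesis using 2 implant_outside[OF rs f t] implant_outside[OF r sf t] by auto
  qed
qed

text \<open>
  Conjugation by \<open>k\<close> moves a copy to the image interval; written without inverses.
\<close>
lemma implant_conj:
  assumes k: "k \<in> carrier thompson_F" and r: "frame r" and f: "f \<in> carrier thompson_F"
  shows "k \<otimes>\<^bsub>thompson_F\<^esub> implant r f = implant (\<lambda>t. k (r t)) f \<otimes>\<^bsub>thompson_F\<^esub> k"
proof (rule F_eqI)
  have kr: "frame (\<lambda>t. k (r t))" using k r by (rule frame_F_compose)
  have mem: "implant r f \<in> carrier thompson_F" "implant (\<lambda>t. k (r t)) f \<in> carrier thompson_F"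
    using implant_in_F r f kr by auto
  then show "k \<otimes>\<^bsub>thompson_F\<^esub> implant r f \<in> carrier thompson_F"
    "implant (\<lambda>t. k (r t)) f \<otimes>\<^bsub>thompson_F\<^esub> k \<in> carrier thompson_F" using k by auto
  fix t :: real assume t: "0 \<le> t" "t \<le> 1"
  have "k (implant r f t) = implant (\<lambda>t. k (r t)) f (k t)"
    using frame_cases[OF r t]
  proof cases
    case (1 s)
    then show ?thesis using implant_apply[OF r, of s f] implant_apply[OF kr, of s f] by simp
  next
    case 2
    then have "k t < k (r 0) \<or> k (r 1) < k t"
      using t frame_range[OF r, of 0] frame_range[OF r, of 1] F_D[OF k]
        PL_less_iff[of k 0 1 t "r 0"] PL_less_iff[of k 0 1 "r 1" t] by auto
    then show ?thesis using 2 t implant_outside[OF r f t] implant_outside[OF kr f, of "k t"] F_range[OF k t]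
      by auto
  qed
  then show "(k \<otimes>\<^bsub>thompson_F\<^esub> implant r f) t = (implant (\<lambda>t. k (r t)) f \<otimes>\<^bsub>thompson_F\<^esub> k) t"
    using t k mem by (simp add: F_mult_apply)
qed

section \<open>Binary trees and the pentagon\<close>

datatype bracketing = Leaf | Node bracketing bracketing

fun leaves :: "bracketing \<Rightarrow> nat" where
  "leaves Leaf = 1"
| "leaves (Node A B) = leaves A + leaves B"

text \<open>
  A tree with \<open>n\<close> leaves divides \<open>[0,1]\<close> into \<open>n\<close> standard dyadic intervals, by halving at each inner
  node. The function maps \<open>[i, i + 1]\<close> affinely onto the \<open>i\<close>-th of them, so that an element of \<open>F\<close>
  carries \<open>T\<close> to \<open>S\<close> when it maps the intervals of \<open>T\<close> affinely and in order to those of \<open>S\<close>.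
\<close>
fun tree_param :: "bracketing \<Rightarrow> real \<Rightarrow> real" where
  "tree_param Leaf t = t"
| "tree_param (Node A B) t = (if t \<le> leaves A then tree_param A t / 2 else (1 + tree_param B (t - leaves A)) / 2)"

lemma leaves_pos [simp]: "0 < leaves T"
  by (induction T) auto

lemma tree_param_ends [simp]: "tree_param T 0 = 0" "tree_param T (real (leaves T)) = 1"
proof -
  show 0: "tree_param T 0 = 0" for T by (induction T) auto
  show "tree_param T (real (leaves T)) = 1"
    by (induction T) (auto simp: not_le)
qed

lemma tree_param_range: "0 \<le> t \<Longrightarrow> t \<le> real (leaves T) \<Longrightarrow> 0 \<le> tree_param T t \<and> tree_param T t \<le> 1"
proof (induction T arbitrary: t)
  case (Node A B)
  show ?case
  proof (cases "t \<le> real (leaves A)")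
    case True
    then show ?thesis using Node.IH(1)[of t] Node.prems by auto
  next
    case False
    then show ?thesis using Node.IH(2)[of "t - leaves A"] Node.prems by auto
  qed
qed auto

lemma tree_param_surj: "0 \<le> y \<Longrightarrow> y \<le> 1 \<Longrightarrow> \<exists>t. 0 \<le> t \<and> t \<le> real (leaves T) \<and> tree_param T t = y"
proof (induction T arbitrary: y)
  case (Node A B)
  show ?case
  proof (cases "y \<le> 1 / 2")
    case True
    then obtain t where "0 \<le> t" "t \<le> real (leaves A)" "tree_param A t = 2 * y"
      using Node.IH(1)[of "2 * y"] Node.prems by auto
    then show ?thesis by (intro exI[of _ t]) auto
  next
    case False
    then obtain t where t: "0 \<le> t" "t \<le> real (leaves B)" "tree_param B t = 2 * y - 1"
      using Node.IH(2)[of "2 * y - 1"] Node.prems by auto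
    then have "t \<noteq> 0" using False by auto
    then show ?thesis using t by (intro exI[of _ "leaves A + t"]) auto
  qed
qed auto

definition carries :: "(real \<Rightarrow> real) \<Rightarrow> bracketing \<Rightarrow> bracketing \<Rightarrow> bool" where
  "carries f T S \<longleftrightarrow> f \<in> carrier thompson_F \<and> leaves T = leaves S \<and>
     (\<forall>t. 0 \<le> t \<longrightarrow> t \<le> real (leaves T) \<longrightarrow> f (tree_param T t) = tree_param S t)"

lemma carries_one: "carries \<one>\<^bsub>thompson_F\<^esub> T T"
  using tree_param_range by (auto simp: carries_def F_one_apply)

lemma carries_mult:
  "carries f T S \<Longrightarrow> carries g S R \<Longrightarrow> carries (g \<otimes>\<^bsub>thompson_F\<^esub> f) T R"
  using tree_param_range by (auto simp: carries_def F_mult_apply)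

lemma carries_unique:
  assumes "carries f T S" "carries g T S" shows "f = g"
proof (rule F_eqI)
  fix y :: real assume "0 \<le> y" "y \<le> 1"
  then obtain t where "0 \<le> t" "t \<le> real (leaves T)" "y = tree_param T t" using tree_param_surj by metis
  then show "f y = g y" using assms by (auto simp: carries_def)
qed (use assms in \<open>auto simp: carries_def\<close>)

definition left_half :: "real \<Rightarrow> real" where "left_half t = t / 2"
definition right_half :: "real \<Rightarrow> real" where "right_half t = (1 + t) / 2"

lemma frame_halves: "frame left_half" "frame right_half"
proof -
  have "PL left_half 0 1"
    by (rule PL.affine[of 0 1 0 _ "-1"]) (auto simp: left_half_def power_int_minus)
  then show "frame left_half" by (auto simp: frame_def left_half_def)
  have "PL right_half 0 1"
    by (rule PL.affine[of 0 1 "1/2" _ "-1"]) (auto simp: right_half_def power_int_minus)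
  then show "frame right_half" by (auto simp: frame_def right_half_def)
qed

lemma carries_Node:
  assumes "carries f A A'" "carries g B B'"
  shows "carries (implant left_half f \<otimes>\<^bsub>thompson_F\<^esub> implant right_half g) (Node A B) (Node A' B')"
proof -
  have fg: "f \<in> carrier thompson_F" "g \<in> carrier thompson_F" using assms by (auto simp: carries_def)
  have i: "implant left_half f \<in> carrier thompson_F" "implant right_half g \<in> carrier thompson_F"
    using fg implant_in_F frame_halves by auto
  have "(implant left_half f \<otimes>\<^bsub>thompson_F\<^esub> implant right_half g) (tree_param (Node A B) t) = tree_param (Node A' B') t"
    if t: "0 \<le> t" "t \<le> real (leaves (Node A B))" for t
  proof (cases "t \<le> real (leaves A)")
    case True
    have r: "0 \<le> tree_param A t" "tree_param A t \<le> 1" using tree_param_range[of t A] True t by auto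
    have h: "implant right_half g (left_half (tree_param A t)) = left_half (tree_param A t)"
      using r fg frame_halves by (intro implant_outside) (auto simp: right_half_def left_half_def)
    have "(implant left_half f \<otimes>\<^bsub>thompson_F\<^esub> implant right_half g) (tree_param (Node A B) t)
        = implant left_half f (implant right_half g (left_half (tree_param A t)))"
      using True r i by (simp add: F_mult_apply left_half_def)
    also have "\<dots> = implant left_half f (left_half (tree_param A t))" by (simp only: h)
    also have "\<dots> = f (tree_param A t) / 2"
      using implant_apply[OF frame_halves(1) r] by (simp add: left_half_def)
    also have "\<dots> = tree_param (Node A' B') t" using True t assms by (simp add: carries_def)
    finally show ?thesis .
  next
    case False
    define s where "s = t - leaves A"
    have s: "0 \<le> s" "s \<le> real (leaves B)" using False t by (auto simp: s_def)
    have r: "0 \<le> tree_param B s" "tree_param B s \<le> 1" using tree_param_range[of s B] s by auto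
    have gs: "g (tree_param B s) = tree_param B' s" using assms s by (simp add: carries_def)
    have r': "0 \<le> tree_param B' s" "tree_param B' s \<le> 1" using F_range[OF fg(2) r] gs by auto
    have "(implant left_half f \<otimes>\<^bsub>thompson_F\<^esub> implant right_half g) (tree_param (Node A B) t)
        = implant left_half f (implant right_half g (right_half (tree_param B s)))"
      using False r i by (simp add: F_mult_apply right_half_def s_def)
    also have "\<dots> = implant left_half f (right_half (tree_param B' s))"
      by (simp only: implant_apply[OF frame_halves(2) r] gs)
    also have "\<dots> = right_half (tree_param B' s)"
      using r' fg frame_halves by (intro implant_outside) (auto simp: left_half_def right_half_def)
    also have "\<dots> = tree_param (Node A' B') t"
      using False t assms by (simp add: carries_def right_half_def s_def)
    finally show ?thesis .
  qed
  then show ?thesis using i assms by (simp add: carries_def)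
qed

text \<open>
  The generator usually called \<open>x\<^sub>0\<close> (or its inverse): it rebrackets \<open>(AB)C\<close> to \<open>A(BC)\<close>.
\<close>
definition associator :: "real \<Rightarrow> real" where
  "associator = (\<lambda>t\<in>{0..1}. if t \<le> 1/2 then (if t \<le> 1/4 then 2 powi 1 * t + 0 else t + 1/4)
      else 2 powi (-1) * t + 1/2)"

lemma associator_in_F: "associator \<in> carrier thompson_F"
proof -
  have "PL (\<lambda>t. if t \<le> 1/2 then (if t \<le> 1/4 then 2 powi 1 * t + 0 else t + 1/4)
      else 2 powi (-1) * t + 1/2) 0 1"
    by (intro PL_glue PL_affine PL_translate) (auto simp: power_int_minus)
  then show ?thesis unfolding associator_def by (intro restrict_in_F) (auto simp: power_int_minus)
qed

lemma carries_associator: "carries associator (Node (Node A B) C) (Node A (Node B C))"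
proof -
  have "associator (tree_param (Node (Node A B) C) t) = tree_param (Node A (Node B C)) t"
    if t: "0 \<le> t" "t \<le> real (leaves (Node (Node A B) C))" for t
  proof -
    consider "t \<le> real (leaves A)" | "real (leaves A) < t" "t \<le> real (leaves A) + real (leaves B)"
      | "real (leaves A) + real (leaves B) < t"
      by linarith
    then show ?thesis
    proof cases
      case 1
      then show ?thesis using tree_param_range[of t A] t by (simp add: associator_def)
    next
      case 2
      then show ?thesis using tree_param_range[of "t - leaves A" B] t
        by (auto simp: associator_def field_simps power_int_minus)
    next
      case 3
      then show ?thesis using tree_param_range[of "t - (real (leaves A) + real (leaves B))" C] t
        by (auto simp: associator_def field_simps power_int_minus)
    qed
  qed
  then show ?thesis using associator_in_F by (simp add: carries_def)
qed

text \<open>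
  Both sides rebracket \<open>((AB)C)D\<close> to \<open>A(B(CD))\<close>, and an element of \<open>F\<close> is determined by the trees
  that it carries to each other.
\<close>
lemma pentagon:
  "associator \<otimes>\<^bsub>thompson_F\<^esub> associator =
     implant right_half associator \<otimes>\<^bsub>thompson_F\<^esub> (associator \<otimes>\<^bsub>thompson_F\<^esub> implant left_half associator)"
proof -
  note a = associator_in_F
  have one: "implant r \<one>\<^bsub>thompson_F\<^esub> = \<one>\<^bsub>thompson_F\<^esub>" if "frame r" for r
    using group_hom.hom_one[OF implant_hom[OF that]] .
  have L: "carries (implant left_half associator) (Node (Node (Node A B) C) D) (Node (Node A (Node B C)) D)" for A B C D
    using carries_Node[OF carries_associator carries_one] one frame_halves implant_in_F a by simp
  have R: "carries (implant right_half associator) (Node D (Node (Node A B) C)) (Node D (Node A (Node B C)))" for A B C D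
    using carries_Node[OF carries_one carries_associator] one frame_halves implant_in_F a by simp
  show ?thesis
    using carries_mult[OF carries_associator carries_associator] carries_mult[OF carries_mult[OF L carries_associator] R]
    by (rule carries_unique)
qed

section \<open>Every element of F carries a tree to a tree\<close>

text \<open>
  The intervals \<open>[i, i + 1]\<close> are mapped affinely onto standard dyadic intervals
  \<open>[j / 2\<^sup>m, (j + 1) / 2\<^sup>m]\<close>.
\<close>
definition standard_param :: "(real \<Rightarrow> real) \<Rightarrow> nat \<Rightarrow> bool" where
  "standard_param g n \<longleftrightarrow> g 0 = 0 \<and> g (real n) = 1 \<and>
     (\<forall>i<n. \<exists>(m::nat) (j::int). \<forall>s\<in>{0..1}. g (real i + s) = (of_int j + s) / 2 ^ m)"

lemma standard_param_less:
  assumes "standard_param g n" shows "i < j \<Longrightarrow> j \<le> n \<Longrightarrow> g (real i) < g (real j)"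
proof (induction j)
  case (Suc j)
  then obtain m :: nat and k :: int where "\<forall>s\<in>{0..1}. g (real j + s) = (of_int k + s) / 2 ^ m"
    using assms unfolding standard_param_def by (metis Suc_le_lessD)
  then have "g (real j + 0) = (of_int k + 0) / 2 ^ m" "g (real j + 1) = (of_int k + 1) / 2 ^ m"
    by (meson atLeastAtMost_iff order_refl zero_le_one)+
  then have "g (real j) < g (real (Suc j))" by (simp add: add.commute divide_strict_right_mono)
  then show ?case using Suc by (cases "i = j") auto
qed simp

lemma standard_param_piece_small:
  assumes g: "standard_param g n" and ab: "a \<le> i" "i < b" "b \<le> n" "g (real b) - g (real a) \<le> 1 / 2"
  shows "\<exists>(m::nat) (j::int). \<forall>s\<in>{0..1}. g (real i + s) = (of_int j + s) / 2 ^ Suc m"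
proof -
  obtain m :: nat and j :: int where mj: "\<forall>s\<in>{0..1}. g (real i + s) = (of_int j + s) / 2 ^ m"
    using g ab unfolding standard_param_def by (metis less_le_trans)
  then have e: "g (real i + 0) = (of_int j + 0) / 2 ^ m" "g (real i + 1) = (of_int j + 1) / 2 ^ m"
    by (meson atLeastAtMost_iff order_refl zero_le_one)+
  have "g (real a) \<le> g (real i)" "g (real (Suc i)) \<le> g (real b)"
    using standard_param_less[OF g, of a i] standard_param_less[OF g, of "Suc i" b] ab
    by (cases "a = i"; cases "Suc i = b"; force)+
  then have "g (real i + 1) - g (real i + 0) \<le> 1/2" using ab by (simp add: add.commute)
  then have "1 / 2 ^ m \<le> (1/2 :: real)" unfolding e by (simp add: field_simps)
  then have "m \<noteq> 0" by (intro notI) simp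
  then show ?thesis using mj by (intro exI[of _ "m - 1"] exI[of _ j]) simp
qed

text \<open>
  A standard dyadic interval with \<open>1/2\<close> in its interior is \<open>[0,1]\<close> itself. So if there are at least two
  intervals then \<open>1/2\<close> is an end point of one of them: it is the image of the last \<open>i\<close> with
  \<open>g i \<le> 1/2\<close>.
\<close>
lemma standard_param_half:
  assumes g: "standard_param g n" and "n > 1"
  obtains i where "0 < i" "i < n" "g (real i) = 1 / 2"
proof -
  have g0: "g 0 = 0" and gn: "g (real n) = 1" using g by (auto simp: standard_param_def)
  define S where "S = {i. i \<le> n \<and> g (real i) \<le> 1 / 2}"
  have "finite S" "0 \<in> S" using g0 by (auto simp: S_def)
  define i where "i = Max S"
  have "i \<in> S" unfolding i_def using \<open>finite S\<close> \<open>0 \<in> S\<close> by (intro Max_in) auto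
  then have i: "i < n" "g (real i) \<le> 1 / 2" using gn by (auto simp: S_def le_less)
  have "Suc i \<notin> S" using Max_ge[OF \<open>finite S\<close>, of "Suc i"] by (auto simp: i_def)
  then have i': "g (real (Suc i)) > 1 / 2" using i by (auto simp: S_def)
  obtain m :: nat and j :: int where mj: "\<forall>s\<in>{0..1}. g (real i + s) = (of_int j + s) / 2 ^ m"
    using g i unfolding standard_param_def by blast
  then have "g (real i + 0) = (of_int j + 0) / 2 ^ m" "g (real i + 1) = (of_int j + 1) / 2 ^ m"
    by (meson atLeastAtMost_iff order_refl zero_le_one)+
  then have e: "g (real i) = of_int j / 2 ^ m" "g (real (Suc i)) = (of_int j + 1) / 2 ^ m"
    by (simp_all add: add.commute)
  have "m \<noteq> 0"
  proof
    assume "m = 0"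
    then have "of_int j \<le> (1/2::real)" "of_int j + 1 > (1/2::real)" using e i i' by auto
    then have "j = 0" by linarith
    then have "g (real i) = 0" "g (real (Suc i)) = 1" using e \<open>m = 0\<close> by auto
    then have "i = 0" "Suc i = n"
      using standard_param_less[OF g, of 0 i] standard_param_less[OF g, of "Suc i" n] g0 gn i by (force, force)
    then show False using \<open>n > 1\<close> by simp
  qed
  then obtain p where p: "m = Suc p" by (cases m) auto
  have "of_int j \<le> (2 ^ p :: real)" "(2 ^ p :: real) < of_int j + 1"
    using i(2) i' unfolding e p by (auto simp: field_simps)
  then have "real_of_int j \<le> real_of_int (2 ^ p)" "real_of_int (2 ^ p) < real_of_int (j + 1)" by auto
  then have "j \<le> 2 ^ p" "2 ^ p < j + 1" by (simp_all only: of_int_le_iff of_int_less_iff)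
  then have "j = 2 ^ p" by simp
  then have half: "g (real i) = 1 / 2" by (simp add: e p)
  then have "i \<noteq> 0" using g0 by (intro notI) simp
  then show ?thesis using half i that by blast
qed

text \<open>
  Cutting at the point that is mapped to \<open>1/2\<close> gives the two subtrees; their parametrisations are the
  two halves of \<open>g\<close>, rescaled to \<open>[0,1]\<close>.
\<close>
lemma standard_param_tree: "n > 0 \<Longrightarrow> standard_param g n \<Longrightarrow> \<exists>S. leaves S = n \<and> (\<forall>t. 0 \<le> t \<longrightarrow> t \<le> real n \<longrightarrow> tree_param S t = g t)"
proof (induction n arbitrary: g rule: less_induct)
  case (less n)
  note g = less.prems(2)
  have g0: "g 0 = 0" and gn: "g (real n) = 1" using g by (auto simp: standard_param_def)
  show ?case
  proof (cases "n = 1")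
    case True
    then obtain m :: nat and j :: int where mj: "\<forall>s\<in>{0..1}. g (0 + s) = (of_int j + s) / 2 ^ m"
      using g unfolding standard_param_def by force
    then have "g (0 + 0) = (of_int j + 0) / 2 ^ m" "g (0 + 1) = (of_int j + 1) / 2 ^ m"
      by (meson atLeastAtMost_iff order_refl zero_le_one)+
    then have "j = 0" "(2::real) ^ m = 1" using g0 gn True by auto
    then show ?thesis using mj True by (intro exI[of _ Leaf]) auto
  next
    case False
    then obtain i where i: "0 < i" "i < n" "g (real i) = 1 / 2"
      using standard_param_half[OF g] less.prems(1) by (metis Suc_lessI One_nat_def)
    have "standard_param (\<lambda>t. 2 * g t) i"
      unfolding standard_param_def
    proof (intro conjI allI impI)
      fix l assume "l < i"
      then have "\<exists>(m::nat) (j::int). \<forall>s\<in>{0..1}. g (real l + s) = (of_int j + s) / 2 ^ Suc m"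
        using i g0 by (intro standard_param_piece_small[OF g, of 0 l i]) auto
      then obtain m :: nat and j :: int
        where "\<And>s. s \<in> {0..1} \<Longrightarrow> g (real l + s) = (of_int j + s) / 2 ^ Suc m" by blast
      then have "\<forall>s\<in>{0..1}. 2 * g (real l + s) = (of_int j + s) / 2 ^ m" by (simp add: field_simps)
      then show "\<exists>m j. \<forall>s\<in>{0..1}. 2 * g (real l + s) = (of_int j + s) / 2 ^ m" by blast
    qed (use g0 i in auto)
    then obtain A where A: "leaves A = i" "\<And>t. 0 \<le> t \<Longrightarrow> t \<le> real i \<Longrightarrow> tree_param A t = 2 * g t"
      using less.IH[OF i(2,1)] by blast
    have "standard_param (\<lambda>t. 2 * g (real i + t) - 1) (n - i)"
      unfolding standard_param_def
    proof (intro conjI allI impI)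
      fix l assume "l < n - i"
      then have "\<exists>(m::nat) (j::int). \<forall>s\<in>{0..1}. g (real (i + l) + s) = (of_int j + s) / 2 ^ Suc m"
        using i gn by (intro standard_param_piece_small[OF g, of i "i + l" n]) auto
      then obtain m :: nat and j :: int
        where "\<And>s. s \<in> {0..1} \<Longrightarrow> g (real (i + l) + s) = (of_int j + s) / 2 ^ Suc m" by blast
      then have "\<forall>s\<in>{0..1}. 2 * g (real i + (real l + s)) - 1 = (of_int (j - 2 ^ m) + s) / 2 ^ m"
        by (auto simp: add.assoc diff_divide_distrib add_divide_distrib)
      then show "\<exists>m j. \<forall>s\<in>{0..1}. 2 * g (real i + (real l + s)) - 1 = (of_int j + s) / 2 ^ m" by blast
    qed (use gn i in auto)
    then obtain B where B: "leaves B = n - i"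
      "\<And>t. 0 \<le> t \<Longrightarrow> t \<le> real (n - i) \<Longrightarrow> tree_param B t = 2 * g (real i + t) - 1"
      using less.IH[of "n - i"] i by auto
    show ?thesis
    proof (intro exI[of _ "Node A B"] conjI allI impI)
      show "leaves (Node A B) = n" using A B i by simp
      fix t :: real assume t: "0 \<le> t" "t \<le> real n"
      show "tree_param (Node A B) t = g t"
      proof (cases "t \<le> i")
        case True then show ?thesis using A t by simp
      next
        case False
        then show ?thesis using B(2)[of "t - i"] A(1) t i by (simp add: of_nat_diff)
      qed
    qed
  qed
qed

text \<open>
  On a piece \<open>2\<^sup>k t + p / 2\<^sup>q\<close> the interval \<open>[i, i + 1] / 2\<^sup>N\<close> has length \<open>2\<^sup>-\<^sup>m\<close> after mapping, where
  \<open>m = N - k\<close>, and its left end is a multiple of \<open>2\<^sup>-\<^sup>m\<close> as soon as \<open>m \<ge> q\<close>. Fine subdivisions do not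
  straddle the break between two pieces.
\<close>
lemma PL_standard:
  "PL f c d \<Longrightarrow> \<exists>N0. \<forall>N\<ge>N0. \<forall>i::int. c \<le> of_int i / 2 ^ N \<longrightarrow> (of_int i + 1) / 2 ^ N \<le> d \<longrightarrow>
     (\<exists>(m::nat) (j::int). \<forall>s\<in>{0..1}. f ((of_int i + s) / 2 ^ N) = (of_int j + s) / 2 ^ m)"
proof (induction rule: PL.induct)
  case (affine c d b k)
  obtain p q where pq: "b = of_int p / 2 ^ q" using affine.hyps(2) by (auto simp: dyadic_def)
  show ?case
  proof (rule exI[of _ "nat (k + int q)"], intro allI impI)
    fix N and i :: int
    assume N: "nat (k + int q) \<le> N" and i: "c \<le> of_int i / 2 ^ N" "(of_int i + 1) / 2 ^ N \<le> d"
    define m where "m = nat (int N - k)"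
    have m: "int m = int N - k" "q \<le> m" using N by (auto simp: m_def)
    then obtain r where r: "m = q + r" using le_Suc_ex by blast
    have pw: "(2::real) powi k / 2 ^ N = 1 / 2 ^ m"
    proof -
      have "(2::real) powi k * 2 ^ m = 2 powi (k + int m)" by (simp add: power_int_add)
      also have "\<dots> = 2 ^ N" by (simp add: m(1))
      finally show ?thesis by (simp add: field_simps)
    qed
    have "f ((of_int i + s) / 2 ^ N) = (of_int (i + p * 2 ^ r) + s) / 2 ^ m" if s: "s \<in> {0..1}" for s
    proof -
      have "of_int i / 2 ^ N \<le> (of_int i + s) / 2 ^ N" "(of_int i + s) / 2 ^ N \<le> (of_int i + 1) / 2 ^ N"
        using s by (auto intro: divide_right_mono)
      then have "f ((of_int i + s) / 2 ^ N) = 2 powi k * ((of_int i + s) / 2 ^ N) + b"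
        using i by (intro affine.hyps(3)) auto
      also have "\<dots> = (of_int i + s) * (2 powi k / 2 ^ N) + b" by simp
      also have "\<dots> = (of_int (i + p * 2 ^ r) + s) / 2 ^ m"
        unfolding pw by (simp add: pq r power_add field_simps)
      finally show ?thesis .
    qed
    then show "\<exists>(m::nat) (j::int). \<forall>s\<in>{0..1}. f ((of_int i + s) / 2 ^ N) = (of_int j + s) / 2 ^ m" by blast
  qed
next
  case (join c x d)
  let ?P = "\<lambda>N i. \<exists>(m::nat) (j::int). \<forall>s\<in>{0..1}. f ((of_int i + s) / 2 ^ N) = (of_int j + s) / 2 ^ m"
  obtain N1 where N1: "\<And>N i. N \<ge> N1 \<Longrightarrow> c \<le> of_int i / 2 ^ N \<Longrightarrow> (of_int i + 1) / 2 ^ N \<le> x \<Longrightarrow> ?P N i"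
    using join.IH(1) by blast
  obtain N2 where N2: "\<And>N i. N \<ge> N2 \<Longrightarrow> x \<le> of_int i / 2 ^ N \<Longrightarrow> (of_int i + 1) / 2 ^ N \<le> d \<Longrightarrow> ?P N i"
    using join.IH(2) by blast
  obtain p q where pq: "x = of_int p / 2 ^ q" using join.hyps(3) by (auto simp: dyadic_def)
  show ?case
  proof (rule exI[of _ "N1 + N2 + q"], intro allI impI)
    fix N and i :: int
    assume N: "N1 + N2 + q \<le> N" and i: "c \<le> of_int i / 2 ^ N" "(of_int i + 1) / 2 ^ N \<le> d"
    then obtain r where r: "N = q + r" using le_Suc_ex[of q N] by auto
    have x: "x = of_int (p * 2 ^ r) / 2 ^ N" by (simp add: pq r power_add)
    consider "p * 2 ^ r \<le> i" | "i + 1 \<le> p * 2 ^ r" by linarith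
    then show "?P N i"
    proof cases
      case 1
      then have "(of_int (p * 2 ^ r) :: real) \<le> of_int i" by (simp only: of_int_le_iff)
      then have "x \<le> of_int i / 2 ^ N" unfolding x by (intro divide_right_mono) auto
      then show ?thesis using N2 N i by auto
    next
      case 2
      then have "(of_int (i + 1) :: real) \<le> of_int (p * 2 ^ r)" by (simp only: of_int_le_iff)
      then have "(of_int i + 1) / 2 ^ N \<le> x" unfolding x by (intro divide_right_mono) auto
      then show ?thesis using N1 N i by auto
    qed
  qed
qed

fun full_tree :: "nat \<Rightarrow> bracketing" where
  "full_tree 0 = Leaf"
| "full_tree (Suc n) = Node (full_tree n) (full_tree n)"

lemma leaves_full_tree [simp]: "leaves (full_tree N) = 2 ^ N"
  by (induction N) auto

lemma tree_param_full: "0 \<le> t \<Longrightarrow> t \<le> 2 ^ N \<Longrightarrow> tree_param (full_tree N) t = t / 2 ^ N"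
proof (induction N arbitrary: t)
  case (Suc N)
  then show ?case using Suc.IH[of t] Suc.IH[of "t - 2 ^ N"] by (auto simp: field_simps)
qed simp

lemma F_carries:
  assumes "f \<in> carrier thompson_F"
  obtains T S where "carries f T S"
proof -
  note f = F_D[OF assms]
  from PL_standard[OF f(2)]
  obtain N where N: "\<And>i::int. 0 \<le> real_of_int i / 2 ^ N \<Longrightarrow> (real_of_int i + 1) / 2 ^ N \<le> 1 \<Longrightarrow>
     \<exists>(m::nat) (j::int). \<forall>s\<in>{0..1}. f ((of_int i + s) / 2 ^ N) = (of_int j + s) / 2 ^ m"
    by (metis order_refl)
  have "standard_param (\<lambda>t. f (t / 2 ^ N)) (2 ^ N)"
    unfolding standard_param_def
  proof (intro conjI allI impI)
    fix i :: nat assume "i < 2 ^ N"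
    then have "real (Suc i) \<le> real (2 ^ N)" by (intro of_nat_mono) simp
    then have "(real i + 1) / 2 ^ N \<le> 1" by (simp add: divide_le_eq add.commute)
    then show "\<exists>(m::nat) (j::int). \<forall>s\<in>{0..1}. f ((real i + s) / 2 ^ N) = (of_int j + s) / 2 ^ m"
      using N[of "int i"] by simp
  qed (use f in auto)
  from standard_param_tree[OF _ this]
  obtain S where "leaves S = 2 ^ N" "\<And>t. 0 \<le> t \<Longrightarrow> t \<le> real (2 ^ N) \<Longrightarrow> tree_param S t = f (t / 2 ^ N)"
    by auto
  then have "carries f (full_tree N) S" using assms by (simp add: carries_def tree_param_full)
  then show ?thesis using that by blast
qed

fun vine :: "nat \<Rightarrow> bracketing" where
  "vine 0 = Leaf"
| "vine (Suc n) = Node Leaf (vine n)"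

section \<open>The kernel of phi\<close>

text \<open>
  Moves \<open>a\<close> to \<open>b\<close> while fixing a neighbourhood of \<open>0\<close>; together with its mirror image this extends maps
  between inner intervals to elements of the kernel of \<open>\<phi>\<close>.
\<close>
lemma stretch_left:
  assumes "0 < a" "0 < b" "a \<in> dyadic" "b \<in> dyadic"
  obtains h e where "0 < e" "e < a" "PL h 0 a" "\<And>t. t \<le> e \<Longrightarrow> h t = t" "h a = b"
proof -
  obtain e where e: "e \<in> dyadic" "0 < e" "e < min a b"
    using dyadic_between[of 0 "min a b"] assms by auto
  obtain h where h: "PL h e a" "h e = e" "h a = b"
    using PL_exists[of e a e b] e assms by auto
  have "PL (\<lambda>t. if t \<le> e then t else h t) 0 a"
    using e h by (intro PL_glue PL_id) auto
  then show ?thesis using e h by (intro that[of e "\<lambda>t. if t \<le> e then t else h t"]) auto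
qed

lemma stretch_right:
  assumes "a < 1" "b < 1" "a \<in> dyadic" "b \<in> dyadic"
  obtains h e where "0 < e" "a < 1 - e" "PL h a 1" "\<And>t. 1 - e \<le> t \<Longrightarrow> h t = t" "h a = b"
proof -
  have "1 - a \<in> dyadic" "1 - b \<in> dyadic" using assms by (auto intro: dyadic_diff)
  then obtain h e where h: "0 < e" "e < 1 - a" "PL h 0 (1 - a)" "\<And>t. t \<le> e \<Longrightarrow> h t = t" "h (1 - a) = 1 - b"
    using stretch_left[of "1 - a" "1 - b"] assms by (metis diff_gt_0_iff_gt)
  have "PL (\<lambda>t. 1 - h (1 - t)) a 1" using PL_reflect[OF h(3)] by simp
  then show ?thesis using h by (intro that[of e "\<lambda>t. 1 - h (1 - t)"]) auto
qed

definition ker_phi :: "(real \<Rightarrow> real) set" where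
  "ker_phi = {f \<in> carrier thompson_F. phi f = (0, 0)}"

lemma ker_phi_support:
  assumes "g \<in> ker_phi"
  obtains c d where "c \<in> dyadic" "d \<in> dyadic" "0 < c" "c < d" "d < 1"
    "\<And>t. 0 \<le> t \<Longrightarrow> t \<le> c \<Longrightarrow> g t = t" "\<And>t. d \<le> t \<Longrightarrow> t \<le> 1 \<Longrightarrow> g t = t"
proof -
  have g: "g \<in> carrier thompson_F" "phi g = (0, 0)" using assms by (auto simp: ker_phi_def)
  obtain e where e: "e > 0" "e \<le> 1" "\<And>t. 0 \<le> t \<Longrightarrow> t \<le> e \<Longrightarrow> g t = t"
    "\<And>t. 0 \<le> t \<Longrightarrow> t \<le> e \<Longrightarrow> g (1 - t) = 1 - t"
    using F_germs[OF g(1)] g(2) by (metis fst_conv mult_1 power_int_0_right snd_conv)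
  obtain c where c: "c \<in> dyadic" "0 < c" "c < min e (1/2)"
    using dyadic_between[of 0 "min e (1/2)"] e by auto
  have "1 - c \<in> dyadic" using c by auto
  then show ?thesis using c e(3) e(4)[of "1 - t" for t] by (intro that[of c "1 - c"]) auto
qed

lemma ker_phi_I:
  assumes "g \<in> carrier thompson_F" "0 < e" "\<And>t. 0 \<le> t \<Longrightarrow> t \<le> e \<Longrightarrow> g t = t"
    "\<And>t. 1 - e \<le> t \<Longrightarrow> t \<le> 1 \<Longrightarrow> g t = t"
  shows "g \<in> ker_phi"
  using assms phi_eqI[of e g 0 0] by (auto simp: ker_phi_def)

definition interior_frame :: "(real \<Rightarrow> real) \<Rightarrow> bool" where
  "interior_frame r \<longleftrightarrow> frame r \<and> 0 < r 0 \<and> r 1 < 1"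

lemma implant_interior:
  assumes "interior_frame r" "f \<in> carrier thompson_F"
  shows "implant r f \<in> ker_phi"
proof (rule ker_phi_I[of _ "min (r 0) (1 - r 1)"])
  show "implant r f \<in> carrier thompson_F" "0 < min (r 0) (1 - r 1)"
    using assms implant_in_F by (auto simp: interior_frame_def)
  fix t :: real
  have r: "frame r" "0 < r 0" "r 0 < r 1" "r 1 < 1" using assms frame_less by (auto simp: interior_frame_def)
  show "implant r f t = t" if "0 \<le> t" "t \<le> min (r 0) (1 - r 1)"
    using that r assms(2) by (intro implant_outside) auto
  show "implant r f t = t" if "1 - min (r 0) (1 - r 1) \<le> t" "t \<le> 1"
    using that r assms(2) by (intro implant_outside) auto
qed

text \<open>
  The map \<open>s r\<^sup>-\<^sup>1\<close> between the two inner intervals is extended on either side by stretches that are the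
  identity near \<open>0\<close> and near \<open>1\<close>.
\<close>
lemma interior_transitive:
  assumes "interior_frame r" "interior_frame s"
  obtains k where "k \<in> ker_phi" "\<And>t. 0 \<le> t \<Longrightarrow> t \<le> 1 \<Longrightarrow> k (r t) = s t"
proof -
  have r: "PL r 0 1" "0 < r 0" "r 0 < r 1" "r 1 < 1" "r 0 \<in> dyadic" "r 1 \<in> dyadic"
    using assms(1) frame_less[of r] frame_dyadic[of r] by (auto simp: interior_frame_def frame_def)
  have s: "PL s 0 1" "0 < s 0" "s 0 < s 1" "s 1 < 1" "s 0 \<in> dyadic" "s 1 \<in> dyadic"
    using assms(2) frame_less[of s] frame_dyadic[of s] by (auto simp: interior_frame_def frame_def)
  obtain h e where h: "0 < e" "e < r 0" "PL h 0 (r 0)" "\<And>t. t \<le> e \<Longrightarrow> h t = t" "h (r 0) = s 0"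
    using stretch_left[of "r 0" "s 0"] r s by metis
  obtain h' e' where h': "0 < e'" "r 1 < 1 - e'" "PL h' (r 1) 1" "\<And>t. 1 - e' \<le> t \<Longrightarrow> h' t = t" "h' (r 1) = s 1"
    using stretch_right[of "r 1" "s 1"] r s by metis
  obtain q where q: "PL q (r 0) (r 1)" "\<And>t. 0 \<le> t \<Longrightarrow> t \<le> 1 \<Longrightarrow> q (r t) = t"
    using PL_has_inverse[OF r(1)] by metis
  have q01: "q (r 0) = 0" "q (r 1) = 1" using q(2) by auto
  have sq: "PL (\<lambda>t. s (q t)) (r 0) (r 1)" by (rule PL_compose[OF s(1) q(1) q01])
  define k1 where "k1 = (\<lambda>t. if t \<le> r 0 then h t else s (q t))"
  define k where "k = (\<lambda>t. if t \<le> r 1 then k1 t else h' t)"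
  have 1: "PL k1 0 (r 1)" unfolding k1_def
    by (rule PL_glue[OF h(3) sq]) (use h q01 r in auto)
  have "PL k 0 1" unfolding k_def
    by (rule PL_glue[OF 1 h'(3)]) (use h' q01 r in \<open>auto simp: k1_def\<close>)
  then have kF: "restrict k {0..1} \<in> carrier thompson_F"
    using h h' r by (intro restrict_in_F) (auto simp: k_def k1_def)
  have "restrict k {0..1} \<in> ker_phi"
    by (rule ker_phi_I[OF kF, of "min e e'"]) (use h h' r in \<open>auto simp: k_def k1_def\<close>)
  moreover have "restrict k {0..1} (r t) = s t" if t: "0 \<le> t" "t \<le> 1" for t
  proof -
    have "r 0 \<le> r t" "r t \<le> r 1" using PL_le_iff[OF r(1)] t by auto
    moreover have "t = 0" if "r t = r 0" using PL_eq_iff[OF r(1), of t 0] t that by auto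
    ultimately show ?thesis using q(2)[OF t] r h by (auto simp: k_def k1_def)
  qed
  ultimately show ?thesis using that by blast
qed

lemma implant_cong:
  assumes "frame r" "frame s" "f \<in> carrier thompson_F" "\<And>t. 0 \<le> t \<Longrightarrow> t \<le> 1 \<Longrightarrow> r t = s t"
  shows "implant r f = implant s f"
proof (rule F_eqI)
  fix t :: real assume t: "0 \<le> t" "t \<le> 1"
  show "implant r f t = implant s f t"
    using frame_cases[OF assms(1) t]
  proof cases
    case (1 v)
    then show ?thesis using implant_apply[OF assms(1), of v f] implant_apply[OF assms(2), of v f]
      assms F_range[OF assms(3), of v] by simp
  next
    case 2
    then show ?thesis using implant_outside[OF assms(1,3) t] implant_outside[OF assms(2,3) t] assms(4)[of 0] assms(4)[of 1]
      by auto
  qed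
qed (use assms implant_in_F in auto)

lemma commute_of_disjoint:
  assumes "g \<in> carrier thompson_F" "h \<in> carrier thompson_F" "0 \<le> d" "d \<le> 1"
    and g: "\<And>t. d \<le> t \<Longrightarrow> t \<le> 1 \<Longrightarrow> g t = t" and h: "\<And>t. 0 \<le> t \<Longrightarrow> t \<le> d \<Longrightarrow> h t = t"
  shows "g \<otimes>\<^bsub>thompson_F\<^esub> h = h \<otimes>\<^bsub>thompson_F\<^esub> g"
proof (rule F_eqI)
  fix t :: real assume t: "0 \<le> t" "t \<le> 1"
  have "g (h t) = h (g t)"
  proof (cases "t \<le> d")
    case True
    then have "0 \<le> g t" "g t \<le> d"
      using g[of d] PL_le_iff[OF F_D(2)[OF assms(1)], of t d] F_range[OF assms(1) t] t assms(4) by auto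
    then show ?thesis using h True t by auto
  next
    case False
    then have "d \<le> h t" "h t \<le> 1"
      using h[of d] PL_le_iff[OF F_D(2)[OF assms(2)], of d t] F_range[OF assms(2) t] t assms(3) by auto
    then show ?thesis using g False t by auto
  qed
  then show "(g \<otimes>\<^bsub>thompson_F\<^esub> h) t = (h \<otimes>\<^bsub>thompson_F\<^esub> g) t"
    using assms(1,2) t by (simp add: F_mult_apply)
qed (use assms in auto)

text \<open>
  It suffices to move a dyadic \<open>c' \<le> c\<close> to some \<open>d' \<ge> d\<close> by \<open>f\<close> itself: since \<open>f\<close> is increasing and
  \<open>c' < f c'\<close>, further applications of \<open>f\<close> only increase the value.
\<close>
lemma push_right:
  assumes "0 < c" "c \<le> 1" "d < 1" "m > (0::nat)"
  obtains f where "f \<in> carrier thompson_F" "d \<le> (f [^]\<^bsub>thompson_F\<^esub> m) c"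
proof (cases "c < d")
  case False
  then show ?thesis using assms by (intro that[of "\<one>\<^bsub>thompson_F\<^esub>"]) (auto simp: F_one_apply)
next
  case True
  obtain c' where c': "c' \<in> dyadic" "0 < c'" "c' < c" using dyadic_between[of 0 c] assms by auto
  obtain d' where d': "d' \<in> dyadic" "d < d'" "d' < 1" using dyadic_between[of d 1] assms by auto
  obtain h where h: "PL h 0 c'" "h 0 = 0" "h c' = d'" using PL_exists[of 0 c' 0 d'] c' d' True by auto
  obtain h' where h': "PL h' c' 1" "h' c' = d'" "h' 1 = 1" using PL_exists[of c' 1 d' 1] c' d' True assms by auto
  define f where "f = restrict (\<lambda>t. if t \<le> c' then h t else h' t) {0..1}"
  have "PL (\<lambda>t. if t \<le> c' then h t else h' t) 0 1" by (rule PL_glue[OF h(1) h'(1)]) (use h h' c' in auto)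
  then have f: "f \<in> carrier thompson_F" unfolding f_def using h h' c' True assms by (intro restrict_in_F) auto
  have fc: "f c' = d'" using c' True assms h by (auto simp: f_def)
  have pw: "f [^]\<^bsub>thompson_F\<^esub> n \<in> carrier thompson_F" for n :: nat using f by simp
  have "d' \<le> (f [^]\<^bsub>thompson_F\<^esub> Suc n) c'" for n
  proof (induction n)
    case 0
    then show ?case using f fc by simp
  next
    case (Suc n)
    have "(f [^]\<^bsub>thompson_F\<^esub> Suc (Suc n)) c' = (f [^]\<^bsub>thompson_F\<^esub> Suc n) (f c')"
      using F_mult_apply[OF pw[of "Suc n"] f, of c'] c' True assms by simp
    also have "\<dots> \<ge> (f [^]\<^bsub>thompson_F\<^esub> Suc n) c'"
      using PL_le_iff[OF F_D(2)[OF pw[of "Suc n"]], of c' d'] fc c' d' True by auto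
    finally show ?case using Suc by simp
  qed
  from this[of "m - 1"] have "d' \<le> (f [^]\<^bsub>thompson_F\<^esub> m) c'" using assms(4) by simp
  also have "\<dots> \<le> (f [^]\<^bsub>thompson_F\<^esub> m) c"
    using PL_le_iff[OF F_D(2)[OF pw[of m]], of c' c] c' d' True assms by auto
  finally show ?thesis using f d' that by auto
qed

section \<open>Homomorphisms to finite groups kill the kernel of phi\<close>

locale finite_image = group_hom thompson_F Q \<psi> for Q (structure) and \<psi> +
  assumes finite_Q: "finite (carrier Q)"
begin

text \<open>
  The power \<open>k\<close> of \<open>f\<close> below is killed by \<open>\<psi>\<close>, so that conjugating \<open>h\<close> by \<open>k\<close> does not change its
  image. The conjugate is supported to the right of the support of \<open>g\<close>.
\<close>
lemma ker_commute:
  assumes "g \<in> ker_phi" "h \<in> ker_phi"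
  shows "\<psi> g \<otimes> \<psi> h = \<psi> h \<otimes> \<psi> g"
proof -
  have g: "g \<in> carrier thompson_F" and h: "h \<in> carrier thompson_F" using assms by (auto simp: ker_phi_def)
  \<comment> \<open>Only the right end of the support of \<open>g\<close> and the left end of that of \<open>h\<close> matter.\<close>
  obtain d where d: "0 < d" "d < 1" "\<And>t. d \<le> t \<Longrightarrow> t \<le> 1 \<Longrightarrow> g t = t"
    using ker_phi_support[OF assms(1)] by (metis order_less_trans)
  obtain c where c: "0 < c" "c < 1" "\<And>t. 0 \<le> t \<Longrightarrow> t \<le> c \<Longrightarrow> h t = t"
    using ker_phi_support[OF assms(2)] by (metis order_less_trans)
  have "order Q > 0" using finite_Q H.order_gt_0_iff_finite by blast
  then obtain f where f: "f \<in> carrier thompson_F" "d \<le> (f [^]\<^bsub>thompson_F\<^esub> order Q) c"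
    using push_right[OF c(1) less_imp_le[OF c(2)] d(2)] by blast
  define k where "k = f [^]\<^bsub>thompson_F\<^esub> order Q"
  have k: "k \<in> carrier thompson_F" "\<psi> k = \<one>"
    using f H.pow_order_eq_1[of "\<psi> f"] by (auto simp: k_def hom_nat_pow)
  define h' where "h' = k \<otimes>\<^bsub>thompson_F\<^esub> h \<otimes>\<^bsub>thompson_F\<^esub> inv\<^bsub>thompson_F\<^esub> k"
  have h': "h' \<in> carrier thompson_F" using h k by (simp add: h'_def)
  have "\<psi> h' = \<psi> h" using h k by (simp add: h'_def)
  have "h' t = t" if t: "0 \<le> t" "t \<le> d" for t
  proof -
    define s where "s = (inv\<^bsub>thompson_F\<^esub> k) t"
    have ks: "k s = t" and s: "0 \<le> s" "s \<le> 1"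
      using F_inv_apply(2)[OF k(1), of t] F_range[of "inv\<^bsub>thompson_F\<^esub> k" t] t d k by (auto simp: s_def)
    have "k s \<le> k c" using ks f(2) t by (simp add: k_def)
    then have "s \<le> c" using PL_le_iff[OF F_D(2)[OF k(1)], of s c] s c by auto
    then show ?thesis using t d s k h c(3)[of s] ks by (simp add: h'_def F_mult_apply s_def[symmetric])
  qed
  then have "g \<otimes>\<^bsub>thompson_F\<^esub> h' = h' \<otimes>\<^bsub>thompson_F\<^esub> g"
    using g h' d by (intro commute_of_disjoint[of g h' d]) auto
  then have "\<psi> g \<otimes> \<psi> h' = \<psi> h' \<otimes> \<psi> g" using g h' by (metis hom_mult)
  then show ?thesis using \<open>\<psi> h' = \<psi> h\<close> by simp
qed

text \<open>
  The two copies are conjugate by an element of the kernel of \<open>\<phi>\<close>, and the image of that kernel is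
  abelian.
\<close>
lemma implant_eq:
  assumes "interior_frame r" "interior_frame s" "f \<in> carrier thompson_F"
  shows "\<psi> (implant r f) = \<psi> (implant s f)"
proof -
  obtain k where k: "k \<in> ker_phi" "\<And>t. 0 \<le> t \<Longrightarrow> t \<le> 1 \<Longrightarrow> k (r t) = s t"
    using interior_transitive[OF assms(1,2)] by blast
  have kF: "k \<in> carrier thompson_F" using k by (simp add: ker_phi_def)
  have fr: "frame r" "frame s" "frame (\<lambda>t. k (r t))"
    using assms frame_F_compose[OF kF] by (auto simp: interior_frame_def)
  have i: "implant r f \<in> ker_phi" "implant s f \<in> ker_phi" using assms implant_interior by auto
  then have iF: "implant r f \<in> carrier thompson_F" "implant s f \<in> carrier thompson_F" by (auto simp: ker_phi_def)
  have "k \<otimes>\<^bsub>thompson_F\<^esub> implant r f = implant s f \<otimes>\<^bsub>thompson_F\<^esub> k"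
    using implant_conj[OF kF fr(1) assms(3)] implant_cong[OF fr(3,2) assms(3) k(2)] by simp
  then have "\<psi> k \<otimes> \<psi> (implant r f) = \<psi> (implant s f) \<otimes> \<psi> k" using kF iF by (metis hom_mult)
  also have "\<dots> = \<psi> k \<otimes> \<psi> (implant s f)" using ker_commute[OF k(1) i(2)] by simp
  finally show ?thesis using kF iF by simp
qed

definition middle :: "real \<Rightarrow> real" where "middle t = 2 powi (-2) * t + 1 / 4"

lemma interior_middle: "interior_frame middle"
proof -
  have "PL middle 0 1" unfolding middle_def by (intro PL_affine) auto
  then show ?thesis by (auto simp: interior_frame_def frame_def middle_def power_int_minus)
qed

text \<open>
  This is \<open>\<psi>\<close> pulled back along one fixed implantation; by \<open>implant_eq\<close> the interval is immaterial.
\<close>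
abbreviation mu :: "(real \<Rightarrow> real) \<Rightarrow> 'a" where "mu f \<equiv> \<psi> (implant middle f)"

lemma frame_middle: "frame middle"
  using interior_middle by (simp add: interior_frame_def)

lemma mu_mult:
  "f \<in> carrier thompson_F \<Longrightarrow> g \<in> carrier thompson_F \<Longrightarrow> mu (f \<otimes>\<^bsub>thompson_F\<^esub> g) = mu f \<otimes> mu g"
  using frame_middle by (simp add: implant_mult implant_in_F)

lemma mu_closed: "f \<in> carrier thompson_F \<Longrightarrow> mu f \<in> carrier Q"
  using frame_middle by (simp add: implant_in_F)

lemma mu_one: "mu \<one>\<^bsub>thompson_F\<^esub> = \<one>"
  using group_hom.hom_one[OF implant_hom[OF frame_middle]] by simp

lemma mu_half:
  assumes "f \<in> carrier thompson_F"
  shows "mu (implant left_half f) = mu f" "mu (implant right_half f) = mu f"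
proof -
  have *: "mu (implant r f) = mu f" if r: "frame r" for r
  proof -
    have "interior_frame (\<lambda>t. middle (r t))"
      using frame_compose[OF frame_middle r] frame_range[OF frame_middle, of "r 0"]
        frame_range[OF frame_middle, of "r 1"] frame_range[OF r, of 0] frame_range[OF r, of 1]
        interior_middle by (auto simp: interior_frame_def)
    then show ?thesis
      using implant_implant[OF frame_middle r assms] implant_eq interior_middle assms by metis
  qed
  then show "mu (implant left_half f) = mu f" "mu (implant right_half f) = mu f"
    using frame_halves by auto
qed

lemma mu_associator: "mu associator = \<one>"
proof -
  note a = associator_in_F
  note i = implant_in_F[OF frame_halves(1) a] implant_in_F[OF frame_halves(2) a]
  have "mu associator \<otimes> mu associator = mu associator \<otimes> (mu associator \<otimes> mu associator)"
    using pentagon a i mu_half[OF a] by (metis mu_mult F.m_closed)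
  then show ?thesis using mu_closed[OF a] by simp
qed

text \<open>
  The associator moves the first leaf of the left vine out; what is left happens in the right half.
\<close>
lemma vine_merge: "\<exists>e. carries e (Node (vine m) (vine n)) (vine (m + n + 1)) \<and> mu e = \<one>"
proof (induction m)
  case 0
  then show ?case using carries_one mu_one by (intro exI[of _ "\<one>\<^bsub>thompson_F\<^esub>"]) auto
next
  case (Suc m)
  then obtain e where e: "carries e (Node (vine m) (vine n)) (vine (m + n + 1))" "mu e = \<one>" by blast
  then have eF: "e \<in> carrier thompson_F" by (simp add: carries_def)
  let ?e = "implant left_half \<one>\<^bsub>thompson_F\<^esub> \<otimes>\<^bsub>thompson_F\<^esub> implant right_half e"
  have "carries (?e \<otimes>\<^bsub>thompson_F\<^esub> associator) (Node (vine (Suc m)) (vine n)) (vine (Suc m + n + 1))"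
    using carries_mult[OF carries_associator carries_Node[OF carries_one e(1)]] by simp
  moreover have "mu (?e \<otimes>\<^bsub>thompson_F\<^esub> associator) = \<one>"
    using eF e(2) associator_in_F frame_halves mu_associator mu_one
    by (simp add: mu_mult implant_in_F mu_half)
  ultimately show ?case by blast
qed

lemma tree_to_vine: "\<exists>e. carries e T (vine (leaves T - 1)) \<and> mu e = \<one>"
proof (induction T)
  case Leaf
  then show ?case using carries_one[of Leaf] mu_one by (intro exI[of _ "\<one>\<^bsub>thompson_F\<^esub>"]) auto
next
  case (Node A B)
  then obtain e e' where e: "carries e A (vine (leaves A - 1))" "mu e = \<one>"
    "carries e' B (vine (leaves B - 1))" "mu e' = \<one>" by blast
  obtain e'' where e'': "carries e'' (Node (vine (leaves A - 1)) (vine (leaves B - 1)))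
      (vine (leaves A - 1 + (leaves B - 1) + 1))" "mu e'' = \<one>" using vine_merge by blast
  have F: "e \<in> carrier thompson_F" "e' \<in> carrier thompson_F" "e'' \<in> carrier thompson_F"
    using e e'' by (auto simp: carries_def)
  let ?e = "implant left_half e \<otimes>\<^bsub>thompson_F\<^esub> implant right_half e'"
  have eq: "leaves A - 1 + (leaves B - 1) + 1 = leaves (Node A B) - 1"
    using leaves_pos[of A] leaves_pos[of B] by (simp del: leaves_pos)
  have "carries (e'' \<otimes>\<^bsub>thompson_F\<^esub> ?e) (Node A B) (vine (leaves (Node A B) - 1))"
    using carries_mult[OF carries_Node[OF e(1,3)] e''(1)] by (simp only: eq)
  moreover have "mu (e'' \<otimes>\<^bsub>thompson_F\<^esub> ?e) = \<one>"
    using F e e'' frame_halves by (simp add: mu_mult implant_in_F mu_half)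
  ultimately show ?case by blast
qed

text \<open>
  If \<open>f\<close> carries \<open>T\<close> to \<open>S\<close>, then it is the composite of the rebracketing of \<open>T\<close> to the vine and the
  inverse of that of \<open>S\<close>.
\<close>
lemma mu_trivial:
  assumes "f \<in> carrier thompson_F" shows "mu f = \<one>"
proof -
  obtain T S where TS: "carries f T S" using F_carries[OF assms] .
  then have l: "leaves T = leaves S" by (simp add: carries_def)
  obtain e e' where e: "carries e T (vine (leaves T - 1))" "mu e = \<one>"
    "carries e' S (vine (leaves S - 1))" "mu e' = \<one>" using tree_to_vine by metis
  have "carries (e' \<otimes>\<^bsub>thompson_F\<^esub> f) T (vine (leaves T - 1))" using carries_mult[OF TS e(3)] l by simp
  then have "e = e' \<otimes>\<^bsub>thompson_F\<^esub> f" using carries_unique e(1) by blast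
  moreover have "e' \<in> carrier thompson_F" using e by (simp add: carries_def)
  ultimately have "mu e = mu e' \<otimes> mu f" using mu_mult assms by simp
  then show ?thesis using e mu_closed[OF assms] by simp
qed

text \<open>
  Conjugating \<open>g\<close> by a parametrisation of an inner interval that contains its support exhibits it as
  an implanted copy of an element of \<open>F\<close>.
\<close>
lemma ker_phi_trivial:
  assumes "g \<in> ker_phi" shows "\<psi> g = \<one>"
proof -
  have g: "g \<in> carrier thompson_F" using assms by (simp add: ker_phi_def)
  obtain c d where cd: "c \<in> dyadic" "d \<in> dyadic" "0 < c" "c < d" "d < 1"
    "\<And>t. 0 \<le> t \<Longrightarrow> t \<le> c \<Longrightarrow> g t = t" "\<And>t. d \<le> t \<Longrightarrow> t \<le> 1 \<Longrightarrow> g t = t"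
    using ker_phi_support[OF assms] by blast
  obtain r where r: "PL r 0 1" "r 0 = c" "r 1 = d" using PL_exists[of 0 1 c d] cd by auto
  then have int: "interior_frame r" and fr: "frame r" using cd by (auto simp: interior_frame_def frame_def)
  obtain q where q: "PL q c d" "\<And>t. 0 \<le> t \<Longrightarrow> t \<le> 1 \<Longrightarrow> q (r t) = t" "\<And>s. c \<le> s \<Longrightarrow> s \<le> d \<Longrightarrow> r (q s) = s"
    using PL_has_inverse[OF r(1)] r by metis
  have gcd: "g c = c" "g d = d" using cd by auto
  have gPL: "PL g c d" using PL_subinterval[OF F_D(2)[OF g], of c d] cd by auto
  have "PL (\<lambda>t. g (r t)) 0 1" by (rule PL_compose[OF gPL r])
  then have "PL (\<lambda>t. q (g (r t))) 0 1" by (rule PL_compose[OF q(1)]) (use r gcd in auto)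
  then have fF: "restrict (\<lambda>t. q (g (r t))) {0..1} \<in> carrier thompson_F" (is "?f \<in> _")
    using r gcd q(2)[of 0] q(2)[of 1] by (intro restrict_in_F) auto
  have "g = implant r ?f"
  proof (rule F_eqI[OF g implant_in_F[OF fr fF]])
    fix t :: real assume t: "0 \<le> t" "t \<le> 1"
    show "g t = implant r ?f t" using frame_cases[OF fr t]
    proof cases
      case (1 s)
      have "c \<le> g (r s)" "g (r s) \<le> d"
        using PL_le_iff[OF gPL, of c "r s"] PL_le_iff[OF gPL, of "r s" d] frame_range[OF fr 1(1,2)] gcd r cd by auto
      then show ?thesis using implant_apply[OF fr 1(1,2), of ?f] 1 q(3) by simp
    next
      case 2
      then show ?thesis using implant_outside[OF fr fF t] cd r t by auto
    qed
  qed
  then show ?thesis using implant_eq[OF int interior_middle fF] mu_trivial[OF fF] by simp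
qed

end

section \<open>Subgroups of finite index\<close>

lemma finite_Bij: "finite S \<Longrightarrow> finite (Bij S)"
proof -
  assume "finite S"
  then have "finite (S \<rightarrow>\<^sub>E S)" by (intro finite_PiE)
  moreover have "Bij S \<subseteq> S \<rightarrow>\<^sub>E S"
    unfolding PiE_def using Bij_imp_extensional Bij_imp_funcset by blast
  ultimately show ?thesis by (rule finite_subset[rotated])
qed

context group begin

text \<open>
  The inverse turns multiplication from the right into a left action.
\<close>
definition coset_action :: "'a set \<Rightarrow> 'a \<Rightarrow> 'a set \<Rightarrow> 'a set" where
  "coset_action H g = (\<lambda>C\<in>rcosets H. C #> inv g)"

lemma rcosets_shift:
  assumes "subgroup H G" "C \<in> rcosets H" "g \<in> carrier G"
  shows "C #> g \<in> rcosets H" "C \<subseteq> carrier G"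
proof -
  have H: "H \<subseteq> carrier G" using assms(1) by (rule subgroup.subset)
  obtain x where x: "x \<in> carrier G" "C = H #> x" using assms(2) by (auto simp: RCOSETS_def)
  then show "C #> g \<in> rcosets H" using H assms(3) by (simp add: coset_mult_assoc rcosetsI)
  show "C \<subseteq> carrier G" using x H by (simp add: r_coset_subset_G)
qed

lemma coset_action_hom:
  assumes H: "subgroup H G"
  shows "group_hom G (BijGroup (rcosets H)) (coset_action H)"
proof (intro group_hom.intro group_hom_axioms.intro homI)
  show "group G" by (rule is_group)
  show "group (BijGroup (rcosets H))" by (rule group_BijGroup)
  have mem: "coset_action H g \<in> Bij (rcosets H)" if g: "g \<in> carrier G" for g
  proof -
    have "bij_betw (coset_action H g) (rcosets H) (rcosets H)"
      by (rule bij_betwI[of _ _ _ "coset_action H (inv g)"])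
        (use g rcosets_shift[OF H] in \<open>auto simp: coset_action_def coset_mult_assoc\<close>)
    then show ?thesis by (simp add: Bij_def coset_action_def)
  qed
  then show "coset_action H g \<in> carrier (BijGroup (rcosets H))" if "g \<in> carrier G" for g
    using that by (simp add: BijGroup_def)
  fix g h assume gh: "g \<in> carrier G" "h \<in> carrier G"
  have "coset_action H (g \<otimes> h) = compose (rcosets H) (coset_action H g) (coset_action H h)"
    using gh rcosets_shift[OF H]
    by (auto simp: coset_action_def compose_def fun_eq_iff coset_mult_assoc inv_mult_group)
  then show "coset_action H (g \<otimes> h) = coset_action H g \<otimes>\<^bsub>BijGroup (rcosets H)\<^esub> coset_action H h"
    using mem gh by (simp add: BijGroup_def)
qed

lemma coset_action_trivial:
  assumes H: "subgroup H G" and g: "g \<in> carrier G" and "coset_action H g = \<one>\<^bsub>BijGroup (rcosets H)\<^esub>"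
  shows "g \<in> H"
proof -
  have "H \<in> rcosets H" by (rule subgroup.subgroup_in_rcosets[OF H is_group])
  then have "H #> inv g = H" using fun_cong[OF assms(3), of H] by (simp add: coset_action_def BijGroup_def)
  then have "inv g \<in> H" using g H by (intro coset_join1[of H "inv g"]) simp_all
  then show ?thesis using subgroup.m_inv_closed[OF H, of "inv g"] g by simp
qed

end

lemma ker_phi_subset:
  assumes "finite_index_subgroup H thompson_F" shows "ker_phi \<subseteq> H"
proof
  fix g assume g: "g \<in> ker_phi"
  have H: "subgroup H thompson_F" "finite (rcosets\<^bsub>thompson_F\<^esub> H)"
    using assms by (auto simp: finite_index_subgroup_def)
  interpret finite_image "BijGroup (rcosets\<^bsub>thompson_F\<^esub> H)" "F.coset_action H"
    using F.coset_action_hom[OF H(1)] finite_Bij[OF H(2)]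
    by (intro finite_image.intro finite_image_axioms.intro) (auto simp: BijGroup_def)
  show "g \<in> H"
    using F.coset_action_trivial[OF H(1) _ ker_phi_trivial[OF g]] g by (simp add: ker_phi_def)
qed

context group_hom begin

definition preimage :: "'c set \<Rightarrow> 'a set" where
  "preimage L = {x \<in> carrier G. h x \<in> L}"

lemma preimage_subgroup: "subgroup L H \<Longrightarrow> subgroup (preimage L) G"
  by (rule G.subgroupI) (auto simp: preimage_def subgroup.m_closed subgroup.m_inv_closed subgroup.one_closed
    intro!: exI[of _ "\<one>"])

lemma preimage_finite_index:
  assumes L: "finite_index_subgroup L H"
  shows "finite_index_subgroup (preimage L) G"
proof -
  have LH: "subgroup L H" "finite (rcosets\<^bsub>H\<^esub> L)" using L by (auto simp: finite_index_subgroup_def)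
  have "preimage L #> x = preimage (L #>\<^bsub>H\<^esub> h x)" if x: "x \<in> carrier G" for x
  proof
    show "preimage L #> x \<subseteq> preimage (L #>\<^bsub>H\<^esub> h x)"
      using x by (auto simp: preimage_def r_coset_def)
    show "preimage (L #>\<^bsub>H\<^esub> h x) \<subseteq> preimage L #> x"
    proof
      fix y assume "y \<in> preimage (L #>\<^bsub>H\<^esub> h x)"
      then obtain l where y: "y \<in> carrier G" "l \<in> L" "h y = l \<otimes>\<^bsub>H\<^esub> h x" by (auto simp: preimage_def r_coset_def)
      have "l \<in> carrier H" using y(2) LH(1) by (rule subgroup.mem_carrier[rotated])
      then have "h (y \<otimes> inv x) = l" using x y by (simp add: H.m_assoc)
      then have "y \<otimes> inv x \<in> preimage L" using x y by (simp add: preimage_def)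
      moreover have "y = (y \<otimes> inv x) \<otimes> x" using x y by (simp add: G.m_assoc)
      ultimately show "y \<in> preimage L #> x" by (auto simp: r_coset_def)
    qed
  qed
  then have "rcosets (preimage L) \<subseteq> preimage ` (rcosets\<^bsub>H\<^esub> L)"
    unfolding RCOSETS_def using hom_closed by blast
  then have "finite (rcosets (preimage L))" using LH(2) by (rule finite_surj[rotated])
  then show ?thesis using preimage_subgroup LH(1) by (simp add: finite_index_subgroup_def)
qed

lemma image_finite_index:
  assumes U: "finite_index_subgroup U G" and surj: "h ` carrier G = carrier H"
  shows "finite_index_subgroup (h ` U) H"
proof -
  have UG: "subgroup U G" "finite (rcosets U)" using U by (auto simp: finite_index_subgroup_def)
  have "(h ` U) #>\<^bsub>H\<^esub> h x = h ` (U #> x)" if x: "x \<in> carrier G" for x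
    using x subgroup.mem_carrier[OF UG(1)] by (force simp: r_coset_def)
  then have "rcosets\<^bsub>H\<^esub> (h ` U) \<subseteq> (`) h ` (rcosets U)"
    by (auto simp: RCOSETS_def surj[symmetric])
  then have "finite (rcosets\<^bsub>H\<^esub> (h ` U))" using UG(2) by (rule finite_surj[rotated])
  then show ?thesis using subgroup_img_is_subgroup UG(1) by (simp add: finite_index_subgroup_def)
qed

lemma preimage_image:
  assumes U: "subgroup U G" and ker: "kernel G H h \<subseteq> U"
  shows "preimage (h ` U) = U"
proof
  show "U \<subseteq> preimage (h ` U)" using subgroup.mem_carrier[OF U] by (auto simp: preimage_def)
  show "preimage (h ` U) \<subseteq> U"
  proof
    fix x assume "x \<in> preimage (h ` U)"
    then obtain y where x: "x \<in> carrier G" "y \<in> U" "h x = h y" by (auto simp: preimage_def)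
    have y: "y \<in> carrier G" using subgroup.mem_carrier[OF U x(2)] .
    have "x \<otimes> inv y \<in> kernel G H h" using x y by (simp add: kernel_def)
    then have "x \<otimes> inv y \<in> U" using ker by blast
    then have "x \<otimes> inv y \<otimes> y \<in> U" using subgroup.m_closed[OF U] x(2) by blast
    then show "x \<in> U" using x y by (simp add: G.m_assoc)
  qed
qed

lemma image_preimage:
  assumes "h ` carrier G = carrier H" "L \<subseteq> carrier H"
  shows "h ` preimage L = L"
proof
  show "h ` preimage L \<subseteq> L" by (auto simp: preimage_def)
  show "L \<subseteq> h ` preimage L"
  proof
    fix y assume y: "y \<in> L"
    then have "y \<in> h ` carrier G" using assms by blast
    then show "y \<in> h ` preimage L" using y by (auto simp: preimage_def)
  qed
qed

lemma finite_index_correspondence: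
  assumes surj: "h ` carrier G = carrier H" and ker: "\<And>U. finite_index_subgroup U G \<Longrightarrow> kernel G H h \<subseteq> U"
  shows "bij_betw (\<lambda>U. h ` U) {U. finite_index_subgroup U G} {L. finite_index_subgroup L H}"
proof (rule bij_betwI[of _ _ _ preimage])
  show "(\<lambda>U. h ` U) \<in> {U. finite_index_subgroup U G} \<rightarrow> {L. finite_index_subgroup L H}"
    using image_finite_index[OF _ surj] by blast
  show "preimage \<in> {L. finite_index_subgroup L H} \<rightarrow> {U. finite_index_subgroup U G}"
    using preimage_finite_index by blast
  show "preimage (h ` U) = U" if "U \<in> {U. finite_index_subgroup U G}" for U
    using that ker preimage_image by (simp add: finite_index_subgroup_def)
  show "h ` preimage L = L" if "L \<in> {L. finite_index_subgroup L H}" for L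
    using that image_preimage[OF surj] by (simp add: finite_index_subgroup_def subgroup.subset)
qed

end

lemma phi_onto: "phi ` carrier thompson_F = carrier Z2"
proof -
  have "y \<in> phi ` carrier thompson_F" for y
    using phi_surj[of "fst y" "snd y"] by (metis image_eqI prod.collapse)
  then show ?thesis by auto
qed

lemma kernel_phi: "kernel thompson_F Z2 phi = ker_phi"
  by (simp add: kernel_def ker_phi_def)

section \<open>Subgroups of the integer lattice\<close>

lemma Z2_inv: "inv\<^bsub>Z2\<^esub> (x, y) = (- x, - y)"
  by (rule Z2.inv_equality) auto

lemma Z2_subgroup_comm: "subgroup L Z2 \<Longrightarrow> comm_group (Z2\<lparr>carrier := L\<rparr>)"
  by (intro group.group_comm_groupI Z2.subgroup_imp_group) (auto simp: add.commute)

lemma Z2_subgroup_smult: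
  assumes "subgroup L Z2" "(x, y) \<in> L" shows "(i * x, i * y) \<in> L"
proof (induction i rule: int_induct[of _ 0])
  case base
  show ?case using subgroup.one_closed[OF assms(1)] by simp
next
  case (step1 i)
  then show ?case using subgroup.m_closed[OF assms(1) step1(2) assms(2)] by (simp add: algebra_simps)
next
  case (step2 i)
  then show ?case using subgroup.m_closed[OF assms(1) step2(2) subgroup.m_inv_closed[OF assms]]
    by (simp add: algebra_simps Z2_inv)
qed

lemma Z2_subgroup_add:
  assumes "subgroup L Z2" "(x, y) \<in> L" "(x', y') \<in> L" shows "(x + x', y + y') \<in> L"
  using subgroup.m_closed[OF assms] by simp

lemma Z2_subgroupI:
  assumes "(0, 0) \<in> L" "\<And>x y x' y'. (x, y) \<in> L \<Longrightarrow> (x', y') \<in> L \<Longrightarrow> (x + x', y + y') \<in> L"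
    "\<And>x y. (x, y) \<in> L \<Longrightarrow> (- x, - y) \<in> L"
  shows "subgroup L Z2"
  by (rule Z2.subgroupI) (use assms in \<open>auto simp: Z2_inv\<close>)

lemma Ktilde_eq: "Ktilde a b = {(x, y). a dvd x \<and> b dvd y}"
proof
  have "subgroup {(x, y). a dvd x \<and> b dvd y} Z2" by (rule Z2_subgroupI) auto
  then show "Ktilde a b \<subseteq> {(x, y). a dvd x \<and> b dvd y}"
    unfolding Ktilde_def by (rule Z2.generate_subgroup_incl[rotated]) auto
  have sub: "subgroup (Ktilde a b) Z2" unfolding Ktilde_def by (rule Z2.generate_is_subgroup) simp
  have gen: "(a, 0) \<in> Ktilde a b" "(0, b) \<in> Ktilde a b"
    unfolding Ktilde_def by (auto intro: generate.incl)
  show "{(x, y). a dvd x \<and> b dvd y} \<subseteq> Ktilde a b"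
  proof clarify
    fix x y assume "a dvd x" "b dvd y"
    then obtain i j where "x = i * a" "y = j * b" by (metis dvd_def mult.commute)
    then show "(x, y) \<in> Ktilde a b"
      using Z2_subgroup_add[OF sub Z2_subgroup_smult[OF sub gen(1), of i] Z2_subgroup_smult[OF sub gen(2), of j]]
      by simp
  qed
qed

lemma Ktilde_subgroup: "subgroup (Ktilde a b) Z2"
  unfolding Ktilde_def by (rule Z2.generate_is_subgroup) simp

lemma Ktilde_subset_iff:
  assumes L: "subgroup L Z2"
  shows "Ktilde a b \<subseteq> L \<longleftrightarrow> (a, 0) \<in> L \<and> (0, b) \<in> L"
proof
  show "Ktilde a b \<subseteq> L" if "(a, 0) \<in> L \<and> (0, b) \<in> L"
    unfolding Ktilde_def using that by (intro Z2.generate_subgroup_incl[OF _ L]) auto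
qed (auto simp: Ktilde_eq)

lemma int_subgroup_generator:
  fixes S :: "int set"
  assumes "0 \<in> S" "\<And>x y. x \<in> S \<Longrightarrow> y \<in> S \<Longrightarrow> x + y \<in> S" "\<And>x i. x \<in> S \<Longrightarrow> i * x \<in> S" "n \<in> S" "n > 0"
  obtains a where "a > 0" "\<And>x. x \<in> S \<longleftrightarrow> a dvd x"
proof -
  define k where "k = (LEAST k::nat. k > 0 \<and> int k \<in> S)"
  have "nat n > 0 \<and> int (nat n) \<in> S" using assms(4,5) by simp
  then have k: "k > 0 \<and> int k \<in> S" unfolding k_def by (rule LeastI)
  have least: "k \<le> l" if "l > 0" "int l \<in> S" for l
    unfolding k_def using that by (intro Least_le) auto
  have "x \<in> S \<longleftrightarrow> int k dvd x" for x
  proof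
    assume x: "x \<in> S"
    have "x + (- (x div int k)) * int k \<in> S" using x k assms by blast
    moreover have "x + (- (x div int k)) * int k = x mod int k" by (simp add: minus_div_mult_eq_mod)
    ultimately have "x mod int k \<in> S" by simp
    moreover have "0 \<le> x mod int k" "x mod int k < int k" using k by auto
    ultimately have "x mod int k = 0" using least[of "nat (x mod int k)"] by (cases "x mod int k = 0") auto
    then show "int k dvd x" by auto
  next
    assume "int k dvd x"
    then obtain i where "x = i * int k" by (metis dvd_def mult.commute)
    then show "x \<in> S" using k assms(3) by blast
  qed
  then show ?thesis using that[of "int k"] k by auto
qed

text \<open>
  The multiples of \<open>(x, y)\<close> lie in finitely many cosets, so two of them differ by an element of \<open>L\<close>.
\<close>
lemma finite_index_multiple:
  assumes L: "finite_index_subgroup L Z2"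
  obtains n where "n > 0" "(n * x, n * y) \<in> L"
proof -
  have sub: "subgroup L Z2" and fin: "finite (rcosets\<^bsub>Z2\<^esub> L)" using L by (auto simp: finite_index_subgroup_def)
  let ?c = "\<lambda>n::nat. L #>\<^bsub>Z2\<^esub> (int n * x, int n * y)"
  have "range ?c \<subseteq> rcosets\<^bsub>Z2\<^esub> L" by (auto simp: RCOSETS_def)
  then have "finite (range ?c)" using fin by (rule finite_subset)
  then have "\<not> inj ?c" using finite_imageD by fastforce
  then obtain m n where mn: "m < n" "?c m = ?c n" unfolding inj_def by (metis linorder_neqE_nat)
  have "(int n * x, int n * y) \<in> ?c m"
    using Z2.repr_independenceD[OF sub _ mn(2)] by simp
  then obtain l where l: "l \<in> L" "(int n * x, int n * y) = (fst l + int m * x, snd l + int m * y)"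
    by (auto simp: r_coset_def)
  then have "l = ((int n - int m) * x, (int n - int m) * y)" by (simp add: prod_eq_iff algebra_simps)
  then show ?thesis using that[of "int n - int m"] l mn by simp
qed

lemma axis_generators:
  assumes L: "finite_index_subgroup L Z2"
  obtains a b where "a > 0" "b > 0" "\<And>x. (x, 0) \<in> L \<longleftrightarrow> a dvd x" "\<And>y. (0, y) \<in> L \<longleftrightarrow> b dvd y"
proof -
  have sub: "subgroup L Z2" using L by (auto simp: finite_index_subgroup_def)
  note one = subgroup.one_closed[OF sub, simplified]
  note add = Z2_subgroup_add[OF sub] and smult = Z2_subgroup_smult[OF sub]
  obtain m where m: "m > 0" "(m * 1, m * 0) \<in> L" using finite_index_multiple[OF L] by blast
  obtain a where a: "a > 0" "\<And>x. x \<in> {x. (x, 0) \<in> L} \<longleftrightarrow> a dvd x"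
    using int_subgroup_generator[of "{x. (x, 0) \<in> L}" m] m one add[of _ 0 _ 0] smult[of _ 0] by auto
  obtain n where n: "n > 0" "(n * 0, n * 1) \<in> L" using finite_index_multiple[OF L] by blast
  obtain b where b: "b > 0" "\<And>x. x \<in> {y. (0, y) \<in> L} \<longleftrightarrow> b dvd x"
    using int_subgroup_generator[of "{y. (0, y) \<in> L}" n] n one add[of 0 _ 0] smult[of 0] by auto
  show ?thesis using that[of a b] a b by auto
qed

section \<open>Rectangular subgroups and Inner\<close>

lemma K_eq: "K a b = phi.preimage (Ktilde a b)"
  by (simp add: K_def phi.preimage_def)

lemma K_subgroup: "subgroup (K a b) thompson_F"
  unfolding K_eq by (rule phi.preimage_subgroup[OF Ktilde_subgroup])

lemma phi_K: "phi ` K a b = Ktilde a b"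
  unfolding K_eq by (rule phi.image_preimage[OF phi_onto]) simp

lemma K_subset_iff: "K a b \<subseteq> K a' b' \<longleftrightarrow> a' dvd a \<and> b' dvd b"
proof
  assume "K a b \<subseteq> K a' b'"
  then have "Ktilde a b \<subseteq> Ktilde a' b'" unfolding phi_K[symmetric] by (rule image_mono)
  moreover have "(a, 0) \<in> Ktilde a b" "(0, b) \<in> Ktilde a b" by (auto simp: Ktilde_eq)
  ultimately have "(a, 0) \<in> Ktilde a' b'" "(0, b) \<in> Ktilde a' b'" by blast+
  then show "a' dvd a \<and> b' dvd b" by (simp add: Ktilde_eq)
qed (auto simp: K_def Ktilde_eq intro: dvd_trans)

text \<open>
  If \<open>c\<close> and \<open>d\<close> generate the intersections of \<open>\<phi>(H)\<close> with the axes, then \<open>K c d\<close> contains every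
  rectangular subgroup of \<open>H\<close>. So it is the only maximal one, which evaluates the definite description in
  \<open>Inner\<close>, and its parameters are determined up to sign.
\<close>
lemma Inner_axes:
  assumes H: "finite_index_subgroup H thompson_F" and ab: "a > 0" "b > 0" "Inner H = K a b"
  shows "(x, 0) \<in> phi ` H \<longleftrightarrow> a dvd x" "(0, y) \<in> phi ` H \<longleftrightarrow> b dvd y"
proof -
  have L: "finite_index_subgroup (phi ` H) Z2" by (rule phi.image_finite_index[OF H phi_onto])
  have sub: "subgroup (phi ` H) Z2" "subgroup H thompson_F" using L H by (auto simp: finite_index_subgroup_def)
  have pre: "phi.preimage (phi ` H) = H"
    using phi.preimage_image[OF sub(2)] ker_phi_subset[OF H] by (simp add: kernel_phi)
  obtain c d where cd: "c > 0" "d > 0" "\<And>x. (x, 0) \<in> phi ` H \<longleftrightarrow> c dvd x" "\<And>y. (0, y) \<in> phi ` H \<longleftrightarrow> d dvd y"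
    using axis_generators[OF L] by metis
  have K_sub: "K p q \<subseteq> H \<longleftrightarrow> K p q \<subseteq> K c d" for p q
  proof -
    have "K p q \<subseteq> H \<longleftrightarrow> Ktilde p q \<subseteq> phi ` H"
    proof
      show "K p q \<subseteq> H" if "Ktilde p q \<subseteq> phi ` H"
        using that unfolding K_eq by (subst pre[symmetric]) (auto simp: phi.preimage_def)
      show "Ktilde p q \<subseteq> phi ` H" if "K p q \<subseteq> H"
        using that unfolding phi_K[symmetric] by (rule image_mono)
    qed
    then show ?thesis using Ktilde_subset_iff[OF sub(1)] cd by (simp add: K_subset_iff)
  qed
  have "Inner H = K c d"
    unfolding Inner_def
  proof (rule the_equality)
    show "rectangular (K c d) \<and> K c d \<subseteq> H \<and> (\<forall>R'. rectangular R' \<longrightarrow> R' \<subseteq> H \<longrightarrow> \<not> K c d \<subset> R')"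
      using cd(1,2) K_sub by (auto simp: rectangular_def)
    show "R = K c d" if R: "rectangular R \<and> R \<subseteq> H \<and> (\<forall>R'. rectangular R' \<longrightarrow> R' \<subseteq> H \<longrightarrow> \<not> R \<subset> R')" for R
      using R cd(1,2) K_sub unfolding rectangular_def by (metis order_refl psubsetI)
  qed
  then have "K a b = K c d" using ab by simp
  then have "a dvd c" "c dvd a" "b dvd d" "d dvd b" using K_subset_iff[of a b c d] K_subset_iff[of c d a b] by auto
  then have "a = c" "b = d" using ab cd by (auto intro: zdvd_antisym_nonneg)
  then show "(x, 0) \<in> phi ` H \<longleftrightarrow> a dvd x" "(0, y) \<in> phi ` H \<longleftrightarrow> b dvd y" using cd by auto
qed

section \<open>The quotient and the exact rows\<close>

text \<open>
  Let \<open>c\<close> generate the first projection of \<open>L\<close> and pick \<open>(c, y) \<in> L\<close>. Every element of \<open>L\<close> differs from a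
  multiple of \<open>(c, y)\<close> by an element of the second axis, which lies in \<open>N\<close>. The hypothesis on \<open>a\<close>
  guarantees that the projection is nontrivial.
\<close>
lemma quotient_cyclic:
  assumes L: "subgroup L Z2" and N: "subgroup N (Z2\<lparr>carrier := L\<rparr>)" and "(a, 0) \<in> L" "a > 0"
    and ax: "\<And>y. (0, y) \<in> L \<Longrightarrow> (0, y) \<in> N"
  shows "cyclic_group ((Z2\<lparr>carrier := L\<rparr>) Mod N)"
proof -
  interpret L: comm_group "Z2\<lparr>carrier := L\<rparr>" by (rule Z2_subgroup_comm[OF L])
  interpret N: normal N "Z2\<lparr>carrier := L\<rparr>" using L.subgroup_imp_normal[OF N] .
  note add = Z2_subgroup_add[OF L] and smult = Z2_subgroup_smult[OF L]
  have fst: "x \<in> fst ` L \<longleftrightarrow> (\<exists>y. (x, y) \<in> L)" for x by force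
  obtain c where c: "c > 0" "\<And>x. x \<in> fst ` L \<longleftrightarrow> c dvd x"
  proof (rule int_subgroup_generator[of "fst ` L" a])
    show "0 \<in> fst ` L" using subgroup.one_closed[OF L] by force
    show "a \<in> fst ` L" using assms(3) by force
    show "x + y \<in> fst ` L" if "x \<in> fst ` L" "y \<in> fst ` L" for x y using that add unfolding fst by blast
    show "i * x \<in> fst ` L" if "x \<in> fst ` L" for x i using that smult unfolding fst by blast
  qed (use assms in auto)
  then obtain y where y: "(c, y) \<in> L" unfolding fst by (metis dvd_refl)
  let ?f = "\<lambda>i. N #>\<^bsub>Z2\<lparr>carrier := L\<rparr>\<^esub> (i * c, i * y)"
  have mem: "(i * c, i * y) \<in> L" for i using smult y by blast
  have hom: "?f \<in> hom integer_group ((Z2\<lparr>carrier := L\<rparr>) Mod N)"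
    using N.rcos_sum mem by (intro homI) (auto simp: FactGroup_def RCOSETS_def integer_group_def algebra_simps)
  have "C \<in> range ?f" if C: "C \<in> rcosets\<^bsub>Z2\<lparr>carrier := L\<rparr>\<^esub> N" for C
  proof -
    obtain x z where xz: "(x, z) \<in> L" "C = N #>\<^bsub>Z2\<lparr>carrier := L\<rparr>\<^esub> (x, z)" using C by (auto simp: RCOSETS_def)
    have "x \<in> fst ` L" using xz by force
    then obtain i where i: "x = i * c" using c by (metis dvd_def mult.commute)
    have "(x + (- i) * c, z + (- i) * y) \<in> L" using add[OF xz(1) mem[of "- i"]] by simp
    then have "(0, z - i * y) \<in> N" using ax i by simp
    then have "(x, z) \<in> N #>\<^bsub>Z2\<lparr>carrier := L\<rparr>\<^esub> (i * c, i * y)" using i by (force simp: r_coset_def)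
    then have "?f i = C" unfolding xz(2) using mem[of i] by (intro L.repr_independence[OF _ _ N]) auto
    then show ?thesis by blast
  qed
  then have "?f ` carrier integer_group = carrier ((Z2\<lparr>carrier := L\<rparr>) Mod N)"
    using mem by (auto simp: FactGroup_def integer_group_def RCOSETS_def)
  then have "?f \<in> epi integer_group ((Z2\<lparr>carrier := L\<rparr>) Mod N)" using hom by (simp add: epi_def)
  then show ?thesis
    by (intro group.cyclic_group_epimorphic_image[OF group_integer_group _ cyclic_integer_group] N.factorgroup_is_group)
qed

lemma quotient_finite:
  assumes "a > 0" "b > 0" and L: "subgroup L Z2" and N: "Ktilde a b \<subseteq> L"
  shows "finite (carrier ((Z2\<lparr>carrier := L\<rparr>) Mod Ktilde a b))"
proof -
  have eq: "Ktilde a b #>\<^bsub>Z2\<lparr>carrier := L\<rparr>\<^esub> (x, y) = Ktilde a b #>\<^bsub>Z2\<^esub> (x mod a, y mod b)" for x y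
  proof -
    have "(x mod a, y mod b) = (x mod a - x, y mod b - y) \<otimes>\<^bsub>Z2\<^esub> (x, y)" by simp
    moreover have "(x mod a - x, y mod b - y) \<in> Ktilde a b"
      by (simp add: Ktilde_eq mod_eq_dvd_iff[symmetric])
    ultimately have "(x mod a, y mod b) \<in> Ktilde a b #>\<^bsub>Z2\<^esub> (x, y)"
      unfolding r_coset_def by blast
    then have "Ktilde a b #>\<^bsub>Z2\<^esub> (x, y) = Ktilde a b #>\<^bsub>Z2\<^esub> (x mod a, y mod b)"
      by (intro Z2.repr_independence[OF _ _ Ktilde_subgroup]) auto
    then show ?thesis by (simp add: r_coset_def)
  qed
  have "carrier ((Z2\<lparr>carrier := L\<rparr>) Mod Ktilde a b)
      \<subseteq> (\<lambda>p. Ktilde a b #>\<^bsub>Z2\<^esub> p) ` ({0..<a} \<times> {0..<b})"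
  proof
    fix C assume "C \<in> carrier ((Z2\<lparr>carrier := L\<rparr>) Mod Ktilde a b)"
    then obtain x y where "C = Ktilde a b #>\<^bsub>Z2\<lparr>carrier := L\<rparr>\<^esub> (x, y)"
      by (auto simp: FactGroup_def RCOSETS_def)
    then have "C = Ktilde a b #>\<^bsub>Z2\<^esub> (x mod a, y mod b)" by (simp only: eq)
    moreover have "(x mod a, y mod b) \<in> {0..<a} \<times> {0..<b}" using assms(1,2) by simp
    ultimately show "C \<in> (\<lambda>p. Ktilde a b #>\<^bsub>Z2\<^esub> p) ` ({0..<a} \<times> {0..<b})" by blast
  qed
  then show ?thesis by (rule finite_subset) auto
qed

text \<open>
  Both rows arise in this way: the upper one from \<open>\<phi>\<close>, the lower one from the identity of \<open>\<int>\<^sup>2\<close>.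
\<close>
lemma short_exact_restrict:
  assumes "group_hom G M h" and H: "subgroup H G" and P: "subgroup P G" "P \<subseteq> H"
    and Q: "group_hom (M\<lparr>carrier := h ` H\<rparr>) Q \<pi>" and "\<pi> ` h ` H = carrier Q"
    and ker: "\<And>x. x \<in> H \<Longrightarrow> \<pi> (h x) = \<one>\<^bsub>Q\<^esub> \<longleftrightarrow> x \<in> P"
  shows "short_exact (G\<lparr>carrier := P\<rparr>) id (G\<lparr>carrier := H\<rparr>) (\<lambda>x. \<pi> (h x)) Q"
proof -
  interpret h: group_hom G M h by fact
  interpret Q: group_hom "M\<lparr>carrier := h ` H\<rparr>" Q \<pi> by fact
  have gH: "group (G\<lparr>carrier := H\<rparr>)" "group (G\<lparr>carrier := P\<rparr>)"
    using h.G.subgroup_imp_group H P by auto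
  have "group_hom (G\<lparr>carrier := P\<rparr>) (G\<lparr>carrier := H\<rparr>) id"
    using gH P by (intro group_hom.intro group_hom_axioms.intro homI) auto
  moreover have "group_hom (G\<lparr>carrier := H\<rparr>) Q (\<lambda>x. \<pi> (h x))"
  proof (intro group_hom.intro group_hom_axioms.intro homI gH Q.H.is_group)
    fix x y assume xy: "x \<in> carrier (G\<lparr>carrier := H\<rparr>)" "y \<in> carrier (G\<lparr>carrier := H\<rparr>)"
    then show "\<pi> (h x) \<in> carrier Q" using Q.hom_closed by simp
    have "h (x \<otimes>\<^bsub>G\<^esub> y) = h x \<otimes>\<^bsub>M\<^esub> h y" using xy subgroup.mem_carrier[OF H] by simp
    then show "\<pi> (h (x \<otimes>\<^bsub>G\<lparr>carrier := H\<rparr>\<^esub> y)) = \<pi> (h x) \<otimes>\<^bsub>Q\<^esub> \<pi> (h y)"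
      using xy Q.hom_mult[of "h x" "h y"] by simp
  qed
  ultimately show ?thesis
    unfolding short_exact_def using P assms(6) ker subgroup.one_closed[OF P(1)]
    by (auto simp: kernel_def image_image)
qed

section \<open>Homeomorphisms that renormalise the ends\<close>

text \<open>
  The index \<open>j\<close> of the half-open interval \<open>(2\<^sup>-\<^sup>a\<^sup>(\<^sup>j\<^sup>+\<^sup>1\<^sup>), 2\<^sup>-\<^sup>a\<^sup>j]\<close> that contains \<open>t\<close>.
\<close>
definition self_similar_scale :: "int \<Rightarrow> real \<Rightarrow> int" where
  "self_similar_scale a t = \<lfloor>- log 2 t / of_int a\<rfloor>"

lemma self_similar_scale:
  assumes "a > 0" "2 powi (- a * (j + 1)) < t" "t \<le> 2 powi (- a * j)"
  shows "self_similar_scale a t = j"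
proof -
  have "0 < (2::real) powi (- a * (j + 1))" by simp
  then have t: "t > 0" using assms(2) by linarith
  have l: "log 2 (2 powi k) = of_int k" for k :: int
    by (simp add: powr_real_of_int'[symmetric])
  have "log 2 (2 powi (- a * (j + 1))) < log 2 t" using assms t by (subst log_less_cancel_iff) auto
  moreover have "log 2 t \<le> log 2 (2 powi (- a * j))" using assms t by (subst log_le_cancel_iff) auto
  ultimately have "of_int (- a * (j + 1)) < log 2 t" "log 2 t \<le> of_int (- a * j)" unfolding l by auto
  then have "of_int j \<le> - log 2 t / of_int a" "- log 2 t / of_int a < of_int j + 1"
    using assms(1) by (auto simp: field_simps)
  then show ?thesis unfolding self_similar_scale_def by (intro floor_unique)
qed

text \<open>
  A piecewise linear map \<open>T\<close> from the fundamental interval \<open>[2\<^sup>-\<^sup>a, 1]\<close> of scaling by \<open>2\<^sup>-\<^sup>a\<close> onto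
  the fundamental interval \<open>[1/2, 1]\<close> of scaling by \<open>1/2\<close> extends uniquely to a map that intertwines the
  two scalings. Its breaks accumulate only at \<open>0\<close>.
\<close>
lemma self_similar_exists:
  assumes "a > (0::int)"
  obtains S where "S 0 = 0" "S 1 = 1" "\<And>c. 0 < c \<Longrightarrow> c \<le> 1 \<Longrightarrow> PL S c 1"
    "\<And>t. 0 \<le> t \<Longrightarrow> S (2 powi (- a) * t) = S t / 2" "\<And>t. 0 < t \<Longrightarrow> t \<le> 1 \<Longrightarrow> 0 < S t"
    "\<And>y. 0 < y \<Longrightarrow> y \<le> 1 \<Longrightarrow> \<exists>t. 0 < t \<and> t \<le> 1 \<and> S t = y"
proof -
  have lt: "(2::real) powi (- a) < 2 powi 0" using assms by (intro power_int_strict_increasing) auto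
  obtain T where T: "PL T (2 powi (- a)) 1" "T (2 powi (- a)) = 1 / 2" "T 1 = 1"
    by (rule PL_exists[of "2 powi (- a)" 1 "1 / 2" 1])
      (use lt dyadic_half[OF dyadic_1] in \<open>auto simp: dyadic_powi[of "- a", simplified]\<close>)
  define S where "S t = (if t \<le> 0 then 0 else
     2 powi (- self_similar_scale a t) * T (2 powi (a * self_similar_scale a t) * t))" for t
  have S0: "S 0 = 0" by (simp add: S_def)
  have S1: "S 1 = 1" using self_similar_scale[OF assms, of 0 1] lt T by (simp add: S_def)
  have eq: "S t = 2 powi (- j) * T (2 powi (a * j) * t)"
    if "2 powi (- a * (j + 1)) \<le> t" "t \<le> 2 powi (- a * j)" for t j
  proof (cases "t = 2 powi (- a * (j + 1))")
    case False
    have "0 < (2::real) powi (- a * (j + 1))" by simp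
    then have "t > 0" using that(1) by linarith
    then show ?thesis using self_similar_scale[OF assms, of j t] that False by (simp add: S_def)
  next
    case True
    \<comment> \<open>At the left end point the scale is already \<open>j + 1\<close>, but both formulas give \<open>2\<^sup>-\<^sup>(\<^sup>j\<^sup>+\<^sup>1\<^sup>)\<close>.\<close>
    have "(2::real) powi (- a * (j + 1 + 1)) < 2 powi (- a * (j + 1))"
      using assms by (intro power_int_strict_increasing) (auto simp: algebra_simps)
    then have "self_similar_scale a t = j + 1" unfolding True
      by (intro self_similar_scale[OF assms]) auto
    moreover have "2 powi (a * (j + 1)) * t = 1" "2 powi (a * j) * t = 2 powi (- a)"
      unfolding True by (simp_all add: power_int_add[symmetric] algebra_simps)
    moreover have "0 < t" unfolding True by simp
    moreover have "(2::real) powi (- (j + 1)) = 2 powi (- j) / 2"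
      by (simp add: power_int_diff)
    ultimately show ?thesis by (simp add: S_def T(2,3))
  qed
  have step: "PL S (2 powi (- a * (j + 1))) (2 powi (- a * j))" for j
  proof -
    have 1: "2 powi (a * j) * 2 powi (- a * (j + 1)) = (2::real) powi (- a)" "2 powi (a * j) * 2 powi (- a * j) = (1::real)"
      by (simp_all add: power_int_add[symmetric] algebra_simps)
    have le: "2 powi (- a * (j + 1)) \<le> (2::real) powi (- a * j)"
      using assms by (intro power_int_increasing) (auto simp: algebra_simps)
    have 2: "PL (\<lambda>t. T (2 powi (a * j) * t + 0)) (2 powi (- a * (j + 1))) (2 powi (- a * j))"
      by (rule PL_compose[OF T(1) PL_affine]) (use le 1 in auto)
    have "PL (\<lambda>t. 2 powi (- j) * T (2 powi (a * j) * t + 0) + 0) (2 powi (- a * (j + 1))) (2 powi (- a * j))"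
      by (rule PL_compose_affine[OF 2 dyadic_0, where k = "- j"]) simp
    then show ?thesis by (rule PL_cong) (simp add: eq[of j])
  qed
  have chain: "PL S (2 powi (- a * int n)) 1" for n
  proof (induction n)
    case 0
    show ?case by (rule PL.affine[of _ _ "0" _ 0]) (use S1 in auto)
  next
    case (Suc n)
    have "int n + 1 = int (Suc n)" by simp
    then have "PL S (2 powi (- a * int (Suc n))) (2 powi (- a * int n))" using step[of "int n"] by (simp only:)
    then show ?case using Suc dyadic_powi by (rule PL.join)
  qed
  have PLS: "PL S c 1" if c: "0 < c" "c \<le> 1" for c
  proof -
    obtain n where n: "(1/2::real) ^ n < c" using real_arch_pow_inv[OF c(1), of "1/2"] by auto
    have "1 * int n \<le> a * int n" using assms by (intro mult_right_mono) auto
    then have "(2::real) powi (- a * int n) \<le> 2 powi (- int n)"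
      by (intro power_int_increasing) auto
    also have "\<dots> = (1/2) ^ n" by (simp add: power_int_minus power_divide inverse_eq_divide)
    finally show ?thesis using n c chain[of n] PL_subinterval[OF chain[of n], of c 1] by auto
  qed
  have scale: "S (2 powi (- a) * t) = S t / 2" if "0 \<le> t" for t
  proof (cases "t = 0")
    case False
    then have t: "t > 0" using that by simp
    have "- log 2 (2 powi (- a) * t) / of_int a = - log 2 t / of_int a + 1"
      using t assms by (simp add: log_mult powr_real_of_int'[symmetric] field_simps)
    then have j: "self_similar_scale a (2 powi (- a) * t) = self_similar_scale a t + 1" (is "_ = ?j + 1")
      by (simp only: self_similar_scale_def one_add_floor)
    have "0 < 2 powi (- a) * t" using t by simp
    then have "S (2 powi (- a) * t) = 2 powi (- (?j + 1)) * T (2 powi (a * (?j + 1)) * (2 powi (- a) * t))"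
      unfolding S_def j by simp
    also have "2 powi (a * (?j + 1)) * (2 powi (- a) * t) = 2 powi (a * ?j) * t"
      by (simp add: mult.assoc[symmetric] power_int_add[symmetric] algebra_simps)
    also have "(2::real) powi (- (?j + 1)) = 2 powi (- ?j) / 2" by (simp add: power_int_diff)
    finally show ?thesis using t by (simp add: S_def)
  qed (simp add: S0)
  have "0 < S t" if t: "0 < t" "t \<le> 1" for t
  proof -
    have tt: "0 < 2 powi (- a) * t" "2 powi (- a) * t < t" using t lt by auto
    have "S (2 powi (- a) * t) < S t"
      using PL_less[OF PLS[of "2 powi (- a) * t"], of "2 powi (- a) * t" t] tt t by auto
    then show ?thesis using scale[of t] t by simp
  qed
  moreover have "\<exists>t. 0 < t \<and> t \<le> 1 \<and> S t = y" if y: "0 < y" "y \<le> 1" for y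
  proof -
    obtain n where n: "(1/2::real) ^ n < y" using real_arch_pow_inv[OF y(1), of "1/2"] by auto
    let ?t = "(2::real) powi (- a * int n)"
    have "S ?t = (1/2) ^ n"
    proof (induction n)
      case 0
      then show ?case using S1 by simp
    next
      case (Suc n)
      have "(2::real) powi (- a * int (Suc n)) = 2 powi (- a) * 2 powi (- a * int n)"
        by (simp add: power_int_add[symmetric] algebra_simps)
      then show ?case using scale[of "2 powi (- a * int n)"] Suc by simp
    qed
    then have "y \<in> S ` {?t..1}" using PL_image[OF chain[of n]] n y S1 by auto
    moreover have "0 < ?t" by simp
    ultimately show ?thesis by (metis (no_types, lifting) atLeastAtMost_iff imageE less_le_trans)
  qed
  ultimately show ?thesis using that S0 S1 PLS scale by blast
qed

text \<open>
  Statements about the end \<open>1\<close> are statements about the end \<open>0\<close> of the map conjugated by \<open>t \<mapsto> 1 - t\<close>.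
\<close>
definition reflect :: "(real \<Rightarrow> real) \<Rightarrow> real \<Rightarrow> real" where
  "reflect f t = 1 - f (1 - t)"

definition scales_at_0 :: "(real \<Rightarrow> real) \<Rightarrow> int \<Rightarrow> int \<Rightarrow> bool" where
  "scales_at_0 f p q \<longleftrightarrow> (\<exists>e>0. \<forall>t. 0 \<le> t \<longrightarrow> t \<le> e \<longrightarrow> f (2 powi (- p) * t) = 2 powi (- q) * f t)"

text \<open>
  Breaks may accumulate at \<open>0\<close> and \<open>1\<close>; for surjective maps, continuity there follows from monotonicity.
\<close>
definition local_PL :: "(real \<Rightarrow> real) \<Rightarrow> bool" where
  "local_PL f \<longleftrightarrow> f 0 = 0 \<and> f 1 = 1 \<and> (\<forall>t. 0 < t \<longrightarrow> t < 1 \<longrightarrow> 0 < f t \<and> f t < 1) \<and>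
     (\<forall>c d. 0 < c \<longrightarrow> c \<le> d \<longrightarrow> d < 1 \<longrightarrow> PL f c d)"

definition inverse_pair :: "(real \<Rightarrow> real) \<Rightarrow> (real \<Rightarrow> real) \<Rightarrow> bool" where
  "inverse_pair f g \<longleftrightarrow> (\<forall>t. 0 \<le> t \<longrightarrow> t \<le> 1 \<longrightarrow> g (f t) = t \<and> f (g t) = t)"

lemma local_PL_range: "local_PL f \<Longrightarrow> 0 \<le> t \<Longrightarrow> t \<le> 1 \<Longrightarrow> 0 \<le> f t \<and> f t \<le> 1"
  by (cases "t = 0 \<or> t = 1") (auto simp: local_PL_def less_imp_le)

lemma local_PL_less:
  assumes "local_PL f" "0 \<le> s" "s < t" "t \<le> 1" shows "f s < f t"
proof -
  consider "s = 0" "t = 1" | "s = 0" "t < 1" | "0 < s" "t = 1" | "0 < s" "t < 1" using assms by linarith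
  then show ?thesis
  proof cases
    case 4
    then have "PL f s t" using assms by (simp add: local_PL_def)
    then show ?thesis using PL_less assms by blast
  qed (use assms in \<open>auto simp: local_PL_def\<close>)
qed

lemma local_PL_le:
  assumes "local_PL f" "0 \<le> s" "s \<le> t" "t \<le> 1" shows "f s \<le> f t"
  using local_PL_less[of f s t] assms by (cases "s = t") auto

lemma local_PL_reflect: "local_PL f \<Longrightarrow> local_PL (reflect f)"
proof -
  assume f: "local_PL f"
  have "PL (reflect f) c d" if "0 < c" "c \<le> d" "d < 1" for c d
  proof -
    have "PL f (1 - d) (1 - c)" using f that by (simp add: local_PL_def)
    from PL_reflect[OF this] show ?thesis by (simp add: reflect_def[abs_def])
  qed
  then show ?thesis using f by (auto simp: local_PL_def reflect_def)
qed

lemma inverse_pair_reflect: "inverse_pair f g \<Longrightarrow> inverse_pair (reflect f) (reflect g)"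
  by (auto simp: inverse_pair_def reflect_def)

lemma inverse_pair_sym: "inverse_pair f g \<Longrightarrow> inverse_pair g f"
  by (auto simp: inverse_pair_def)

lemma local_PL_has_inverse:
  assumes f: "local_PL f" and surj: "\<And>y. 0 < y \<Longrightarrow> y < 1 \<Longrightarrow> \<exists>t. 0 < t \<and> t < 1 \<and> f t = y"
  obtains g where "local_PL g" "inverse_pair f g"
proof -
  have inj: "inj_on f {0..1}"
  proof (rule linorder_inj_onI)
    show "f x \<noteq> f y" if "x < y" "x \<in> {0..1}" "y \<in> {0..1}" for x y
      using local_PL_less[OF f, of x y] that by auto
  qed auto
  define g where "g = inv_into {0..1} f"
  have gf: "g (f t) = t" if "0 \<le> t" "t \<le> 1" for t
    using inj that by (simp add: g_def inv_into_f_f)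
  have f01: "f 0 = 0" "f 1 = 1" using f by (auto simp: local_PL_def)
  have g01: "g 0 = 0" "g 1 = 1" using gf[of 0] gf[of 1] f01 by auto
  have g_open: "0 < g y \<and> g y < 1 \<and> f (g y) = y" if "0 < y" "y < 1" for y
    using surj[OF that] gf by (metis less_imp_le)
  have "PL g c d" if cd: "0 < c" "c \<le> d" "d < 1" for c d
  proof -
    have "g c \<le> g d"
      using local_PL_less[OF f, of "g d" "g c"] g_open[of c] g_open[of d] cd by (cases "g c \<le> g d") auto
    then have "PL f (g c) (g d)" using f g_open[of c] g_open[of d] cd by (simp add: local_PL_def)
    from PL_inverse[OF this, of g] show ?thesis using gf g_open[of c] g_open[of d] cd by auto
  qed
  then have "local_PL g" using g01 g_open by (simp add: local_PL_def)
  moreover have "f (g t) = t" if "0 \<le> t" "t \<le> 1" for t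
    using g_open[of t] that g01 f01 by (cases "t = 0 \<or> t = 1") auto
  then have "inverse_pair f g" using gf by (simp add: inverse_pair_def)
  ultimately show ?thesis using that by blast
qed

lemma scales_at_0_inverse:
  assumes "local_PL f" "local_PL g" "inverse_pair f g" "scales_at_0 f p q" "p \<ge> 0"
  shows "scales_at_0 g q p"
proof -
  obtain e where e: "e > 0" "\<And>t. 0 \<le> t \<Longrightarrow> t \<le> e \<Longrightarrow> f (2 powi (- p) * t) = 2 powi (- q) * f t"
    using assms(4) unfolding scales_at_0_def by blast
  define e' where "e' = min e (1/2)"
  have e': "0 < e'" "e' < 1" "e' \<le> e" using e by (auto simp: e'_def)
  have fe: "0 < f e'" "f e' < 1" using assms(1) e' by (auto simp: local_PL_def)
  have "g (2 powi (- q) * y) = 2 powi (- p) * g y" if y: "0 \<le> y" "y \<le> f e'" for y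
  proof -
    have gy: "0 \<le> g y" "g y \<le> e'" "f (g y) = y"
      using local_PL_le[OF assms(2), of y "f e'"] local_PL_range[OF assms(2), of y] y fe e' assms(3)
      by (auto simp: inverse_pair_def)
    have "2 powi (- p) \<le> (2::real) powi 0" using assms(5) by (intro power_int_increasing) auto
    then have "2 powi (- p) * g y \<le> 1 * 1" using gy e' by (intro mult_mono) auto
    moreover have "f (2 powi (- p) * g y) = 2 powi (- q) * y" using e(2)[of "g y"] gy e' by simp
    ultimately show ?thesis using assms(3) gy unfolding inverse_pair_def
      by (metis mult_1 mult_nonneg_nonneg zero_le_power_int zero_le_numeral)
  qed
  then show ?thesis unfolding scales_at_0_def using fe by blast
qed

text \<open>
  Iterating the intertwining relation, conjugation by \<open>\<theta>\<close> turns multiplication by \<open>2\<^sup>p\<^sup>k\<close> into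
  multiplication by \<open>2\<^sup>q\<^sup>k\<close>, on a neighbourhood of \<open>0\<close> that is small enough for both \<open>t\<close> and its image to
  lie in the range of the relation.
\<close>
lemma scales_at_0_germ:
  assumes \<theta>: "local_PL \<theta>" "local_PL \<theta>'" "inverse_pair \<theta> \<theta>'" and "scales_at_0 \<theta> p q" "p \<ge> 0"
    and "0 < d" and f: "\<And>t. 0 \<le> t \<Longrightarrow> t \<le> d \<Longrightarrow> f t = 2 powi (p * k) * t"
  shows "\<exists>h>0. \<forall>y. 0 \<le> y \<longrightarrow> y \<le> h \<longrightarrow> \<theta> (f (\<theta>' y)) = 2 powi (q * k) * y"
proof -
  obtain e where e: "e > 0" "\<And>t. 0 \<le> t \<Longrightarrow> t \<le> e \<Longrightarrow> \<theta> (2 powi (- p) * t) = 2 powi (- q) * \<theta> t"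
    using assms(4) unfolding scales_at_0_def by blast
  have le1: "2 powi (- p * int n) \<le> (1::real)" for n
    using power_int_increasing[of "- p * int n" 0 "2::real"] assms(5) by auto
  have iter: "\<theta> (2 powi (- p * int n) * t) = 2 powi (- q * int n) * \<theta> t" if t: "0 \<le> t" "t \<le> e" for n t
  proof (induction n)
    case (Suc n)
    have "2 powi (- p * int n) * t \<le> 1 * e" using t le1 by (intro mult_mono) auto
    then have "\<theta> (2 powi (- p) * (2 powi (- p * int n) * t)) = 2 powi (- q) * \<theta> (2 powi (- p * int n) * t)"
      using t by (intro e(2)) auto
    moreover have "(2::real) powi (- r * int (Suc n)) = 2 powi (- r) * 2 powi (- r * int n)" for r
      by (simp add: power_int_add[symmetric] algebra_simps)
    ultimately show ?case using Suc by (simp only: mult.assoc)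
  qed simp
  have scale: "\<theta> (2 powi (p * k) * t) = 2 powi (q * k) * \<theta> t"
    if t: "0 \<le> t" "t \<le> e" "2 powi (p * k) * t \<le> e" for t
  proof (cases "k \<le> 0")
    case True
    then show ?thesis using iter[OF t(1,2), of "nat (- k)"] by simp
  next
    case False
    have "\<theta> (2 powi (- p * int (nat k)) * (2 powi (p * k) * t)) = 2 powi (- q * int (nat k)) * \<theta> (2 powi (p * k) * t)"
      using t by (intro iter) auto
    then have "\<theta> t = 2 powi (- (q * k)) * \<theta> (2 powi (p * k) * t)"
      using False by (simp add: mult.assoc[symmetric] power_int_add[symmetric])
    then show ?thesis by (simp add: mult.assoc[symmetric] power_int_add[symmetric])
  qed
  define t0 where "t0 = Min {d, e, e / 2 powi (p * k), 1/2}"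
  have t0: "0 < t0" "t0 < 1" "t0 \<le> d" "t0 \<le> e" "t0 \<le> e / 2 powi (p * k)"
    using e assms(6) by (auto simp: t0_def)
  have h: "0 < \<theta> t0" "\<theta> t0 < 1" using \<theta>(1) t0 by (auto simp: local_PL_def)
  have "\<theta> (f (\<theta>' y)) = 2 powi (q * k) * y" if y: "0 \<le> y" "y \<le> \<theta> t0" for y
  proof -
    have t: "0 \<le> \<theta>' y" "\<theta>' y \<le> t0" "\<theta> (\<theta>' y) = y"
      using local_PL_le[OF \<theta>(2), of y "\<theta> t0"] local_PL_range[OF \<theta>(2), of y] y h t0 \<theta>(3)
      by (auto simp: inverse_pair_def)
    then have "\<theta>' y \<le> e / 2 powi (p * k)" using t0 by linarith
    then have "2 powi (p * k) * \<theta>' y \<le> e" by (simp add: pos_le_divide_eq mult.commute)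
    then have "\<theta> (2 powi (p * k) * \<theta>' y) = 2 powi (q * k) * \<theta> (\<theta>' y)" using t t0 by (intro scale) auto
    then show ?thesis using f[of "\<theta>' y"] t t0 by simp
  qed
  then show ?thesis using h by blast
qed

definition transport :: "(real \<Rightarrow> real) \<Rightarrow> (real \<Rightarrow> real) \<Rightarrow> (real \<Rightarrow> real) \<Rightarrow> real \<Rightarrow> real" where
  "transport \<theta> \<theta>' f = (\<lambda>t\<in>{0..1}. \<theta> (f (\<theta>' t)))"

text \<open>
  Near the ends the conjugate is linear by \<open>scales_at_0_germ\<close>, applied also to the reflected maps; on the
  remaining compact part of \<open>(0,1)\<close> it is a composite of three piecewise linear maps. Allowing general
  exponents on both sides makes the lemma applicable to \<open>\<theta>\<close> and to its inverse.
\<close>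
lemma transport_in_F:
  assumes \<theta>: "local_PL \<theta>" "local_PL \<theta>'" "inverse_pair \<theta> \<theta>'"
    and s: "scales_at_0 \<theta> p q" "scales_at_0 (reflect \<theta>) p' q'" "p \<ge> 0" "p' \<ge> 0"
    and f: "f \<in> carrier thompson_F" "phi f = (p * k, p' * l)"
  shows "transport \<theta> \<theta>' f \<in> carrier thompson_F" "phi (transport \<theta> \<theta>' f) = (q * k, q' * l)"
proof -
  note fd = F_D[OF f(1)]
  obtain d where d: "0 < d" "\<And>t. 0 \<le> t \<Longrightarrow> t \<le> d \<Longrightarrow> f t = 2 powi (p * k) * t"
    "\<And>t. 0 \<le> t \<Longrightarrow> t \<le> d \<Longrightarrow> f (1 - t) = 1 - 2 powi (p' * l) * t"
    using F_germs[OF f(1)] f(2) by (metis fst_conv snd_conv)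
  obtain h1 where h1: "h1 > 0" "\<And>y. 0 \<le> y \<Longrightarrow> y \<le> h1 \<Longrightarrow> \<theta> (f (\<theta>' y)) = 2 powi (q * k) * y"
    using scales_at_0_germ[OF \<theta> s(1,3) d(1,2)] by blast
  have "reflect f t = 2 powi (p' * l) * t" if "0 \<le> t" "t \<le> d" for t
    using d(3)[OF that] by (simp add: reflect_def)
  then obtain h2 where h2: "h2 > 0"
    "\<And>y. 0 \<le> y \<Longrightarrow> y \<le> h2 \<Longrightarrow> reflect \<theta> (reflect f (reflect \<theta>' y)) = 2 powi (q' * l) * y"
    using scales_at_0_germ[OF local_PL_reflect local_PL_reflect inverse_pair_reflect s(2,4) d(1)] \<theta> by blast
  have h2': "\<theta> (f (\<theta>' (1 - y))) = 1 - 2 powi (q' * l) * y" if "0 \<le> y" "y \<le> h2" for y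
    using h2(2)[OF that] by (simp add: reflect_def)
  obtain u where u: "u \<in> dyadic" "0 < u" "u < min h1 (1/2)" using dyadic_between[of 0 "min h1 (1/2)"] h1 by auto
  obtain w where w: "w \<in> dyadic" "0 < w" "w < min h2 (1/2)" using dyadic_between[of 0 "min h2 (1/2)"] h2 by auto
  define v where "v = 1 - w"
  have v: "v \<in> dyadic" "u < v" "v < 1" "1 - v < h2" using u w by (auto simp: v_def)
  let ?g = "\<lambda>t. \<theta> (f (\<theta>' t))"
  have 1: "PL \<theta>' u v" using \<theta>(2) u v by (simp add: local_PL_def)
  have r1: "0 < \<theta>' u" "\<theta>' u \<le> \<theta>' v" "\<theta>' v < 1"
    using \<theta>(2) u v local_PL_le[OF \<theta>(2), of u v] by (auto simp: local_PL_def)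
  have "PL f (\<theta>' u) (\<theta>' v)" using PL_subinterval[OF fd(2)] r1 by simp
  then have 2: "PL (\<lambda>t. f (\<theta>' t)) u v" by (rule PL_compose[OF _ 1]) auto
  have r2: "0 < f (\<theta>' u)" "f (\<theta>' u) \<le> f (\<theta>' v)" "f (\<theta>' v) < 1"
    using PL_less[OF fd(2), of 0 "\<theta>' u"] PL_less[OF fd(2), of "\<theta>' v" 1] r1 fd
      PL_le_iff[OF fd(2), of "\<theta>' u" "\<theta>' v"] by auto
  then have "PL \<theta> (f (\<theta>' u)) (f (\<theta>' v))" using \<theta>(1) by (simp add: local_PL_def)
  then have mid: "PL ?g u v" by (rule PL_compose[OF _ 2]) auto
  have left: "PL ?g 0 u" by (rule PL.affine[of _ _ 0 _ "q * k"]) (use u h1 in auto)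
  have eq: "?g t = 2 powi (q' * l) * t + (1 - 2 powi (q' * l))" if "v \<le> t" "t \<le> 1" for t
    using h2'[of "1 - t"] that v by (simp add: algebra_simps)
  have right: "PL ?g v 1"
    by (rule PL.affine[OF _ _ eq]) (use v in \<open>auto intro: dyadic_diff dyadic_powi\<close>)
  have PLg: "PL ?g 0 1" using left mid right u v by (blast intro: PL.join)
  have ends: "?g 0 = 0" "?g 1 = 1" using \<theta> fd by (auto simp: local_PL_def)
  show "transport \<theta> \<theta>' f \<in> carrier thompson_F"
    unfolding transport_def using PLg ends by (rule restrict_in_F)
  show "phi (transport \<theta> \<theta>' f) = (q * k, q' * l)"
    by (rule phi_eqI[of "min u w"]) (use u w h1 h2' in \<open>auto simp: transport_def\<close>)
qed

lemma transport_mult: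
  assumes \<theta>: "local_PL \<theta>" "local_PL \<theta>'" "inverse_pair \<theta> \<theta>'"
    and "f \<in> carrier thompson_F" "g \<in> carrier thompson_F"
    "transport \<theta> \<theta>' f \<in> carrier thompson_F" "transport \<theta> \<theta>' g \<in> carrier thompson_F"
  shows "transport \<theta> \<theta>' (f \<otimes>\<^bsub>thompson_F\<^esub> g) = transport \<theta> \<theta>' f \<otimes>\<^bsub>thompson_F\<^esub> transport \<theta> \<theta>' g"
proof -
  have "transport \<theta> \<theta>' (f \<otimes>\<^bsub>thompson_F\<^esub> g) t = (transport \<theta> \<theta>' f \<otimes>\<^bsub>thompson_F\<^esub> transport \<theta> \<theta>' g) t" for t
  proof (cases "t \<in> {0..1}")
    case True
    then have r: "0 \<le> \<theta>' t" "\<theta>' t \<le> 1" using local_PL_range[OF \<theta>(2)] by auto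
    then have r2: "0 \<le> g (\<theta>' t)" "g (\<theta>' t) \<le> 1" using F_range assms by auto
    have "0 \<le> \<theta> (g (\<theta>' t))" "\<theta> (g (\<theta>' t)) \<le> 1" using local_PL_range[OF \<theta>(1)] r2 by auto
    then show ?thesis using True r r2 assms by (simp add: F_mult_apply transport_def inverse_pair_def)
  next
    case False
    have "transport \<theta> \<theta>' f \<otimes>\<^bsub>thompson_F\<^esub> transport \<theta> \<theta>' g \<in> extensional {0..1}"
      using assms by (intro F_D) auto
    then show ?thesis using False by (auto simp: transport_def extensional_def)
  qed
  then show ?thesis by blast
qed

lemma transport_inverse:
  assumes \<theta>: "local_PL \<theta>" "local_PL \<theta>'" "inverse_pair \<theta> \<theta>'" and f: "f \<in> carrier thompson_F"
  shows "transport \<theta>' \<theta> (transport \<theta> \<theta>' f) = f"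
proof (rule extensionalityI[of _ "{0..1}"])
  fix t :: real assume "t \<in> {0..1}"
  then show "transport \<theta>' \<theta> (transport \<theta> \<theta>' f) t = f t"
    using local_PL_range[OF \<theta>(1), of t] F_range[OF f, of t] \<theta>(3)
    by (auto simp: transport_def inverse_pair_def)
qed (use F_D[OF f] in \<open>auto simp: transport_def\<close>)

definition glue_halves :: "(real \<Rightarrow> real) \<Rightarrow> (real \<Rightarrow> real) \<Rightarrow> real \<Rightarrow> real" where
  "glue_halves S S' t = (if t \<le> 1/2 then S (2 * t) / 2 else 1 - S' (2 * (1 - t)) / 2)"

lemma renormalisation_exists:
  assumes "a > 0" "b > 0"
  obtains \<theta> \<theta>' where "local_PL \<theta>" "local_PL \<theta>'" "inverse_pair \<theta> \<theta>'"
    "scales_at_0 \<theta> a 1" "scales_at_0 (reflect \<theta>) b 1"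
proof -
  obtain S where S: "S 0 = 0" "S 1 = 1" "\<And>c. 0 < c \<Longrightarrow> c \<le> 1 \<Longrightarrow> PL S c 1"
    "\<And>t. 0 \<le> t \<Longrightarrow> S (2 powi (- a) * t) = S t / 2" "\<And>t. 0 < t \<Longrightarrow> t \<le> 1 \<Longrightarrow> 0 < S t"
    "\<And>y. 0 < y \<Longrightarrow> y \<le> 1 \<Longrightarrow> \<exists>t. 0 < t \<and> t \<le> 1 \<and> S t = y"
    using self_similar_exists[OF assms(1)] by blast
  obtain R where R: "R 0 = 0" "R 1 = 1" "\<And>c. 0 < c \<Longrightarrow> c \<le> 1 \<Longrightarrow> PL R c 1"
    "\<And>t. 0 \<le> t \<Longrightarrow> R (2 powi (- b) * t) = R t / 2" "\<And>t. 0 < t \<Longrightarrow> t \<le> 1 \<Longrightarrow> 0 < R t"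
    "\<And>y. 0 < y \<Longrightarrow> y \<le> 1 \<Longrightarrow> \<exists>t. 0 < t \<and> t \<le> 1 \<and> R t = y"
    using self_similar_exists[OF assms(2)] by blast
  have PL_half: "PL (glue_halves S' R') c (1/2)"
    if "\<And>c. 0 < c \<Longrightarrow> c \<le> 1 \<Longrightarrow> PL S' c 1" "0 < c" "c \<le> 1/2" for S' R' c
  proof -
    have 1: "PL (\<lambda>t. 2 powi 1 * t + 0) c (1/2)" using that by (intro PL_affine) auto
    have 2: "PL S' (2 * c) 1" using that by auto
    have "PL (\<lambda>t. S' (2 powi 1 * t + 0)) c (1/2)" by (rule PL_compose[OF 2 1]) auto
    then have "PL (\<lambda>t. 2 powi (-1) * S' (2 powi 1 * t + 0) + 0) c (1/2)"
      by (rule PL_compose_affine[OF _ dyadic_0, where k = "-1"]) simp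
    then show ?thesis by (rule PL_cong) (auto simp: glue_halves_def power_int_minus)
  qed
  let ?\<theta> = "glue_halves S R"
  have refl: "reflect ?\<theta> t = glue_halves R S t" for t
  proof (cases "t = 1/2")
    case True
    show ?thesis unfolding True using S(2) R(2) by (simp add: reflect_def glue_halves_def)
  qed (auto simp: reflect_def glue_halves_def)
  have upper: "PL ?\<theta> (1/2) d" if d: "1/2 \<le> d" "d < 1" for d
  proof -
    have "PL (glue_halves R S) (1 - d) (1/2)" using d by (intro PL_half R(3)) auto
    from PL_reflect[OF this] have "PL (\<lambda>t. 1 - glue_halves R S (1 - t)) (1/2) d" by simp
    then show ?thesis by (rule PL_cong) (simp add: refl[symmetric] reflect_def)
  qed
  have half_lt: "S' t \<le> 1" if "\<And>c. 0 < c \<Longrightarrow> c \<le> 1 \<Longrightarrow> PL S' c 1" "S' 1 = 1" "0 < t" "t \<le> 1" for S' :: "real \<Rightarrow> real" and t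
    using PL_le_iff[OF that(1)[OF that(3,4)], of t 1] that by auto
  have "local_PL ?\<theta>" unfolding local_PL_def
  proof (intro conjI allI impI)
    show "?\<theta> 0 = 0" "?\<theta> 1 = 1" using S R by (auto simp: glue_halves_def)
    fix t :: real assume t: "0 < t" "t < 1"
    show "0 < ?\<theta> t" "?\<theta> t < 1"
      using S(5)[of "2 * t"] R(5)[of "2 * (1 - t)"] half_lt[OF S(3,2), of "2 * t"] half_lt[OF R(3,2), of "2 * (1 - t)"] t
      by (auto simp: glue_halves_def)
  next
    fix c d :: real assume cd: "0 < c" "c \<le> d" "d < 1"
    have "PL ?\<theta> (min c (1/2)) (1/2)" using cd by (intro PL_half S(3)) auto
    moreover have "PL ?\<theta> (1/2) (max d (1/2))" using cd by (intro upper) auto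
    ultimately have "PL ?\<theta> (min c (1/2)) (max d (1/2))"
      using dyadic_half[OF dyadic_1] by (rule PL.join)
    then show "PL ?\<theta> c d" by (rule PL_subinterval) (use cd in auto)
  qed
  moreover have "\<exists>t. 0 < t \<and> t < 1 \<and> ?\<theta> t = y" if y: "0 < y" "y < 1" for y
  proof (cases "y \<le> 1/2")
    case True
    then obtain t where "0 < t" "t \<le> 1" "S t = 2 * y" using S(6)[of "2 * y"] y by auto
    then show ?thesis by (intro exI[of _ "t / 2"]) (auto simp: glue_halves_def)
  next
    case False
    then obtain t where t: "0 < t" "t \<le> 1" "R t = 2 * (1 - y)" using R(6)[of "2 * (1 - y)"] y by auto
    moreover have "t \<noteq> 1" using t R(2) False by auto
    ultimately show ?thesis by (intro exI[of _ "1 - t / 2"]) (auto simp: glue_halves_def field_simps)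
  qed
  moreover have scale: "scales_at_0 (glue_halves S' R') c 1"
    if "c > 0" and S': "\<And>t. 0 \<le> t \<Longrightarrow> S' (2 powi (- c) * t) = S' t / 2" for S' R' c
  proof -
    have "glue_halves S' R' (2 powi (- c) * t) = 2 powi (- 1) * glue_halves S' R' t"
      if t: "0 \<le> t" "t \<le> 1/2" for t
    proof -
      have "2 powi (- c) \<le> (2::real) powi 0" using \<open>c > 0\<close> by (intro power_int_increasing) auto
      then have "2 powi (- c) * t \<le> 1 * (1/2)" using t by (intro mult_mono) auto
      moreover have "S' (2 powi (- c) * (2 * t)) = S' (2 * t) / 2" using \<open>0 \<le> t\<close> by (intro S') auto
      then have "S' (2 * (2 powi (- c) * t)) = S' (2 * t) / 2" by (simp only: mult.left_commute)
      ultimately show ?thesis using t by (simp add: glue_halves_def power_int_minus)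
    qed
    then show ?thesis unfolding scales_at_0_def by (intro exI[of _ "1/2"]) auto
  qed
  moreover have "reflect ?\<theta> = glue_halves R S" using refl by blast
  ultimately show ?thesis using local_PL_has_inverse[of ?\<theta>] that[of ?\<theta>] assms S(4) R(4) by metis
qed

lemma K_iso:
  assumes "a > 0" "b > 0"
  shows "thompson_F\<lparr>carrier := K a b\<rparr> \<cong> thompson_F"
proof -
  obtain \<theta> \<theta>' where \<theta>: "local_PL \<theta>" "local_PL \<theta>'" "inverse_pair \<theta> \<theta>'"
    "scales_at_0 \<theta> a 1" "scales_at_0 (reflect \<theta>) b 1"
    using renormalisation_exists[OF assms(1,2)] by metis
  have \<theta>': "inverse_pair \<theta>' \<theta>" "scales_at_0 \<theta>' 1 a" "scales_at_0 (reflect \<theta>') 1 b"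
    using \<theta> assms inverse_pair_sym scales_at_0_inverse[OF \<theta>(1-4)]
      scales_at_0_inverse[OF local_PL_reflect[OF \<theta>(1)] local_PL_reflect[OF \<theta>(2)] inverse_pair_reflect[OF \<theta>(3)] \<theta>(5)]
    by auto
  have to: "transport \<theta> \<theta>' f \<in> carrier thompson_F" if f: "f \<in> K a b" for f
  proof -
    obtain k l where "phi f = (a * k, b * l)" using f by (cases "phi f") (auto simp: K_def Ktilde_eq dvd_def)
    then show ?thesis using transport_in_F(1)[OF \<theta>] f assms by (simp add: K_def Ktilde_eq mem_Times_iff)
  qed
  have from': "transport \<theta>' \<theta> f \<in> K a b" if f: "f \<in> carrier thompson_F" for f
  proof -
    have "phi f = (1 * fst (phi f), 1 * snd (phi f))" by simp
    from transport_in_F[OF \<theta>(2,1) \<theta>' _ _ f this] show ?thesis by (simp add: K_def Ktilde_eq mem_Times_iff)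
  qed
  have HF: "f \<in> carrier thompson_F" if "f \<in> K a b" for f using that by (simp add: K_def Ktilde_eq mem_Times_iff)
  have "transport \<theta> \<theta>' \<in> iso (thompson_F\<lparr>carrier := K a b\<rparr>) thompson_F"
  proof (rule isoI)
    show "transport \<theta> \<theta>' \<in> hom (thompson_F\<lparr>carrier := K a b\<rparr>) thompson_F"
      by (rule homI) (use to HF transport_mult[OF \<theta>(1-3)] in auto)
    show "bij_betw (transport \<theta> \<theta>') (carrier (thompson_F\<lparr>carrier := K a b\<rparr>)) (carrier thompson_F)"
      by (rule bij_betwI[of _ _ _ "transport \<theta>' \<theta>"])
        (use to from' HF transport_inverse[OF \<theta>(1-3)] transport_inverse[OF \<theta>(2,1) \<theta>'(1)] in auto)
  qed
  then show ?thesis by (auto simp: is_iso_def)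
qed

section \<open>The correspondence and the diagram\<close>

theorem theorem1p6:
  shows
    "bij_betw (\<lambda>H. phi ` H)
       {H. finite_index_subgroup H thompson_F} {L. finite_index_subgroup L Z2}
     \<and>
     (\<forall>H Htilde a b Q.
        finite_index_subgroup H thompson_F \<longrightarrow> Htilde = phi ` H \<longrightarrow>
        a > 0 \<longrightarrow> b > 0 \<longrightarrow> Inner H = K a b \<longrightarrow> K a b \<subseteq> H \<longrightarrow>
        Q = (Z2\<lparr>carrier := Htilde\<rparr>) Mod (Ktilde a b) \<longrightarrow>
          finite (carrier Q) \<and> cyclic_group Q \<and>
          thompson_F\<lparr>carrier := K a b\<rparr> \<cong> thompson_F \<and>
          (\<exists>\<iota> \<rho> \<iota>' \<rho>'.
             short_exact (thompson_F\<lparr>carrier := K a b\<rparr>) \<iota> (thompson_F\<lparr>carrier := H\<rparr>) \<rho> Q \<and>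
             short_exact (Z2\<lparr>carrier := Ktilde a b\<rparr>) \<iota>' (Z2\<lparr>carrier := Htilde\<rparr>) \<rho>' Q \<and>
             (\<forall>f\<in>K a b. phi (\<iota> f) = \<iota>' (phi f)) \<and>
             (\<forall>h\<in>H. \<rho> h = \<rho>' (phi h))))"
proof (intro conjI allI impI)
  show "bij_betw (\<lambda>H. phi ` H) {H. finite_index_subgroup H thompson_F} {L. finite_index_subgroup L Z2}"
    using phi.finite_index_correspondence[OF phi_onto] ker_phi_subset by (simp add: kernel_phi)
next
  fix H Htilde a b Q
  assume H: "finite_index_subgroup H thompson_F" and L: "Htilde = phi ` H" and ab: "a > 0" "b > 0"
    and inner: "Inner H = K a b" and KH: "K a b \<subseteq> H"
    and Q: "Q = (Z2\<lparr>carrier := Htilde\<rparr>) Mod (Ktilde a b)"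
  have HF: "subgroup H thompson_F" using H by (simp add: finite_index_subgroup_def)
  have LZ: "subgroup Htilde Z2" unfolding L using HF by (rule phi.subgroup_img_is_subgroup)
  have NL: "Ktilde a b \<subseteq> Htilde" unfolding L phi_K[symmetric] using KH by (rule image_mono)
  have axes: "(x, 0) \<in> Htilde \<longleftrightarrow> a dvd x" "(0, y) \<in> Htilde \<longleftrightarrow> b dvd y" for x y
    unfolding L using Inner_axes[OF H ab inner] by auto
  interpret L: comm_group "Z2\<lparr>carrier := Htilde\<rparr>" by (rule Z2_subgroup_comm[OF LZ])
  have N: "subgroup (Ktilde a b) (Z2\<lparr>carrier := Htilde\<rparr>)"
    using Z2.subgroup_incl[OF Ktilde_subgroup LZ NL] .
  interpret N: normal "Ktilde a b" "Z2\<lparr>carrier := Htilde\<rparr>" by (rule L.subgroup_imp_normal[OF N])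
  show "finite (carrier Q)" unfolding Q by (rule quotient_finite[OF ab LZ NL])
  show "cyclic_group Q" unfolding Q
    by (rule quotient_cyclic[OF LZ N _ ab(1)]) (auto simp: axes Ktilde_eq)
  show "thompson_F\<lparr>carrier := K a b\<rparr> \<cong> thompson_F" using ab by (rule K_iso)
  define \<pi> where "\<pi> = (\<lambda>x. Ktilde a b #>\<^bsub>Z2\<lparr>carrier := Htilde\<rparr>\<^esub> x)"
  have \<pi>: "group_hom (Z2\<lparr>carrier := Htilde\<rparr>) Q \<pi>"
    unfolding Q \<pi>_def using N.r_coset_hom_Mod N.factorgroup_is_group L.is_group
    by (intro group_hom.intro group_hom_axioms.intro)
  have onto: "\<pi> ` Htilde = carrier Q" by (auto simp: Q \<pi>_def FactGroup_def RCOSETS_def)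
  have ker: "\<pi> x = \<one>\<^bsub>Q\<^esub> \<longleftrightarrow> x \<in> Ktilde a b" if "x \<in> Htilde" for x
    using L.coset_join1[OF _ _ N, of x] L.coset_join2[OF _ N, of x] that
    by (auto simp: Q \<pi>_def FactGroup_def)
  have 1: "short_exact (thompson_F\<lparr>carrier := K a b\<rparr>) id (thompson_F\<lparr>carrier := H\<rparr>) (\<lambda>h. \<pi> (phi h)) Q"
  proof (rule short_exact_restrict[OF phi_hom HF K_subgroup KH])
    show "\<pi> (phi x) = \<one>\<^bsub>Q\<^esub> \<longleftrightarrow> x \<in> K a b" if "x \<in> H" for x
      using ker[of "phi x"] that subgroup.mem_carrier[OF HF that] by (simp add: L K_def)
  qed (use \<pi> onto in \<open>auto simp: L\<close>)
  have idZ: "group_hom Z2 Z2 id" by (intro group_hom.intro group_hom_axioms.intro homI) auto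
  have 2: "short_exact (Z2\<lparr>carrier := Ktilde a b\<rparr>) id (Z2\<lparr>carrier := Htilde\<rparr>) (\<lambda>x. \<pi> (id x)) Q"
    by (rule short_exact_restrict[OF idZ LZ Ktilde_subgroup NL]) (use \<pi> onto ker in auto)
  show "\<exists>\<iota> \<rho> \<iota>' \<rho>'.
     short_exact (thompson_F\<lparr>carrier := K a b\<rparr>) \<iota> (thompson_F\<lparr>carrier := H\<rparr>) \<rho> Q \<and>
     short_exact (Z2\<lparr>carrier := Ktilde a b\<rparr>) \<iota>' (Z2\<lparr>carrier := Htilde\<rparr>) \<rho>' Q \<and>
     (\<forall>f\<in>K a b. phi (\<iota> f) = \<iota>' (phi f)) \<and> (\<forall>h\<in>H. \<rho> h = \<rho>' (phi h))"
    using 1 2 by (intro exI[of _ id] exI[of _ "\<lambda>h. \<pi> (phi h)"] exI[of _ \<pi>]) simp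
qed

end
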